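(* Let $p>1$, $\alpha_2=2p-1$, $\alpha_1\ge p-1$, $\alpha_0\ge\alpha_1-p$, $\eta>-1$, $\gamma=(\alpha_2+(p-1)\eta)/p$, and $\theta\in\mathbb R$. Then there exists a constant $C=C(p,\eta)>0$ such that for all $u\in X^{2,p}_\infty(\alpha_0,\alpha_1,\alpha_2)$ satisfying $\|L_{\theta,\gamma}u\|_{L^p_{\alpha_2+(\theta-\gamma)p}}\le1$, $$\int_0^\infty\frac{\exp_p\left(\beta_{0,2}|u|^{\frac p{p-1}}\right)}{(1+|u|)^{\frac p{p-1}}}\,r^\eta\,dr\le C\|u\|^p_{L^p_\eta},$$ where $\beta_{0,2}=(\eta+1)(\gamma-1)^{\frac p{p-1}}$.
   Context: For $p\ge1$ and $\alpha\in\mathbb R$, $\|u\|_{L^p_\alpha}=\left(\int_0^\infty|u|^pr^\alpha\,dr\right)^{1/p}$, and $L^p_\alpha$ is the space of measurable $u:(0,\infty)\to\mathbb R$ with finite such norm. $X^{2,p}_\infty(\alpha_0,\alpha_1,\alpha_2)$ is the space of functions $u:(0,\infty)\to\mathbb R$ whose weak derivatives satisfy $u^{(j)}\in L^p_{\alpha_j}$ for $j=0,1,2$ (so $u'$ is locally absolutely continuous on $(0,\infty)$). $L_{\theta,\gamma}u=-r^{-\theta}(r^\gamma u')'$. For real $p>1$ and $t\ge0$, $\exp_p(t):=\sum_{j=0}^\infty\frac{t^{p-1+j}}{\Gamma(p+j)}$. *)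

theory Defs
  imports "HOL-Analysis.Analysis"
begin

text \<open>Functions on $(0,\infty)$ are total functions on the reals of which only the values on
  \<open>{0<..}\<close> matter. Norms and the integrals in the inequality take values in \<^typ>\<open>ennreal\<close>, so
  that divergent ones are \<open>top\<close> instead of a default value.\<close>

definition ennpowr :: "ennreal \<Rightarrow> real \<Rightarrow> ennreal"  \<comment> \<open>only used with positive exponents\<close>
  where "ennpowr x a = (if x = top then top else ennreal (enn2real x powr a))"

definition wLp_norm :: "real \<Rightarrow> real \<Rightarrow> (real \<Rightarrow> real) \<Rightarrow> ennreal"
  where "wLp_norm p \<alpha> u =
    ennpowr (\<integral>\<^sup>+ r \<in> {0<..}. ennreal (\<bar>u r\<bar> powr p * r powr \<alpha>) \<partial>lebesgue) (1 / p)"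

definition wLp :: "real \<Rightarrow> real \<Rightarrow> (real \<Rightarrow> real) set"
  where "wLp p \<alpha> = {u. u \<in> borel_measurable (lebesgue_on {0<..}) \<and> wLp_norm p \<alpha> u < top}"

definition locally_integrable :: "(real \<Rightarrow> real) \<Rightarrow> bool"
  where "locally_integrable u \<longleftrightarrow>
    (\<forall>K. compact K \<and> K \<subseteq> {0<..} \<longrightarrow> u absolutely_integrable_on K)"

definition test_function :: "(real \<Rightarrow> real) \<Rightarrow> bool"
  where "test_function \<phi> \<longleftrightarrow>
    (\<forall>k x. (deriv ^^ k) \<phi> differentiable (at x)) \<and>
    compact (closure {x. \<phi> x \<noteq> 0}) \<and> closure {x. \<phi> x \<noteq> 0} \<subseteq> {0<..}"

definition has_weak_deriv :: "nat \<Rightarrow> (real \<Rightarrow> real) \<Rightarrow> (real \<Rightarrow> real) \<Rightarrow> bool"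
  where "has_weak_deriv k u v \<longleftrightarrow>
    locally_integrable u \<and> locally_integrable v \<and>
    (\<forall>\<phi>. test_function \<phi> \<longrightarrow>
      (LINT r:{0<..}|lebesgue. v r * \<phi> r) =
        (-1) ^ k * (LINT r:{0<..}|lebesgue. u r * (deriv ^^ k) \<phi> r))"

text \<open>A representative of the first weak derivative, which is unique almost everywhere on
  \<open>{0<..}\<close>; only quantities invariant under null-set changes are formed from it.\<close>

definition weak_deriv :: "(real \<Rightarrow> real) \<Rightarrow> real \<Rightarrow> real"
  where "weak_deriv u = (SOME v. has_weak_deriv 1 u v)"

definition X2 :: "real \<Rightarrow> real \<Rightarrow> real \<Rightarrow> real \<Rightarrow> (real \<Rightarrow> real) set"
  where "X2 p \<alpha>0 \<alpha>1 \<alpha>2 =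
    {u. u \<in> wLp p \<alpha>0 \<and> (\<exists>v \<in> wLp p \<alpha>1. has_weak_deriv 1 u v) \<and>
        (\<exists>w \<in> wLp p \<alpha>2. has_weak_deriv 2 u w)}"

definition L_op :: "real \<Rightarrow> real \<Rightarrow> (real \<Rightarrow> real) \<Rightarrow> real \<Rightarrow> real"
  where "L_op \<theta> \<gamma> u =
    (\<lambda>r. - (r powr (- \<theta>)) * weak_deriv (\<lambda>s. s powr \<gamma> * weak_deriv u s) r)"

definition exp_tail :: "real \<Rightarrow> real \<Rightarrow> real"
  where "exp_tail p t = (\<Sum>j. t powr (p - 1 + real j) / Gamma (p + real j))"

end

theory Submission
  imports Defs
begin

text \<open>Write $q = p/(p-1)$ and $g = (r^\gamma u')'$, so that the hypothesis on $L_{\theta,\gamma}u$ reads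
  $\int_0^\infty |g|^p r^{-(p-1)\eta}\,dr \le 1$, independently of $\theta$. Three things make the
  inequality true.

  \<^emph>\<open>A potential with a sharp kernel.\<close> Since $u'' \in L^p_{2p-1}$ and $\gamma > 1$, the flux
  $r^\gamma u'$ vanishes at $0$ (\<open>derivative_growth_at_0\<close>, \<open>flux_bound\<close>), hence
  $|r^\gamma u'(r)| \le \int_0^r |g|$. Integrating once more, $|u(x)| - |u(y)|$ is for $x \le y$ at most
  the integral of $|g|$ over $(0,y)$ against the kernel $\max(x,z)^{1-\gamma}/(\gamma-1)$
  (\<open>potential_bound\<close>). The $q$-th power of this kernel in the dual weight is $1/z$ between $x$ and
  $y$, and has finite mass on $(0,x)$. So Hoelder's inequality (\<open>two_scale_bound\<close>) gives logarithmic
  growth, with the constant that enters $\beta$: for $W = \beta^{1/q}|u|$ and the variable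
  $t = \ln M - (\eta+1)\ln r$, where $M$ is a multiple of $\|u\|^p_{L^p_\eta}$, the increment of $W$ over a
  $t$-interval of length $\ell$ is about $e\,\ell^{1/q}$ where $e^p$ is the energy of $g$ on that
  interval. This is recorded in the predicate \<open>log_growth\<close>, whose second half says that the
  $L^p_\eta$ norm forces $W \le e^{s/p}$ somewhere in each interval $[s-1,s]$.

  \<^emph>\<open>Starting the growth at the right place.\<close> Growth by $(t-s)^{1/q}$ from a point near $s$ gives
  $W(t)^q \le t - s + \ldots$ with an error of order $e^{s/p} t^{1/p}$. The choice $s = -\ln t$ makes that
  error bounded at the price of $\ln t$; as $W^q$ is then about $t$, dividing $e^{W^q}$ by $W^q$ pays
  exactly this price, and $e^{W^q}/W^q \le C e^{t}$ (\<open>log_growth_upper\<close>). This is the role of the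
  denominator in the statement.

  \<^emph>\<open>Near-maximal growth is rare.\<close> The bound $C e^t$ alone integrates to a divergent integral
  $\int dt$. However, if $e^{W^q}/W^q \ge e^{t-\lambda}$ at $t_1$, almost all energy was spent before
  $t_1$, and what is left cannot sustain the growth for longer than $O(1+\lambda)$
  (\<open>two_point\<close>, \<open>log_growth_level_set\<close>; this is the mechanism of Adams's proof of the
  Moser-Trudinger inequality). Thus the level sets have length $O(1+\lambda)$, and summing
  $e^{-\lambda}(1+\lambda)$ over integers $\lambda$ gives a bound proportional to $M$
  (\<open>log_growth_covering\<close>, \<open>log_growth_majorant\<close>). Where $W < 4$ the integrand is at most a
  multiple of $W^p r^\eta$, by the behaviour of $\exp_p$ at $0$ (\<open>exp_tail_le_powr\<close>).

  The weak derivatives enter through their absolutely continuous representatives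
  (\<open>weak_deriv_antideriv\<close>), obtained from the du Bois-Reymond lemma.\<close>

section \<open>Smooth functions and test functions\<close>

definition smooth :: "(real \<Rightarrow> real) \<Rightarrow> bool"
  where "smooth f \<longleftrightarrow> (\<forall>k x. (deriv ^^ k) f differentiable (at x))"

text \<open>Smoothness is checked on a family of functions that is closed under differentiation, so that higher
  derivatives never have to be computed.\<close>

lemma smooth_coinduct:
  assumes "f \<in> S" and diff: "\<And>f x. f \<in> S \<Longrightarrow> f differentiable (at x)"
    and deriv: "\<And>f. f \<in> S \<Longrightarrow> deriv f \<in> S"
  shows "smooth f"
proof -
  have "(deriv ^^ k) f \<in> S" for k
    by (induction k) (use assms in auto)
  then show ?thesis using diff by (auto simp: smooth_def)
qed

lemma smooth_differentiable: "smooth f \<Longrightarrow> f differentiable (at x)"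
  unfolding smooth_def by (metis funpow_0)

lemma smooth_deriv: "smooth f \<Longrightarrow> smooth (deriv f)"
  unfolding smooth_def by (metis comp_apply funpow_Suc_right)

lemma smooth_has_deriv: "smooth f \<Longrightarrow> (f has_real_derivative deriv f x) (at x)"
  by (simp add: DERIV_deriv_iff_real_differentiable smooth_differentiable)

lemma smooth_continuous: "smooth f \<Longrightarrow> continuous_on A f"
  by (meson continuous_at_imp_continuous_on differentiable_imp_continuous_within smooth_differentiable)

lemma smooth_antideriv:
  assumes "smooth f" "\<And>x. (F has_real_derivative f x) (at x)"
  shows "smooth F"
proof (rule smooth_coinduct[of _ "insert F {f. smooth f}"])
  have "deriv F = f" using assms(2) by (auto intro: DERIV_imp_deriv)
  then show "deriv g \<in> insert F {f. smooth f}" if "g \<in> insert F {f. smooth f}" for g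
    using that assms(1) smooth_deriv by auto
qed (use assms smooth_differentiable real_differentiable_def in blast)+

text \<open>By the Leibniz rule, sums of products of smooth functions are closed under differentiation, unlike
  the products themselves.\<close>

inductive_set prod_sums :: "(real \<Rightarrow> real) set" where
  prod: "smooth f \<Longrightarrow> smooth g \<Longrightarrow> (\<lambda>x. f x * g x) \<in> prod_sums"
| add: "f \<in> prod_sums \<Longrightarrow> g \<in> prod_sums \<Longrightarrow> (\<lambda>x. f x + g x) \<in> prod_sums"

lemma prod_sums_smooth:
  assumes "f \<in> prod_sums" shows "smooth f"
proof -
  have *: "(\<forall>x. f differentiable (at x)) \<and> deriv f \<in> prod_sums" if "f \<in> prod_sums" for f
    using that
  proof induction
    case (prod f g)
    have D: "((\<lambda>x. f x * g x) has_real_derivative (deriv f x * g x + f x * deriv g x)) (at x)" for x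
      using prod by (auto intro!: derivative_eq_intros smooth_has_deriv)
    then have "deriv (\<lambda>x. f x * g x) = (\<lambda>x. deriv f x * g x + f x * deriv g x)"
      by (auto intro: DERIV_imp_deriv)
    moreover have "(\<lambda>x. deriv f x * g x + f x * deriv g x) \<in> prod_sums"
      using prod by (intro prod_sums.intros smooth_deriv)
    ultimately show ?case using D real_differentiable_def by auto
  next
    case (add f g)
    then have D: "((\<lambda>x. f x + g x) has_real_derivative (deriv f x + deriv g x)) (at x)" for x
      by (auto intro!: derivative_eq_intros simp: DERIV_deriv_iff_real_differentiable)
    then have "deriv (\<lambda>x. f x + g x) = (\<lambda>x. deriv f x + deriv g x)"
      by (auto intro: DERIV_imp_deriv)
    moreover have "(\<lambda>x. deriv f x + deriv g x) \<in> prod_sums"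
      using add by (intro prod_sums.add) auto
    ultimately show ?case using D real_differentiable_def by auto
  qed
  show ?thesis
    by (rule smooth_coinduct[of _ prod_sums]) (use * assms in auto)
qed

lemma smooth_mult: "smooth f \<Longrightarrow> smooth g \<Longrightarrow> smooth (\<lambda>x. f x * g x)"
  by (rule prod_sums_smooth[OF prod_sums.prod])

lemma smooth_const: "smooth (\<lambda>x. c)"
  by (rule smooth_coinduct[of _ "range (\<lambda>c x. c)"]) auto

lemma smooth_add: "smooth f \<Longrightarrow> smooth g \<Longrightarrow> smooth (\<lambda>x. f x + g x)"
proof -
  assume "smooth f" "smooth g"
  then have "(\<lambda>x. f x * 1 + g x * 1) \<in> prod_sums"
    by (intro prod_sums.intros smooth_const)
  then show ?thesis using prod_sums_smooth by simp
qed

lemma smooth_cmult: "smooth f \<Longrightarrow> smooth (\<lambda>x. c * f x)"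
  by (intro smooth_mult smooth_const)

lemma smooth_affine:
  assumes "smooth f" shows "smooth (\<lambda>x. f (a * x + b))"
proof (rule smooth_coinduct[of _ "{(\<lambda>x. c * f (a * x + b)) | c f. smooth f}"])
  show "(\<lambda>x. f (a * x + b)) \<in> {(\<lambda>x. c * f (a * x + b)) | c f. smooth f}"
    using assms by (auto intro!: exI[of _ 1] exI[of _ f])
  have D: "((\<lambda>x. c * f (a * x + b)) has_real_derivative (c * a) * deriv f (a * x + b)) (at x)"
    if "smooth f" for c f x
    using that by (auto intro!: derivative_eq_intros DERIV_chain2[OF smooth_has_deriv])
  then have D': "deriv (\<lambda>x. c * f (a * x + b)) = (\<lambda>x. (c * a) * deriv f (a * x + b))"
    if "smooth f" for c f
    using that by (auto intro!: DERIV_imp_deriv)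
  fix g assume g: "g \<in> {(\<lambda>x. c * f (a * x + b)) | c f. smooth f}"
  show "g differentiable (at x)" for x
    using g D real_differentiable_def by blast
  show "deriv g \<in> {(\<lambda>x. c * f (a * x + b)) | c f. smooth f}"
    using g D' smooth_deriv by fastforce
qed

text \<open>For \<open>P = 1\<close> this is the classical function $e^{-1/x}$, all of whose derivatives vanish at $0$. The
  polynomial factor makes the family closed under differentiation.\<close>

definition flat :: "real poly \<Rightarrow> real \<Rightarrow> real"
  where "flat P x = (if x > 0 then poly P (1 / x) * exp (- (1 / x)) else 0)"

lemma poly_times_exp_tendsto_0: "((\<lambda>y::real. poly P y * exp (- y)) \<longlongrightarrow> 0) at_top"
proof -
  have "((\<lambda>y::real. \<Sum>i\<le>degree P. coeff P i * (y ^ i / exp y)) \<longlongrightarrow> (\<Sum>i\<le>degree P. coeff P i * 0)) at_top"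
    by (intro tendsto_sum tendsto_mult tendsto_const tendsto_power_div_exp_0)
  moreover have "(\<Sum>i\<le>degree P. coeff P i * (y ^ i / exp y)) = poly P y * exp (- y)" for y
    by (simp add: poly_altdef sum_distrib_right exp_minus divide_inverse mult.assoc)
  ultimately show ?thesis by simp
qed

lemma flat_has_deriv:
  "(flat P has_real_derivative flat ([:0, 0, 1:] * (P - pderiv P)) x) (at x)"
proof -
  consider "x > 0" | "x < 0" | "x = 0" by linarith
  then show ?thesis
  proof cases
    case 1
    have "((\<lambda>x. poly P (1 / x) * exp (- (1 / x))) has_real_derivative
        flat ([:0, 0, 1:] * (P - pderiv P)) x) (at x)"
    proof -
      have inv: "((\<lambda>x. 1 / x) has_real_derivative - (1 / x\<^sup>2)) (at x)"
        using 1 by (auto intro!: derivative_eq_intros simp: power2_eq_square)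
      have "((\<lambda>x. poly P (1 / x) * exp (- (1 / x))) has_real_derivative
          (poly (pderiv P) (1 / x) * (- (1 / x\<^sup>2))) * exp (- (1 / x)) +
          (exp (- (1 / x)) * (- (- (1 / x\<^sup>2)))) * poly P (1 / x)) (at x)"
        by (intro DERIV_mult DERIV_chain2[OF poly_DERIV] DERIV_chain2[OF DERIV_exp] DERIV_minus inv)
      moreover have "(poly (pderiv P) (1 / x) * (- (1 / x\<^sup>2))) * exp (- (1 / x)) +
          (exp (- (1 / x)) * (- (- (1 / x\<^sup>2)))) * poly P (1 / x) =
          flat ([:0, 0, 1:] * (P - pderiv P)) x"
        using 1 by (simp add: flat_def power2_eq_square field_simps)
      ultimately show ?thesis by simp
    qed
    then show ?thesis
      by (rule has_field_derivative_transform_within_open[where S="{0<..}"]) (use 1 in \<open>auto simp: flat_def\<close>)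
  next
    case 2
    have "((\<lambda>x::real. 0::real) has_real_derivative flat ([:0, 0, 1:] * (P - pderiv P)) x) (at x)"
      using 2 unfolding flat_def by auto
    then show ?thesis
      by (rule has_field_derivative_transform_within_open[where S="{..<0}"]) (use 2 in \<open>auto simp: flat_def\<close>)
  next
    case 3
    have "((\<lambda>h. flat P h / h) \<longlongrightarrow> 0) (at_left 0)"
      by (rule tendsto_eventually) (auto simp: eventually_at_filter flat_def)
    moreover have "((\<lambda>h. flat P h / h) \<longlongrightarrow> 0) (at_right 0)"
    proof (subst filterlim_at_right_to_top, rule Lim_transform_eventually)
      show "((\<lambda>y. poly (pCons 0 P) y * exp (- y)) \<longlongrightarrow> 0) at_top"
        by (rule poly_times_exp_tendsto_0)
      show "\<forall>\<^sub>F y in at_top. poly (pCons 0 P) y * exp (- y) = flat P (inverse y) / inverse y"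
        using eventually_gt_at_top[of 0] by eventually_elim (auto simp: flat_def field_simps)
    qed
    ultimately have "((\<lambda>h. flat P h / h) \<longlongrightarrow> 0) (at 0)"
      by (simp add: filterlim_split_at)
    then show ?thesis using 3 by (simp add: DERIV_def flat_def)
  qed
qed

lemma smooth_flat: "smooth (flat P)"
proof (rule smooth_coinduct[of _ "range flat"])
  fix f assume "f \<in> range flat"
  then obtain P where f: "f = flat P" by auto
  show "f differentiable (at x)" for x
    using flat_has_deriv real_differentiable_def f by auto
  have "deriv f = flat ([:0, 0, 1:] * (P - pderiv P))"
    unfolding f using flat_has_deriv by (auto intro: DERIV_imp_deriv)
  then show "deriv f \<in> range flat" by auto
qed auto

text \<open>The supports stay in the interval from \<open>a\<close> to \<open>b\<close>, and the dilation by \<open>Suc n\<close> makes the values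
  increase to $1$ inside it.\<close>

definition bump :: "real \<Rightarrow> real \<Rightarrow> nat \<Rightarrow> real \<Rightarrow> real"
  where "bump a b n x = flat 1 (real (Suc n) * (x - a)) * flat 1 (real (Suc n) * (b - x))"

lemma smooth_bump: "smooth (bump a b n)"
proof -
  have "smooth (\<lambda>x. flat 1 (real (Suc n) * x + (- real (Suc n) * a)) *
        flat 1 (- real (Suc n) * x + real (Suc n) * b))"
    by (intro smooth_mult smooth_affine smooth_flat)
  then show ?thesis unfolding bump_def by (simp add: algebra_simps)
qed

lemma flat_1_nonneg: "0 \<le> flat 1 x" and flat_1_le_1: "flat 1 x \<le> 1"
  by (auto simp: flat_def)

lemma bump_nonneg: "0 \<le> bump a b n x"
  by (simp add: bump_def flat_1_nonneg)

lemma bump_le_1: "bump a b n x \<le> 1"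
  unfolding bump_def by (intro mult_le_one flat_1_nonneg flat_1_le_1)

lemma bump_eq_0: "x \<notin> {a<..<b} \<Longrightarrow> bump a b n x = 0"
  by (auto simp: bump_def flat_def zero_less_mult_iff)

lemma bump_pos: "x \<in> {a<..<b} \<Longrightarrow> bump a b n x > 0"
  by (auto simp: bump_def flat_def zero_less_mult_iff)

lemma bump_tendsto: "(\<lambda>n. bump a b n x) \<longlonglongrightarrow> indicator {a<..<b} x"
proof (cases "x \<in> {a<..<b}")
  case True
  have *: "(\<lambda>n. flat 1 (real (Suc n) * y)) \<longlonglongrightarrow> 1" if "y > 0" for y
  proof -
    have "(\<lambda>n. exp (- (inverse (real (Suc n)) / y))) \<longlonglongrightarrow> exp (- (0 / y))"
      using that by (intro tendsto_intros LIMSEQ_inverse_real_of_nat) auto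
    moreover have "exp (- (inverse (real (Suc n)) / y)) = flat 1 (real (Suc n) * y)" for n
      using that by (simp add: flat_def divide_simps zero_less_mult_iff)
    ultimately show ?thesis by simp
  qed
  have "(\<lambda>n. bump a b n x) \<longlonglongrightarrow> 1 * 1"
    unfolding bump_def using True by (intro tendsto_mult *) auto
  then show ?thesis using True by simp
qed (simp add: bump_eq_0)

lemma test_functionI:
  assumes "smooth f" "0 < a" "\<And>x. x \<notin> {a..b} \<Longrightarrow> f x = 0"
  shows "test_function f"
proof -
  have "closure {x. f x \<noteq> 0} \<subseteq> {a..b}"
  proof (rule closure_minimal)
    show "{x. f x \<noteq> 0} \<subseteq> {a..b}" using assms(3) by blast
  qed simp
  moreover from this have "compact (closure {x. f x \<noteq> 0})"
    by (meson bounded_closed_interval bounded_subset closed_closure compact_eq_bounded_closed)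
  ultimately show ?thesis
    using assms(1,2) unfolding test_function_def smooth_def by (auto dest!: subsetD)
qed

lemma test_function_bump: "0 < a \<Longrightarrow> test_function (bump a b n)"
  by (rule test_functionI[where a=a and b=b, OF smooth_bump]) (auto intro: bump_eq_0)

lemma test_function_smooth: "test_function f \<Longrightarrow> smooth f"
  by (simp add: test_function_def smooth_def)

lemma test_function_support:
  assumes "test_function f"
  obtains a b where "0 < a" "a < b" "\<forall>x. x \<notin> {a<..<b} \<longrightarrow> f x = 0 \<and> deriv f x = 0"
proof -
  let ?K = "closure {x. f x \<noteq> 0}"
  have K: "compact ?K" "?K \<subseteq> {0<..}" using assms by (auto simp: test_function_def)
  obtain a b where ab: "0 < a" "a < b" "?K \<subseteq> {a<..<b}"
  proof (cases "?K = {}")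
    case True
    with that[of 1 2] show ?thesis by auto
  next
    case False
    obtain a where a: "a \<in> ?K" "\<And>t. t \<in> ?K \<Longrightarrow> a \<le> t" using compact_attains_inf[OF K(1) False] by auto
    obtain b where b: "b \<in> ?K" "\<And>t. t \<in> ?K \<Longrightarrow> t \<le> b" using compact_attains_sup[OF K(1) False] by auto
    have "a > 0" "b > 0" "a \<le> b" using a b K by auto
    then show ?thesis using a b by (intro that[of "a / 2" "b + 1"]) force+
  qed
  have *: "deriv f x = 0" if "x \<notin> {a<..<b}" for x
  proof (rule DERIV_imp_deriv, rule has_field_derivative_transform_within_open[where S="- ?K"])
    show "((\<lambda>_. 0) has_real_derivative 0) (at x)" by simp
    show "x \<in> - ?K" using that ab by auto
    show "0 = f y" if "y \<in> - ?K" for y using that closure_subset by force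
  qed auto
  have **: "f x = 0" if "x \<notin> {a<..<b}" for x
  proof -
    have "x \<notin> ?K" using that ab by blast
    then show ?thesis using closure_subset[of "{x. f x \<noteq> 0}"] by auto
  qed
  show ?thesis by (rule that[OF ab(1,2)]) (use * ** in auto)
qed

lemma test_function_deriv:
  assumes "test_function f" shows "test_function (deriv f)"
proof -
  obtain a b where ab: "0 < a" "a < b" "\<forall>x. x \<notin> {a<..<b} \<longrightarrow> f x = 0 \<and> deriv f x = 0"
    by (rule test_function_support[OF assms])
  show ?thesis
  proof (rule test_functionI)
    show "smooth (deriv f)" by (rule smooth_deriv[OF test_function_smooth[OF assms]])
    show "deriv f x = 0" if "x \<notin> {a..b}" for x using ab(3) that by auto
  qed (rule ab(1))
qed

section \<open>Integration by parts for indefinite integrals\<close>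

lemma pair_sigma_finite_lebesgue: "pair_sigma_finite (lebesgue :: real measure) (lebesgue :: real measure)"
proof -
  have "sigma_finite_measure (lebesgue :: real measure)"
  proof
    show "\<exists>A::real set set. countable A \<and> A \<subseteq> sets lebesgue \<and> \<Union> A = space lebesgue \<and>
        (\<forall>a\<in>A. emeasure lebesgue a \<noteq> \<infinity>)"
    proof (intro exI[of _ "range (\<lambda>n::nat. {- real n..real n})"] conjI)
      have "\<exists>n::nat. x \<in> {- real n..real n}" for x :: real
        using real_arch_simple[of "\<bar>x\<bar>"] by (auto simp: abs_le_iff) (metis minus_le_iff)
      then show "(\<Union> (range (\<lambda>n::nat. {- real n..real n}))) = space lebesgue" by auto
    qed auto
  qed
  then show ?thesis by (simp add: pair_sigma_finite_def)
qed

lemma borel_imp_lebesgue_measurable: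
  "f \<in> borel_measurable borel \<Longrightarrow> f \<in> borel_measurable lebesgue"
  by (simp add: measurable_completion)

lemma lebesgue_pair_fst: "(\<lambda>z. fst z :: real) \<in> borel_measurable (lebesgue \<Otimes>\<^sub>M lebesgue)"
  and lebesgue_pair_snd: "(\<lambda>z. snd z :: real) \<in> borel_measurable (lebesgue \<Otimes>\<^sub>M lebesgue)"
  by (rule measurable_compose[OF measurable_fst], simp add: borel_imp_lebesgue_measurable)
     (rule measurable_compose[OF measurable_snd], simp add: borel_imp_lebesgue_measurable)

lemma integrable_triangle:
  fixes F G :: "real \<Rightarrow> real"
  assumes "integrable lebesgue F" "integrable lebesgue G"
  shows "integrable (lebesgue \<Otimes>\<^sub>M lebesgue) (\<lambda>(x, y). if y \<le> x then F x * G y else 0)"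
proof -
  interpret pair_sigma_finite "lebesgue :: real measure" "lebesgue :: real measure"
    by (rule pair_sigma_finite_lebesgue)
  note [measurable] = borel_measurable_integrable[OF assms(1)] borel_measurable_integrable[OF assms(2)]
    lebesgue_pair_fst lebesgue_pair_snd
  have "integrable (lebesgue \<Otimes>\<^sub>M lebesgue) (\<lambda>(x, y). F x * G y)"
  proof (rule Fubini_integrable)
    show "integrable lebesgue (\<lambda>x. \<integral>y. norm (case (x, y) of (x, y) \<Rightarrow> F x * G y) \<partial>lebesgue)"
      using assms by (simp add: abs_mult)
    show "AE x in lebesgue. integrable lebesgue (\<lambda>y. case (x, y) of (x, y) \<Rightarrow> F x * G y)"
      using assms by simp
  qed measurable
  then show ?thesis
    by (rule Bochner_Integration.integrable_bound) (auto simp: split_beta')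
qed

text \<open>As \<open>U\<close> need not be differentiable, the classical rule does not apply; instead both sides are the two
  iterated integrals of $v(y)\,\phi'(x)$ over the triangle $y \le x$.\<close>

lemma integration_by_parts_antiderivative:
  fixes v \<phi> \<phi>' U :: "real \<Rightarrow> real"
  assumes ab: "a \<le> b" and v: "v absolutely_integrable_on {a..b}"
    and U: "\<And>x. x \<in> {a..b} \<Longrightarrow> U x = U a + integral {a..x} v"
    and \<phi>: "\<And>x. x \<in> {a..b} \<Longrightarrow> (\<phi> has_real_derivative \<phi>' x) (at x within {a..b})"
    and \<phi>': "continuous_on {a..b} \<phi>'" and bd: "\<phi> a = 0" "\<phi> b = 0"
  shows "integral {a..b} (\<lambda>x. U x * \<phi>' x) = - integral {a..b} (\<lambda>x. v x * \<phi> x)"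
proof -
  interpret pair_sigma_finite "lebesgue :: real measure" "lebesgue :: real measure"
    by (rule pair_sigma_finite_lebesgue)
  define F where "F x = indicator {a..b} x * \<phi>' x" for x
  define G where "G x = indicator {a..b} x * v x" for x
  have F: "integrable lebesgue F" and G: "integrable lebesgue G"
    using absolutely_integrable_continuous_real[OF \<phi>'] v
    by (auto simp: set_integrable_def F_def[abs_def] G_def[abs_def])
  have FTC: "integral {c..b} \<phi>' = - \<phi> c" "\<phi>' integrable_on {c..b}" if "c \<in> {a..b}" for c
  proof -
    have "(\<phi> has_real_derivative \<phi>' x) (at x within {c..b})" if "x \<in> {c..b}" for x
      by (rule has_field_derivative_subset[OF \<phi>]) (use that \<open>c \<in> {a..b}\<close> in auto)
    then have "(\<phi>' has_integral (\<phi> b - \<phi> c)) {c..b}"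
      using that by (intro fundamental_theorem_of_calculus)
        (simp_all only: has_real_derivative_iff_has_vector_derivative atLeastAtMost_iff)
    then show "integral {c..b} \<phi>' = - \<phi> c" "\<phi>' integrable_on {c..b}"
      using bd by (auto simp: has_integral_integrable_integral)
  qed
  have "(\<integral>y. (\<integral>x. (if y \<le> x then F x * G y else 0) \<partial>lebesgue) \<partial>lebesgue) =
      (\<integral>x. (\<integral>y. (if y \<le> x then F x * G y else 0) \<partial>lebesgue) \<partial>lebesgue)"
    using Fubini_integral[OF integrable_triangle[OF F G]] by simp
  moreover have "(\<integral>x. (if y \<le> x then F x * G y else 0) \<partial>lebesgue) = indicator {a..b} y * (- (v y * \<phi> y))" for y
  proof (cases "y \<in> {a..b}")
    case True
    have "(\<integral>x. (if y \<le> x then F x * G y else 0) \<partial>lebesgue) =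
        (\<integral>x. v y * (indicator {y..b} x * \<phi>' x) \<partial>lebesgue)"
      using True by (intro Bochner_Integration.integral_cong) (auto simp: F_def G_def indicator_def)
    also have "\<dots> = v y * (LINT x:{y..b}|lebesgue. \<phi>' x)"
      by (simp add: set_lebesgue_integral_def)
    also have "(LINT x:{y..b}|lebesgue. \<phi>' x) = integral {y..b} \<phi>'"
      using True continuous_on_subset[OF \<phi>', of "{y..b}"]
      by (intro set_lebesgue_integral_eq_integral absolutely_integrable_continuous_real) auto
    finally show ?thesis using True FTC by simp
  qed (auto simp: G_def intro!: Bochner_Integration.integral_eq_zero_AE)
  moreover have "(\<integral>y. (if y \<le> x then F x * G y else 0) \<partial>lebesgue) =
      indicator {a..b} x * ((U x - U a) * \<phi>' x)" for x
  proof (cases "x \<in> {a..b}")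
    case True
    have "(\<integral>y. (if y \<le> x then F x * G y else 0) \<partial>lebesgue) =
        (\<integral>y. \<phi>' x * (indicator {a..x} y * v y) \<partial>lebesgue)"
      using True by (intro Bochner_Integration.integral_cong) (auto simp: F_def G_def indicator_def)
    also have "\<dots> = \<phi>' x * (LINT y:{a..x}|lebesgue. v y)"
      by (simp add: set_lebesgue_integral_def)
    also have "(LINT y:{a..x}|lebesgue. v y) = integral {a..x} v"
      using True by (intro set_lebesgue_integral_eq_integral absolutely_integrable_on_subinterval[OF v]) auto
    also have "integral {a..x} v = U x - U a" using U[OF True] by linarith
    finally show ?thesis using True by simp
  qed (auto simp: F_def intro!: Bochner_Integration.integral_eq_zero_AE)
  ultimately have eq: "(LINT y:{a..b}|lebesgue. - (v y * \<phi> y)) = (LINT x:{a..b}|lebesgue. (U x - U a) * \<phi>' x)"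
    by (simp add: set_lebesgue_integral_def)
  have \<phi>_cont: "continuous_on {a..b} \<phi>"
    using \<phi> DERIV_continuous continuous_on_eq_continuous_within by blast
  have I1: "(\<lambda>y. v y * \<phi> y) absolutely_integrable_on {a..b}"
    using absolutely_integrable_bounded_measurable_product_real[OF _ _ _ v, of \<phi>] \<phi>_cont
    by (simp add: mult.commute continuous_imp_measurable_on_sets_lebesgue compact_imp_bounded compact_continuous_image)
  have I1': "(\<lambda>y. - (v y * \<phi> y)) absolutely_integrable_on {a..b}"
    using I1 by (simp add: set_integrable_def)
  have "continuous_on {a..b} (\<lambda>x. integral {a..x} v)"
    using v by (intro indefinite_integral_continuous_1) (auto simp: absolutely_integrable_on_def)
  then have "continuous_on {a..b} (\<lambda>x. U a + integral {a..x} v)"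
    by (intro continuous_intros)
  then have U_cont: "continuous_on {a..b} U"
    by (rule continuous_on_eq) (rule U[symmetric])
  have I2: "(\<lambda>x. U x * \<phi>' x) absolutely_integrable_on {a..b}"
    "(\<lambda>x. (U x - U a) * \<phi>' x) absolutely_integrable_on {a..b}"
    by (intro absolutely_integrable_continuous_real continuous_intros U_cont \<phi>')+
  have "- integral {a..b} (\<lambda>x. v x * \<phi> x) = integral {a..b} (\<lambda>x. (U x - U a) * \<phi>' x)"
    using eq set_lebesgue_integral_eq_integral(2)[OF I2(2)]
      set_lebesgue_integral_eq_integral(2)[OF I1'] by simp
  also have "\<dots> = integral {a..b} (\<lambda>x. U x * \<phi>' x - U a * \<phi>' x)"
    by (simp add: algebra_simps)
  also have "\<dots> = integral {a..b} (\<lambda>x. U x * \<phi>' x) - U a * integral {a..b} \<phi>'"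
    using I2(1) FTC(2)[of a] ab
    by (subst Henstock_Kurzweil_Integration.integral_diff)
       (auto simp: absolutely_integrable_on_def intro: integrable_on_mult_right)
  also have "\<dots> = integral {a..b} (\<lambda>x. U x * \<phi>' x)"
    using FTC(1)[of a] ab bd by simp
  finally show ?thesis by simp
qed

section \<open>Weak derivatives\<close>

text \<open>\<open>U\<close> is locally absolutely continuous on the half-line with derivative \<open>v\<close> almost everywhere.\<close>

definition antideriv :: "(real \<Rightarrow> real) \<Rightarrow> (real \<Rightarrow> real) \<Rightarrow> bool"
  where "antideriv U v \<longleftrightarrow> (\<forall>a b. 0 < a \<and> a \<le> b \<longrightarrow> U b - U a = integral {a..b} v)"

lemma locally_integrable_interval:
  "locally_integrable v \<Longrightarrow> 0 < a \<Longrightarrow> v absolutely_integrable_on {a..b}"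
  by (simp add: locally_integrable_def subset_eq)

lemma LINT_pos_eq_integral:
  fixes f :: "real \<Rightarrow> real"
  assumes "f absolutely_integrable_on {a..b}" "0 < a" "\<And>x. x \<notin> {a<..<b} \<Longrightarrow> f x = 0"
  shows "(LINT r:{0<..}|lebesgue. f r) = integral {a..b} f" "set_integrable lebesgue {0<..} f"
proof -
  have *: "indicator {0<..} r *\<^sub>R f r = indicator {a..b} r *\<^sub>R f r" for r
  proof (cases "r \<in> {a<..<b}")
    case False
    then have "f r = 0" by (rule assms(3))
    then show ?thesis by simp
  qed (use assms(2) in \<open>auto simp: indicator_def\<close>)
  show "(LINT r:{0<..}|lebesgue. f r) = integral {a..b} f"
    unfolding set_lebesgue_integral_eq_integral(2)[OF assms(1), symmetric] set_lebesgue_integral_def *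
    by simp
  show "set_integrable lebesgue {0<..} f"
    using assms(1) unfolding set_integrable_def * .
qed

lemma absolutely_integrable_mult_continuous:
  fixes h \<phi> :: "real \<Rightarrow> real"
  assumes "h absolutely_integrable_on {a..b}" "continuous_on {a..b} \<phi>"
  shows "(\<lambda>x. h x * \<phi> x) absolutely_integrable_on {a..b}"
  using absolutely_integrable_bounded_measurable_product_real[OF _ _ _ assms(1), of \<phi>] assms(2)
  by (simp add: mult.commute continuous_imp_measurable_on_sets_lebesgue compact_imp_bounded compact_continuous_image)

lemma antideriv_exists:
  assumes "locally_integrable v" shows "\<exists>U. antideriv U v"
proof -
  define U where "U x = (if x \<ge> 1 then integral {1..x} v else - integral {x..1} v)" for x
  have int: "v integrable_on {a..b}" if "0 < a" for a b
    using locally_integrable_interval[OF assms that] by (auto simp: absolutely_integrable_on_def)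
  have C: "integral {a..c} v + integral {c..b} v = integral {a..b} v" if "0 < a" "a \<le> c" "c \<le> b" for a b c
    by (rule Henstock_Kurzweil_Integration.integral_combine) (use that int in auto)
  have "U b - U a = integral {a..b} v" if "0 < a" "a \<le> b" for a b
    using C[of a 1 b] C[of 1 a b] C[of a b 1] that by (cases "a \<ge> 1"; cases "b \<ge> 1") (auto simp: U_def)
  then show ?thesis by (auto simp: antideriv_def)
qed

lemma antideriv_continuous:
  assumes "antideriv U v" "locally_integrable v" "0 < a"
  shows "continuous_on {a..b} U"
proof -
  have "continuous_on {a..b} (\<lambda>x. integral {a..x} v)"
    using locally_integrable_interval[OF assms(2,3)]
    by (intro indefinite_integral_continuous_1) (auto simp: absolutely_integrable_on_def)
  then have "continuous_on {a..b} (\<lambda>x. U a + integral {a..x} v)"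
    by (intro continuous_intros)
  moreover have "U a + integral {a..x} v = U x" if "x \<in> {a..b}" for x
    using assms that unfolding antideriv_def by (metis add_diff_cancel_left' atLeastAtMost_iff diff_add_cancel)
  ultimately show ?thesis by (rule continuous_on_eq)
qed

lemma antideriv_integration_by_parts:
  assumes U: "antideriv U v" and v: "locally_integrable v" and ab: "0 < a" "a \<le> b"
    and \<phi>: "\<And>x. x \<in> {a..b} \<Longrightarrow> (\<phi> has_real_derivative \<phi>' x) (at x within {a..b})"
    and \<phi>': "continuous_on {a..b} \<phi>'"
    and out: "\<And>x. x \<notin> {a<..<b} \<Longrightarrow> \<phi> x = 0" "\<And>x. x \<notin> {a<..<b} \<Longrightarrow> \<phi>' x = 0"
  shows "(LINT r:{0<..}|lebesgue. U r * \<phi>' r) = - (LINT r:{0<..}|lebesgue. v r * \<phi> r)"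
proof -
  have vi: "v absolutely_integrable_on {a..b}" by (rule locally_integrable_interval[OF v ab(1)])
  have \<phi>_cont: "continuous_on {a..b} \<phi>"
    using \<phi> DERIV_continuous continuous_on_eq_continuous_within by blast
  have "(LINT r:{0<..}|lebesgue. U r * \<phi>' r) = integral {a..b} (\<lambda>r. U r * \<phi>' r)"
    by (rule LINT_pos_eq_integral(1))
       (use ab out in \<open>auto intro!: absolutely_integrable_continuous_real continuous_intros antideriv_continuous[OF U v] \<phi>'\<close>)
  also have "\<dots> = - integral {a..b} (\<lambda>r. v r * \<phi> r)"
  proof (rule integration_by_parts_antiderivative[OF ab(2) vi _ \<phi> \<phi>'])
    show "U x = U a + integral {a..x} v" if "x \<in> {a..b}" for x
      using U ab(1) that unfolding antideriv_def by (metis add_diff_cancel_left' atLeastAtMost_iff diff_add_cancel)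
  qed (auto intro: out)
  also have "integral {a..b} (\<lambda>r. v r * \<phi> r) = (LINT r:{0<..}|lebesgue. v r * \<phi> r)"
    by (rule LINT_pos_eq_integral(1)[symmetric])
       (use ab out in \<open>auto intro!: absolutely_integrable_mult_continuous vi \<phi>_cont\<close>)
  finally show ?thesis .
qed

text \<open>The primitive that vanishes to the left of the support is constant to its right, and the constant is
  the mean of the function.\<close>

lemma test_function_antideriv:
  assumes "test_function \<phi>" "(LINT r:{0<..}|lebesgue. \<phi> r) = 0"
  obtains \<Phi> where "test_function \<Phi>" "deriv \<Phi> = \<phi>"
proof -
  obtain a b where ab: "0 < a" "a < b" "\<forall>x. x \<notin> {a<..<b} \<longrightarrow> \<phi> x = 0 \<and> deriv \<phi> x = 0"
    by (rule test_function_support[OF assms(1)])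
  have cont: "continuous_on A \<phi>" for A
    using assms(1) by (intro smooth_continuous test_function_smooth)
  have int: "\<phi> integrable_on {x..y}" for x y by (intro integrable_continuous_real cont)
  define \<Phi> where "\<Phi> x = integral {a / 2..x} \<phi>" for x
  have zero: "integral {x..y} \<phi> = 0" if "\<forall>z\<in>{x..y}. z \<notin> {a<..<b}" for x y
    using integral_cong[of "{x..y}" \<phi> "\<lambda>_. 0"] that ab(3) by auto
  have D: "(\<Phi> has_real_derivative \<phi> x) (at x)" for x
  proof (cases "x < a")
    case True
    have "((\<lambda>_. 0) has_real_derivative \<phi> x) (at x)" using True ab by auto
    then show ?thesis
      by (rule has_field_derivative_transform_within_open[where S="{..<a}"])
         (use True zero in \<open>auto simp: \<Phi>_def\<close>)
  next
    case False
    have "(\<Phi> has_real_derivative \<phi> x) (at x within {a / 2..x + 1})"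
      unfolding \<Phi>_def by (rule integral_has_real_derivative) (use False ab cont in auto)
    then show ?thesis
      using False ab by (subst (asm) at_within_Icc_at) auto
  qed
  have "integral {a..b} \<phi> = 0"
    using assms(2) LINT_pos_eq_integral(1)[of a b \<phi>] ab absolutely_integrable_continuous_real[OF cont]
    by (simp del: greaterThanLessThan_iff)
  \<comment> \<open>beyond the support the primitive has already collected the whole integral\<close>
  then have tot: "integral {a / 2..x} \<phi> = 0" if "x \<ge> b" for x
    using Henstock_Kurzweil_Integration.integral_combine[of "a / 2" a x \<phi>]
      Henstock_Kurzweil_Integration.integral_combine[of a b x \<phi>] int zero[of "a / 2" a] zero[of b x] that ab
    by auto
  have "test_function \<Phi>"
  proof (rule test_functionI[of _ a b])
    show "smooth \<Phi>" by (rule smooth_antideriv[OF test_function_smooth[OF assms(1)] D])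
    show "\<Phi> x = 0" if "x \<notin> {a..b}" for x
      using that tot[of x] zero[of "a / 2" x] by (cases "x < a") (auto simp: \<Phi>_def)
  qed (use ab in auto)
  moreover have "deriv \<Phi> = \<phi>" using D by (auto intro: DERIV_imp_deriv)
  ultimately show ?thesis by (rule that)
qed

lemma test_function_diff_cmult:
  assumes "test_function f" "test_function g"
  shows "test_function (\<lambda>x. f x - c * g x)"
proof -
  obtain a b where ab: "0 < a" "a < b" "\<forall>x. x \<notin> {a<..<b} \<longrightarrow> f x = 0 \<and> deriv f x = 0"
    by (rule test_function_support[OF assms(1)])
  obtain a' b' where ab': "0 < a'" "a' < b'" "\<forall>x. x \<notin> {a'<..<b'} \<longrightarrow> g x = 0 \<and> deriv g x = 0"
    by (rule test_function_support[OF assms(2)])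
  show ?thesis
  proof (rule test_functionI[of _ "min a a'" "max b b'"])
    have "smooth (\<lambda>x. f x + (- c) * g x)"
      by (intro smooth_add smooth_cmult test_function_smooth assms)
    then show "smooth (\<lambda>x. f x - c * g x)" by simp
    show "f x - c * g x = 0" if "x \<notin> {min a a'..max b b'}" for x
      using that ab(3)[rule_format, of x] ab'(3)[rule_format, of x] by (auto simp: min_def max_def split: if_splits)
  qed (use ab ab' in auto)
qed

lemma set_integrable_mult_test_function:
  assumes "locally_integrable h" "test_function \<phi>"
  shows "set_integrable lebesgue {0<..} (\<lambda>x. h x * \<phi> x)"
proof -
  obtain a b where ab: "0 < a" "a < b" "\<forall>x. x \<notin> {a<..<b} \<longrightarrow> \<phi> x = 0 \<and> deriv \<phi> x = 0"
    by (rule test_function_support[OF assms(2)])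
  show ?thesis
    by (rule LINT_pos_eq_integral(2)[of a b])
       (use ab in \<open>auto intro!: absolutely_integrable_mult_continuous locally_integrable_interval[OF assms(1)]
          smooth_continuous test_function_smooth assms\<close>)
qed

lemma locally_integrable_const: "locally_integrable (\<lambda>_. c)"
  unfolding locally_integrable_def
  by (auto intro!: absolutely_integrable_on_const lmeasurable_compact)

text \<open>A consequence of the Lebesgue differentiation theorem, applied to \<open>h - c\<close> cut off at a positive
  \<open>\<epsilon>\<close>, since \<open>h\<close> may fail to be integrable up to $0$.\<close>

lemma locally_integrable_AE_const:
  assumes h: "locally_integrable h"
    and 0: "\<And>a b. 0 < a \<Longrightarrow> a \<le> b \<Longrightarrow> integral {a..b} h = c * (b - a)"
  shows "AE x in lebesgue. x > 0 \<longrightarrow> h x = c"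
proof -
  have "AE x in lebesgue. x > \<epsilon> \<longrightarrow> h x = c" if "\<epsilon> > 0" for \<epsilon>
  proof -
    define f where "f x = (if x \<ge> \<epsilon> then h x - c else 0)" for x
    have "(\<lambda>x. h x - c) absolutely_integrable_on {\<epsilon>..b}" for b
      by (intro set_integral_diff(1) locally_integrable_interval[OF h that] absolutely_integrable_on_const) auto
    then have int: "(\<lambda>x. h x - c) integrable_on {\<epsilon>..b}" for b
      by (auto simp: absolutely_integrable_on_def)
    have "f integrable_on cbox a b" for a b
    proof -
      have "f integrable_on {\<epsilon>..b}"
        using int[of b] by (rule integrable_eq) (auto simp: f_def)
      then have "(\<lambda>x. if x \<in> {\<epsilon>..b} then f x else 0) integrable_on {min a \<epsilon>..b}"
        by (subst integrable_restrict_Int) (auto simp: Int_absorb2 )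
      then have "f integrable_on {min a \<epsilon>..b}"
        by (rule integrable_eq) (auto simp: f_def)
      then have "f integrable_on {a..b}" by (rule integrable_on_subinterval) auto
      then show ?thesis by simp
    qed
    then obtain N where N: "negligible N"
      "\<And>x e. \<lbrakk>x \<notin> N; 0 < e\<rbrakk> \<Longrightarrow> \<exists>d>0. \<forall>h. 0 < h \<and> h < d \<longrightarrow>
          norm (integral (cbox x (x + h *\<^sub>R One)) f /\<^sub>R h ^ DIM(real) - f x) < e"
      using integrable_ccontinuous_explicit[of f] by metis
    have "h x = c" if "x \<notin> N" "x > \<epsilon>" for x
    proof -
      have "\<bar>f x\<bar> < e" if "e > 0" for e
      proof -
        obtain d where d: "d > 0" "\<And>h. 0 < h \<and> h < d \<Longrightarrow>
          norm (integral (cbox x (x + h *\<^sub>R One)) f /\<^sub>R h ^ DIM(real) - f x) < e"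
          using N(2)[OF \<open>x \<notin> N\<close> \<open>e > 0\<close>] by auto
        have "integral {x..x + d / 2} f = integral {x..x + d / 2} (\<lambda>x. h x - c)"
          using \<open>x > \<epsilon>\<close> by (intro integral_cong) (auto simp: f_def)
        also have "\<dots> = integral {x..x + d / 2} h - integral {x..x + d / 2} (\<lambda>x. c)"
          using locally_integrable_interval[OF h, of x] \<open>x > \<epsilon>\<close> \<open>\<epsilon> > 0\<close>
          by (intro Henstock_Kurzweil_Integration.integral_diff) (auto simp: absolutely_integrable_on_def)
        also have "\<dots> = 0"
          using 0[of x "x + d / 2"] \<open>x > \<epsilon>\<close> \<open>\<epsilon> > 0\<close> d(1) by simp
        finally show ?thesis using d(2)[of "d / 2"] d(1) by simp
      qed
      from this[of "\<bar>f x\<bar>"] have "f x = 0" by auto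
      then show ?thesis using that by (simp add: f_def)
    qed
    then show ?thesis
      using N(1) by (intro AE_I'[of N]) (auto simp: negligible_iff_null_sets)
  qed
  then have "AE x in lebesgue. \<forall>n. x > inverse (real (Suc n)) \<longrightarrow> h x = c"
    by (subst AE_all_countable) auto
  then show ?thesis
    by eventually_elim (use reals_Archimedean in blast)
qed

text \<open>Subtracting a multiple of one fixed bump turns every test function into one of mean zero, that is, into
  the derivative of a test function. So \<open>h\<close> acts on test functions like a constant, and bumps that
  converge to the indicator function of an interval transfer this to integrals over intervals.\<close>

lemma du_Bois_Reymond:
  assumes h: "locally_integrable h"
    and 0: "\<And>\<phi>. test_function \<phi> \<Longrightarrow> (LINT r:{0<..}|lebesgue. h r * deriv \<phi> r) = 0"
  shows "\<exists>c. AE x in lebesgue. x > 0 \<longrightarrow> h x = c"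
proof -
  let ?I = "\<lambda>f. (LINT r:{0<..}|lebesgue. f r) :: real"
  define \<phi>0 where "\<phi>0 = bump 1 2 0"
  have t0: "test_function \<phi>0" unfolding \<phi>0_def by (rule test_function_bump) simp
  have i1: "set_integrable lebesgue {0<..} \<phi>" if "test_function \<phi>" for \<phi>
    using set_integrable_mult_test_function[OF locally_integrable_const[of 1] that] by simp
  have I0: "?I \<phi>0 \<noteq> 0"
  proof
    assume "?I \<phi>0 = 0"
    then have "integral\<^sup>L lebesgue (\<lambda>r. indicator {0<..} r * \<phi>0 r) = 0"
      by (simp add: set_lebesgue_integral_def)
    then have "AE r in lebesgue. indicator {0<..} r * \<phi>0 r = 0"
      using i1[OF t0] by (subst (asm) integral_nonneg_eq_0_iff_AE)
        (auto simp: set_integrable_def \<phi>0_def bump_nonneg)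
    then have "AE r in lebesgue. r \<notin> {1<..<2::real}"
      by eventually_elim (use bump_pos[of _ 1 2 0] in \<open>force simp: \<phi>0_def\<close>)
    then have "{1<..<2::real} \<in> null_sets lebesgue"
      by (subst (asm) AE_iff_null_sets[symmetric]) auto
    then show False by (auto simp: null_sets_def)
  qed
  define c where "c = ?I (\<lambda>r. h r * \<phi>0 r) / ?I \<phi>0"
  have key: "?I (\<lambda>r. h r * \<phi> r) = c * ?I \<phi>" if t: "test_function \<phi>" for \<phi>
  proof -
    define k where "k = ?I \<phi> / ?I \<phi>0"
    have tk: "test_function (\<lambda>x. \<phi> x - k * \<phi>0 x)" by (rule test_function_diff_cmult[OF t t0])
    have "?I (\<lambda>x. \<phi> x - k * \<phi>0 x) = ?I \<phi> - k * ?I \<phi>0"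
      using i1[OF t] i1[OF t0] by (subst set_integral_diff) auto
    also have "\<dots> = 0" using I0 by (simp add: k_def)
    finally obtain \<Phi> where \<Phi>: "test_function \<Phi>" "deriv \<Phi> = (\<lambda>x. \<phi> x - k * \<phi>0 x)"
      by (rule test_function_antideriv[OF tk])
    have "0 = ?I (\<lambda>x. h x * \<phi> x - k * (h x * \<phi>0 x))"
      using 0[OF \<Phi>(1)] unfolding \<Phi>(2) by (simp add: algebra_simps)
    also have "\<dots> = ?I (\<lambda>x. h x * \<phi> x) - k * ?I (\<lambda>x. h x * \<phi>0 x)"
      using set_integrable_mult_test_function[OF h t] set_integrable_mult_test_function[OF h t0]
      by (subst set_integral_diff) auto
    finally show ?thesis using I0 by (simp add: c_def k_def)
  qed
  have "integral {a..b} h = c * (b - a)" if ab: "0 < a" "a \<le> b" for a b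
  proof -
    have lim: "(\<lambda>n. ?I (\<lambda>r. g r * bump a b n r)) \<longlonglongrightarrow> integral {a..b} g" if g: "locally_integrable g" for g
    proof -
      have gi: "integrable lebesgue (\<lambda>r. indicator {a..b} r * g r)"
        using locally_integrable_interval[OF g ab(1), of b] by (simp add: set_integrable_def)
      have "(\<lambda>n. \<integral>r. indicator {0<..} r * (g r * bump a b n r) \<partial>lebesgue)
          \<longlonglongrightarrow> (\<integral>r. indicator {a<..<b} r * g r \<partial>lebesgue)"
      proof (rule integral_dominated_convergence[where w="\<lambda>r. \<bar>indicator {a..b} r * g r\<bar>"])
        show "integrable lebesgue (\<lambda>r. \<bar>indicator {a..b} r * g r\<bar>)" using gi by (rule integrable_abs)
        show "AE r in lebesgue. (\<lambda>n. indicator {0<..} r * (g r * bump a b n r)) \<longlonglongrightarrow> indicator {a<..<b} r * g r"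
        proof (rule AE_I2)
          fix r
          have "(\<lambda>n. indicator {0<..} r * (g r * bump a b n r)) \<longlonglongrightarrow>
              indicator {0<..} r * (g r * indicator {a<..<b} r)"
            by (intro tendsto_intros bump_tendsto)
          moreover have "indicator {0<..} r * (g r * indicator {a<..<b} r) = indicator {a<..<b} r * g r"
            using ab by (auto simp: indicator_def)
          ultimately show "(\<lambda>n. indicator {0<..} r * (g r * bump a b n r)) \<longlonglongrightarrow> indicator {a<..<b} r * g r"
            by simp
        qed
        show "AE r in lebesgue. norm (indicator {0<..} r * (g r * bump a b n r)) \<le> \<bar>indicator {a..b} r * g r\<bar>" for n
        proof (rule AE_I2)
          fix r
          show "norm (indicator {0<..} r * (g r * bump a b n r)) \<le> \<bar>indicator {a..b} r * g r\<bar>"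
            using bump_eq_0[of r a b n] bump_nonneg[of a b n r] bump_le_1[of a b n r]
            by (cases "r \<in> {a<..<b}") (auto simp: abs_mult indicator_def mult_left_le)
        qed
        show "(\<lambda>r. indicator {a<..<b} r * g r) \<in> borel_measurable lebesgue"
        proof -
          have "(\<lambda>r. indicator {a<..<b} r * g r) = (\<lambda>r. indicator {a<..<b} r * (indicator {a..b} r * g r))"
            by (auto simp: indicator_def)
          moreover have "(\<lambda>r. indicator {a<..<b} r * (indicator {a..b} r * g r)) \<in> borel_measurable lebesgue"
            using borel_measurable_integrable[OF gi] by (rule borel_measurable_times[OF borel_measurable_indicator, rotated]) auto
          ultimately show ?thesis by (simp only:)
        qed
        show "(\<lambda>r. indicator {0<..} r * (g r * bump a b n r)) \<in> borel_measurable lebesgue" for n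
          using set_integrable_mult_test_function[OF g test_function_bump[OF ab(1)], of b n]
          by (simp add: set_integrable_def)
      qed
      moreover have "(\<integral>r. indicator {a<..<b} r * g r \<partial>lebesgue) = (\<integral>r. indicator {a..b} r * g r \<partial>lebesgue)"
      proof (rule Bochner_Integration.integral_cong_AE)
        have "AE r in lebesgue. r \<notin> {a, b}"
          by (rule AE_not_in) (auto simp flip: negligible_iff_null_sets)
        then show "AE r in lebesgue. indicator {a<..<b} r * g r = indicator {a..b} r * g r"
          by eventually_elim (auto simp: indicator_def)
        show "(\<lambda>r. indicator {a..b} r * g r) \<in> borel_measurable lebesgue"
          using gi by simp
        have "(\<lambda>r. indicator {a<..<b} r * g r) = (\<lambda>r. indicator {a<..<b} r * (indicator {a..b} r * g r))"
          by (auto simp: indicator_def)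
        moreover have "(\<lambda>r. indicator {a<..<b} r * (indicator {a..b} r * g r)) \<in> borel_measurable lebesgue"
          using borel_measurable_integrable[OF gi] by (rule borel_measurable_times[OF borel_measurable_indicator, rotated]) auto
        ultimately show "(\<lambda>r. indicator {a<..<b} r * g r) \<in> borel_measurable lebesgue" by (simp only:)
      qed
      moreover have "(\<integral>r. indicator {a..b} r * g r \<partial>lebesgue) = integral {a..b} g"
        using set_lebesgue_integral_eq_integral(2)[OF locally_integrable_interval[OF g ab(1), of b]]
        by (simp add: set_lebesgue_integral_def)
      ultimately show ?thesis by (simp add: set_lebesgue_integral_def)
    qed
    have "(\<lambda>n. c * ?I (\<lambda>r. 1 * bump a b n r)) \<longlonglongrightarrow> c * integral {a..b} (\<lambda>_. 1)"
      by (intro tendsto_mult tendsto_const lim locally_integrable_const)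
    then have "(\<lambda>n. ?I (\<lambda>r. h r * bump a b n r)) \<longlonglongrightarrow> c * (b - a)"
      using key[OF test_function_bump[OF ab(1)]] ab by simp
    with lim[OF h] show ?thesis by (rule LIMSEQ_unique)
  qed
  then show ?thesis using locally_integrable_AE_const[OF h] by blast
qed

lemma locally_integrable_antideriv:
  assumes "antideriv U v" "locally_integrable v" shows "locally_integrable U"
  unfolding locally_integrable_def
proof (intro allI impI, elim conjE)
  fix K :: "real set" assume K: "compact K" "K \<subseteq> {0<..}"
  show "U absolutely_integrable_on K"
  proof (cases "K = {}")
    case False
    obtain a where a: "a \<in> K" "\<And>t. t \<in> K \<Longrightarrow> a \<le> t" using compact_attains_inf[OF K(1) False] by auto
    obtain b where b: "b \<in> K" "\<And>t. t \<in> K \<Longrightarrow> t \<le> b" using compact_attains_sup[OF K(1) False] by auto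
    have "U absolutely_integrable_on {a..b}"
      using a K by (intro absolutely_integrable_continuous_real antideriv_continuous[OF assms]) auto
    then show ?thesis
      by (rule set_integrable_subset) (use a b K in \<open>auto simp: borel_compact\<close>)
  qed auto
qed

lemma weak_deriv_antideriv:
  assumes "has_weak_deriv 1 u v"
  shows "\<exists>U. antideriv U v \<and> (AE x in lebesgue. x > 0 \<longrightarrow> u x = U x)"
proof -
  have u: "locally_integrable u" and v: "locally_integrable v"
    and w: "\<And>\<phi>. test_function \<phi> \<Longrightarrow>
      (LINT r:{0<..}|lebesgue. v r * \<phi> r) = - (LINT r:{0<..}|lebesgue. u r * deriv \<phi> r)"
    using assms by (auto simp: has_weak_deriv_def)
  obtain U where U: "antideriv U v" using antideriv_exists[OF v] by blast
  note Uloc = locally_integrable_antideriv[OF U v]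
  have "\<exists>c. AE x in lebesgue. x > 0 \<longrightarrow> u x - U x = c"
  proof (rule du_Bois_Reymond)
    show "locally_integrable (\<lambda>x. u x - U x)"
      using u Uloc by (auto simp: locally_integrable_def intro: set_integral_diff(1))
    fix \<phi> assume t: "test_function \<phi>"
    obtain a b where ab: "0 < a" "a < b" "\<forall>x. x \<notin> {a<..<b} \<longrightarrow> \<phi> x = 0 \<and> deriv \<phi> x = 0"
      by (rule test_function_support[OF t])
    note s = test_function_smooth[OF t]
    have "(LINT r:{0<..}|lebesgue. U r * deriv \<phi> r) = - (LINT r:{0<..}|lebesgue. v r * \<phi> r)"
    proof (rule antideriv_integration_by_parts[OF U v ab(1)])
      show "(\<phi> has_real_derivative deriv \<phi> x) (at x within {a..b})" for x
        by (rule has_field_derivative_at_within[OF smooth_has_deriv[OF s]])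
      show "continuous_on {a..b} (deriv \<phi>)"
        by (rule smooth_continuous[OF smooth_deriv[OF s]])
    qed (use ab(2,3) in \<open>simp_all del: greaterThanLessThan_iff\<close>)
    then show "(LINT r:{0<..}|lebesgue. (u r - U r) * deriv \<phi> r) = 0"
      using w[OF t] set_integrable_mult_test_function[OF u test_function_deriv[OF t]]
        set_integrable_mult_test_function[OF Uloc test_function_deriv[OF t]]
      by (simp add: left_diff_distrib)
  qed
  then obtain c where c: "AE x in lebesgue. x > 0 \<longrightarrow> u x - U x = c" by blast
  have "antideriv (\<lambda>x. U x + c) v" using U by (simp add: antideriv_def)
  moreover have "AE x in lebesgue. x > 0 \<longrightarrow> u x = U x + c"
    using c by eventually_elim auto
  ultimately show ?thesis by blast
qed

lemma locally_integrable_measurable: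
  assumes "locally_integrable g"
  shows "(\<lambda>r. indicator {0<..} r * g r) \<in> borel_measurable lebesgue"
proof (rule borel_measurable_LIMSEQ_real)
  define a where "a n = inverse (real (Suc n))" for n
  show "(\<lambda>r. indicator {a n..real n} r * g r) \<in> borel_measurable lebesgue" for n
    using locally_integrable_interval[OF assms, of "a n" "real n"]
    by (auto simp: set_integrable_def a_def)
  show "(\<lambda>n. indicator {a n..real n} r * g r) \<longlonglongrightarrow> indicator {0<..} r * g r" for r
  proof (cases "r > 0")
    case True
    have "eventually (\<lambda>n. a n < r) sequentially"
      unfolding a_def using True LIMSEQ_inverse_real_of_nat by (rule order_tendstoD(2)[rotated])
    moreover have "eventually (\<lambda>n. r \<le> real n) sequentially"
      using filterlim_real_sequentially by (simp add: filterlim_at_top)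
    ultimately have "eventually (\<lambda>n. indicator {a n..real n} r * g r = indicator {0<..} r * g r) sequentially"
      by eventually_elim (use True in auto)
    then show ?thesis by (rule tendsto_eventually)
  next
    case False
    have "indicator {a n..real n} r * g r = 0" for n
    proof -
      have "a n > 0" by (simp add: a_def)
      then show ?thesis using False by (auto simp: indicator_def)
    qed
    then show ?thesis using False by (simp only:) simp
  qed
qed

lemma weak_deriv_of_weak_deriv:
  assumes "has_weak_deriv 1 u v" "has_weak_deriv 2 u w"
  shows "has_weak_deriv 1 v w"
  using assms unfolding has_weak_deriv_def
proof (safe)
  fix \<phi> assume t: "test_function \<phi>"
    and 1: "\<forall>\<phi>. test_function \<phi> \<longrightarrow> (LINT r:{0<..}|lebesgue. v r * \<phi> r) = (- 1) ^ 1 * (LINT r:{0<..}|lebesgue. u r * (deriv ^^ 1) \<phi> r)"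
    and 2: "\<forall>\<phi>. test_function \<phi> \<longrightarrow> (LINT r:{0<..}|lebesgue. w r * \<phi> r) = (- 1)\<^sup>2 * (LINT r:{0<..}|lebesgue. u r * (deriv ^^ 2) \<phi> r)"
  show "(LINT r:{0<..}|lebesgue. w r * \<phi> r) = (- 1) ^ 1 * (LINT r:{0<..}|lebesgue. v r * (deriv ^^ 1) \<phi> r)"
    using 1[rule_format, OF test_function_deriv[OF t]] 2[rule_format, OF t]
    by (simp add: numeral_2_eq_2)
qed

text \<open>This makes the choice of a weak derivative in the definition of the operator meaningful. The product
  rule needs no smooth cut-off: one integrates the absolutely continuous representative of \<open>v\<close> by parts
  against $r^\gamma\phi$.\<close>

lemma weak_deriv_powr_mult:
  assumes "has_weak_deriv 1 v w"
  shows "\<exists>g. has_weak_deriv 1 (\<lambda>s. s powr \<gamma> * v s) g"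
proof -
  obtain V where V: "antideriv V w" and Vv: "AE x in lebesgue. x > 0 \<longrightarrow> v x = V x"
    using weak_deriv_antideriv[OF assms] by blast
  have v: "locally_integrable v" and w: "locally_integrable w"
    using assms by (auto simp: has_weak_deriv_def)
  have loc: "locally_integrable (\<lambda>s. s powr k * f s)" if f: "locally_integrable f" for k f
    unfolding locally_integrable_def
  proof (intro allI impI, elim conjE)
    fix K :: "real set" assume K: "compact K" "K \<subseteq> {0<..}"
    have c: "continuous_on K (\<lambda>s. s powr k)" using K by (intro continuous_intros) auto
    have "K \<in> sets lebesgue" using K(1) by (simp add: borel_compact)
    then show "(\<lambda>s. s powr k * f s) absolutely_integrable_on K"
      using absolutely_integrable_bounded_measurable_product_real[of "\<lambda>s. s powr k" K f] f K c
      by (simp add: locally_integrable_def continuous_imp_measurable_on_sets_lebesgue compact_imp_bounded compact_continuous_image)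
  qed
  define g where "g s = \<gamma> * (s powr (\<gamma> - 1) * v s) + s powr \<gamma> * w s" for s
  have "locally_integrable g"
    using loc[OF v, of "\<gamma> - 1"] loc[OF w, of \<gamma>]
    unfolding locally_integrable_def g_def by (auto intro!: set_integral_add(1) set_integrable_mult_right)
  moreover have "(LINT r:{0<..}|lebesgue. g r * \<phi> r) = - (LINT r:{0<..}|lebesgue. r powr \<gamma> * v r * deriv \<phi> r)"
    if t: "test_function \<phi>" for \<phi>
  proof -
    obtain a b where ab: "0 < a" "a < b" "\<forall>x. x \<notin> {a<..<b} \<longrightarrow> \<phi> x = 0 \<and> deriv \<phi> x = 0"
      by (rule test_function_support[OF t])
    note s = test_function_smooth[OF t]
    define \<psi> where "\<psi> r = r powr \<gamma> * \<phi> r" for r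
    define \<psi>' where "\<psi>' r = \<gamma> * r powr (\<gamma> - 1) * \<phi> r + r powr \<gamma> * deriv \<phi> r" for r
    have ibp: "(LINT r:{0<..}|lebesgue. V r * \<psi>' r) = - (LINT r:{0<..}|lebesgue. w r * \<psi> r)"
    proof (rule antideriv_integration_by_parts[OF V w ab(1)])
      show "(\<psi> has_real_derivative \<psi>' x) (at x within {a..b})" if "x \<in> {a..b}" for x
      proof -
        have "(\<psi> has_real_derivative \<psi>' x) (at x)"
          unfolding \<psi>_def[abs_def] \<psi>'_def using that ab(1)
          by (auto intro!: derivative_eq_intros smooth_has_deriv[OF s])
        then show ?thesis by (rule has_field_derivative_at_within)
      qed
      show "continuous_on {a..b} \<psi>'"
        unfolding \<psi>'_def using ab(1)
        by (intro continuous_intros smooth_continuous s smooth_deriv) auto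
    qed (use ab(2,3) in \<open>simp_all add: \<psi>_def \<psi>'_def del: greaterThanLessThan_iff\<close>)
    have I: "set_integrable lebesgue {0<..} (\<lambda>r. (r powr k * f r) * \<zeta> r)"
      if "locally_integrable f" "test_function \<zeta>" for f \<zeta> k
      by (rule set_integrable_mult_test_function[OF loc[OF that(1)] that(2)])
    have "(LINT r:{0<..}|lebesgue. V r * \<psi>' r) = (LINT r:{0<..}|lebesgue. v r * \<psi>' r)"
      unfolding set_lebesgue_integral_def
    proof (rule Bochner_Integration.integral_cong_AE)
      show "AE r in lebesgue. indicator {0<..} r *\<^sub>R (V r * \<psi>' r) = indicator {0<..} r *\<^sub>R (v r * \<psi>' r)"
        using Vv by eventually_elim (auto simp: indicator_def)
      have "set_integrable lebesgue {0<..} (\<lambda>r. \<gamma> * ((r powr (\<gamma> - 1) * f r) * \<phi> r) + (r powr \<gamma> * f r) * deriv \<phi> r)"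
        if "locally_integrable f" for f
        by (intro set_integral_add(1) set_integrable_mult_right I that t test_function_deriv[OF t])
      moreover have "\<gamma> * ((r powr (\<gamma> - 1) * f r) * \<phi> r) + (r powr \<gamma> * f r) * deriv \<phi> r = f r * \<psi>' r" for f r
        by (simp add: \<psi>'_def algebra_simps)
      ultimately have "set_integrable lebesgue {0<..} (\<lambda>r. f r * \<psi>' r)" if "locally_integrable f" for f
        using that by simp
      then show "(\<lambda>r. indicator {0<..} r *\<^sub>R (V r * \<psi>' r)) \<in> borel_measurable lebesgue"
        "(\<lambda>r. indicator {0<..} r *\<^sub>R (v r * \<psi>' r)) \<in> borel_measurable lebesgue"
        using locally_integrable_antideriv[OF V w] v unfolding set_integrable_def
        by (blast intro: borel_measurable_integrable)+
    qed
    also have "\<dots> = (LINT r:{0<..}|lebesgue. \<gamma> * ((r powr (\<gamma> - 1) * v r) * \<phi> r) + (r powr \<gamma> * v r) * deriv \<phi> r)"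
      by (simp add: \<psi>'_def algebra_simps)
    also have "\<dots> = \<gamma> * (LINT r:{0<..}|lebesgue. (r powr (\<gamma> - 1) * v r) * \<phi> r) + (LINT r:{0<..}|lebesgue. (r powr \<gamma> * v r) * deriv \<phi> r)"
      by (subst set_integral_add(2)) (auto intro!: set_integrable_mult_right I v t test_function_deriv[OF t])
    finally have 1: "\<gamma> * (LINT r:{0<..}|lebesgue. (r powr (\<gamma> - 1) * v r) * \<phi> r) + (LINT r:{0<..}|lebesgue. (r powr \<gamma> * v r) * deriv \<phi> r)
        = - (LINT r:{0<..}|lebesgue. w r * \<psi> r)" using ibp by simp
    have "(LINT r:{0<..}|lebesgue. g r * \<phi> r) =
        (LINT r:{0<..}|lebesgue. \<gamma> * ((r powr (\<gamma> - 1) * v r) * \<phi> r) + (r powr \<gamma> * w r) * \<phi> r)"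
      by (simp add: g_def algebra_simps)
    also have "\<dots> = \<gamma> * (LINT r:{0<..}|lebesgue. (r powr (\<gamma> - 1) * v r) * \<phi> r) + (LINT r:{0<..}|lebesgue. (r powr \<gamma> * w r) * \<phi> r)"
      by (subst set_integral_add(2)) (auto intro!: set_integrable_mult_right I v w t)
    also have "(LINT r:{0<..}|lebesgue. (r powr \<gamma> * w r) * \<phi> r) = (LINT r:{0<..}|lebesgue. w r * \<psi> r)"
      by (simp add: \<psi>_def mult_ac)
    finally show ?thesis using 1 by simp
  qed
  ultimately have "has_weak_deriv 1 (\<lambda>s. s powr \<gamma> * v s) g"
    using loc[OF v, of \<gamma>] by (simp add: has_weak_deriv_def)
  then show ?thesis by blast
qed

section \<open>Bounds for the truncated exponential\<close>

text \<open>Each factor $a+\theta+i$ is the weighted arithmetic mean of $a+i$ and $a+1+i$, so it dominates their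
  weighted geometric mean.\<close>

lemma pochhammer_interpolation:
  fixes a \<theta> :: real
  assumes "a > 0" "0 \<le> \<theta>" "\<theta> \<le> 1"
  shows "pochhammer a j powr (1 - \<theta>) * pochhammer (a + 1) j powr \<theta> \<le> pochhammer (a + \<theta>) j"
proof (induction j)
  case (Suc j)
  have "(a + real j) powr (1 - \<theta>) * (a + 1 + real j) powr \<theta> \<le>
      (1 - \<theta>) * (a + real j) + \<theta> * (a + 1 + real j)"
    using assms by (intro Youngs_inequality_0) auto
  then have "(pochhammer a j powr (1 - \<theta>) * pochhammer (a + 1) j powr \<theta>) *
      ((a + real j) powr (1 - \<theta>) * (a + 1 + real j) powr \<theta>) \<le>
      pochhammer (a + \<theta>) j * (a + \<theta> + real j)"
    by (intro mult_mono Suc) (use assms pochhammer_pos[of "a + \<theta>" j] in \<open>auto simp: algebra_simps\<close>)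
  moreover have "pochhammer a j \<ge> 0" "pochhammer (a + 1) j \<ge> 0"
    using assms pochhammer_pos[of a j] pochhammer_pos[of "a + 1" j] by auto
  ultimately show ?case
    using assms by (simp add: pochhammer_Suc powr_mult mult_ac)
qed simp

lemma Gamma_add_nat:
  fixes p :: real assumes "p > 0"
  shows "Gamma (p + real j) = pochhammer p j * Gamma p"
proof -
  have "pochhammer p j = Gamma (p + real j) / Gamma p"
    using assms by (intro pochhammer_Gamma) (auto elim!: nonpos_Ints_cases)
  then show ?thesis using Gamma_real_pos[OF assms] by (simp add: nonzero_eq_divide_eq)
qed

lemma exp_series_tail_le:
  fixes t :: real assumes "t \<ge> 0"
  shows "summable (\<lambda>j. t ^ (m + j) / pochhammer (real m + 1) j)"
    and "(\<Sum>j. t ^ (m + j) / pochhammer (real m + 1) j) \<le> fact m * exp t"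
proof -
  have "pochhammer (real m + 1) j = fact (m + j) / fact m" for j
    using pochhammer_product'[of "1::real" m j] pochhammer_pos[of "1::real" m]
    by (simp add: pochhammer_fact add.commute field_simps)
  then have eq: "(\<lambda>j. t ^ (m + j) / pochhammer (real m + 1) j) = (\<lambda>j. fact m * (t ^ (j + m) / fact (j + m)))"
    by (auto simp: add.commute)
  have s: "summable (\<lambda>j. t ^ j / fact j)" and e: "(\<Sum>j. t ^ j / fact j) = exp t"
    using exp_converges[of t] by (auto simp: sums_iff divide_inverse mult.commute)
  have s': "summable (\<lambda>j. t ^ (j + m) / fact (j + m))"
    using s by (rule summable_ignore_initial_segment)
  have "(\<Sum>j. t ^ (j + m) / fact (j + m)) \<le> exp t"
    using suminf_split_initial_segment[OF s, of m] assms e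
    by (simp add: sum_nonneg)
  then show "summable (\<lambda>j. t ^ (m + j) / pochhammer (real m + 1) j)"
    and "(\<Sum>j. t ^ (m + j) / pochhammer (real m + 1) j) \<le> fact m * exp t"
    unfolding eq suminf_mult[OF s'] by (auto intro!: summable_mult s' mult_left_mono simp del: times_divide_eq_right)
qed

lemma suminf_le_nonneg:
  fixes a b :: "nat \<Rightarrow> real"
  assumes "\<And>j. 0 \<le> a j" "\<And>j. a j \<le> b j" "summable b"
  shows "suminf a \<le> suminf b"
proof -
  have "summable a" by (rule summable_comparison_test'[OF assms(3), of 0]) (use assms in auto)
  then show ?thesis using assms by (intro suminf_le)
qed

text \<open>The function $\exp_p$ is $e^t$ times a regularised incomplete Gamma function, so that no power of $t$ is
  lost. The argument avoids that integral representation: by interpolation the series is dominated by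
  the sum of those with integral parameters $\lfloor p\rfloor$ and $\lfloor p\rfloor+1$, which are
  remainders of the exponential series.\<close>

lemma exp_tail_le_exp:
  assumes "p > 1"
  shows "\<exists>C>0. \<forall>t\<ge>0. exp_tail p t \<le> C * exp t"
proof -
  define m where "m = nat \<lfloor>p\<rfloor> - 1"
  define \<theta> where "\<theta> = p - (real m + 1)"
  have m1: "real m + 1 = real_of_int \<lfloor>p\<rfloor>"
  proof -
    have 1: "\<lfloor>p\<rfloor> \<ge> 1" using assms by (simp add: le_floor_iff)
    then have "nat \<lfloor>p\<rfloor> \<ge> 1" by linarith
    then show ?thesis using 1 unfolding m_def by (subst of_nat_diff) auto
  qed
  have \<theta>: "0 \<le> \<theta>" "\<theta> \<le> 1" unfolding \<theta>_def m1 by linarith+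
  have p: "p = real m + 1 + \<theta>" by (simp add: \<theta>_def)
  have G: "Gamma p > 0" using assms by (intro Gamma_real_pos) auto
  define X where "X t j = t ^ (m + j) / pochhammer (real m + 1) j" for t :: real and j
  define Y where "Y t j = t ^ (Suc m + j) / pochhammer (real (Suc m) + 1) j" for t :: real and j
  have term_le: "t powr (p - 1 + real j) / Gamma (p + real j) \<le> (X t j + Y t j) / Gamma p"
    if t: "t \<ge> 0" for t j
  proof (cases "t = 0")
    case False
    then have t: "t > 0" using t by simp
    have pp: "pochhammer (real m + 1) j > 0" "pochhammer (real m + 2) j > 0" "pochhammer p j > 0"
      using assms by (auto intro!: pochhammer_pos)
    have Gp: "Gamma (p + real j) = pochhammer p j * Gamma p"
      using Gamma_add_nat[of p j] assms by simp
    have XY: "X t j > 0" "Y t j > 0"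
      using t pp by (auto simp: X_def Y_def add.commute add.assoc)
    have "t powr (p - 1 + real j) = (t ^ (m + j)) powr (1 - \<theta>) * (t ^ (Suc m + j)) powr \<theta>"
      using t unfolding powr_realpow[OF t, symmetric] powr_powr powr_add[symmetric]
      by (simp add: p algebra_simps)
    then have "t powr (p - 1 + real j) / pochhammer p j \<le>
        (t ^ (m + j)) powr (1 - \<theta>) * (t ^ (Suc m + j)) powr \<theta> /
        (pochhammer (real m + 1) j powr (1 - \<theta>) * pochhammer (real m + 2) j powr \<theta>)"
      using pochhammer_interpolation[of "real m + 1" \<theta> j] \<theta> pp t
      by (auto intro!: divide_left_mono mult_pos_pos simp: p add.assoc)
    also have "\<dots> = X t j powr (1 - \<theta>) * Y t j powr \<theta>"
      using t pp by (simp add: X_def Y_def powr_divide add.commute add.assoc)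
    also have "\<dots> \<le> (1 - \<theta>) * X t j + \<theta> * Y t j"
      using XY \<theta> by (intro Youngs_inequality_0) auto
    also have "\<dots> \<le> 1 * X t j + 1 * Y t j"
      using XY \<theta> by (intro add_mono mult_right_mono) auto
    finally show ?thesis
      using G unfolding Gp by (simp add: divide_right_mono flip: divide_divide_eq_left)
  qed (use G in \<open>simp add: X_def Y_def pochhammer_nonneg\<close>)
  have "exp_tail p t \<le> ((fact m + fact (Suc m)) / Gamma p) * exp t" if t: "t \<ge> 0" for t
  proof -
    have s: "summable (X t)" "summable (Y t)" "suminf (X t) \<le> fact m * exp t" "suminf (Y t) \<le> fact (Suc m) * exp t"
      using exp_series_tail_le[OF t, of m] exp_series_tail_le[OF t, of "Suc m"]
      unfolding X_def[abs_def] Y_def[abs_def] by auto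
    have s': "summable (\<lambda>j. (X t j + Y t j) / Gamma p)"
      using s by (intro summable_divide summable_add)
    have nn: "0 \<le> t powr (p - 1 + real j) / Gamma (p + real j)" for j
      using assms by (intro divide_nonneg_pos Gamma_real_pos) auto
    have "exp_tail p t \<le> (\<Sum>j. (X t j + Y t j) / Gamma p)"
      unfolding exp_tail_def by (rule suminf_le_nonneg[OF nn term_le[OF t] s'])
    also have "\<dots> = (suminf (X t) + suminf (Y t)) / Gamma p"
      using s by (simp add: suminf_divide suminf_add summable_add)
    also have "\<dots> \<le> (fact m * exp t + fact (Suc m) * exp t) / Gamma p"
      using s G by (intro divide_right_mono add_mono) auto
    finally show ?thesis by (simp add: algebra_simps add_divide_distrib)
  qed
  moreover have "(fact m + fact (Suc m)) / Gamma p > 0" using G by (auto intro!: divide_pos_pos add_pos_pos)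
  ultimately show ?thesis by blast
qed

text \<open>The bound that is sharp near $0$, where $\exp_p(t)$ behaves like $t^{p-1}$.\<close>

lemma exp_tail_le_powr:
  assumes "p > 1" "t \<ge> 0"
  shows "exp_tail p t \<le> t powr (p - 1) * exp t / Gamma p"
proof -
  have G: "Gamma p > 0" using assms by (intro Gamma_real_pos) auto
  have s: "summable (\<lambda>j. t ^ j / fact j)" and e: "(\<Sum>j. t ^ j / fact j) = exp t"
    using exp_converges[of t] by (auto simp: sums_iff divide_inverse mult.commute)
  have term_le: "t powr (p - 1 + real j) / Gamma (p + real j) \<le> (t powr (p - 1) / Gamma p) * (t ^ j / fact j)" for j
  proof -
    have "fact j \<le> pochhammer p j"
      unfolding pochhammer_fact pochhammer_prod using assms by (intro prod_mono) auto
    moreover have "Gamma (p + real j) = pochhammer p j * Gamma p"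
      using Gamma_add_nat[of p j] assms by simp
    moreover have "t powr (p - 1 + real j) = t powr (p - 1) * t ^ j"
      using assms by (cases "t = 0") (auto simp: powr_add powr_realpow)
    ultimately have "t powr (p - 1 + real j) / Gamma (p + real j) = t powr (p - 1) * t ^ j / (pochhammer p j * Gamma p)"
      by simp
    also have "\<dots> \<le> t powr (p - 1) * t ^ j / (fact j * Gamma p)"
      using G assms \<open>fact j \<le> pochhammer p j\<close> pochhammer_pos[of p j]
      by (intro divide_left_mono mult_right_mono mult_pos_pos) auto
    finally show ?thesis by (simp add: mult.commute)
  qed
  have nn: "0 \<le> t powr (p - 1 + real j) / Gamma (p + real j)" for j
    using assms by (intro divide_nonneg_pos Gamma_real_pos) auto
  have s': "summable (\<lambda>j. (t powr (p - 1) / Gamma p) * (t ^ j / fact j))"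
    using s by (rule summable_mult)
  have "exp_tail p t \<le> (\<Sum>j. (t powr (p - 1) / Gamma p) * (t ^ j / fact j))"
    unfolding exp_tail_def by (rule suminf_le_nonneg[OF nn term_le s'])
  also have "\<dots> = (t powr (p - 1) / Gamma p) * exp t"
    by (simp only: suminf_mult[OF s] e)
  finally show ?thesis by simp
qed

section \<open>Functions of sharp logarithmic growth\<close>

lemma powr_add_le:
  fixes A B q :: real
  assumes "A > 0" "B \<ge> 0" "q \<ge> 1"
  shows "(A + B) powr q \<le> A powr q + q * B * (A + B) powr (q - 1)"
proof (cases "B = 0")
  case False
  then have "A < A + B" using assms by simp
  moreover have "((\<lambda>x. x powr q) has_real_derivative q * x powr (q - 1)) (at x)" if "A \<le> x" for x
    using that assms by (intro has_real_derivative_powr) auto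
  ultimately obtain z where z: "A < z" "z < A + B" "(A + B) powr q - A powr q = (A + B - A) * (q * z powr (q - 1))"
    using MVT2[of A "A + B" "\<lambda>x. x powr q" "\<lambda>x. q * x powr (q - 1)"] by blast
  have "z powr (q - 1) \<le> (A + B) powr (q - 1)" using z assms by (intro powr_mono2) auto
  then have "B * (q * z powr (q - 1)) \<le> B * (q * (A + B) powr (q - 1))"
    using assms by (intro mult_left_mono) auto
  then show ?thesis using z by (simp add: algebra_simps)
qed simp

text \<open>The elementary core of the estimate of level sets. \<open>N\<close> is the logarithmic length before some point and
  \<open>d\<close> the length after it; \<open>e1\<close> and \<open>e2\<close> are the $L^p$ norms available before and after the point.
  By the first inequality the growth before the point is optimal up to a loss \<open>\<mu>\<close>, which forces
  $e_2^p = O(\mu/N)$; the second one says that the growth nevertheless continues over \<open>d\<close>.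
  Comparing $(N+d-\mu)$ with the \<open>q\<close>-th power of the right-hand side bounds \<open>d\<close>, because the mixed term
  is $O(\mu^{1/p}(d+1)^{1/q})$. This fails if \<open>d\<close> is much larger than \<open>N\<close>, and then the lower bound
  on \<open>N\<close> makes the right-hand side too small.\<close>

lemma two_point:
  fixes p q :: real
  assumes p: "p > 1" and q: "q > 1" and pq: "1 / p + 1 / q = 1"
  shows "\<exists>\<Gamma>\<ge>2. \<exists>C\<ge>1. \<forall>N \<mu> d e1 e2. 1 \<le> \<mu> \<longrightarrow> \<Gamma> * \<mu> \<le> N \<longrightarrow> 0 \<le> d \<longrightarrow> 0 \<le> e1 \<longrightarrow> 0 \<le> e2 \<longrightarrow>
      e1 powr p + e2 powr p \<le> 1 \<longrightarrow>
      (N - \<mu>) powr (1 / q) \<le> 3 * N powr (- 1 / p) + e1 * N powr (1 / q) + e2 \<longrightarrow>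
      (N + d - \<mu>) powr (1 / q) \<le> 3 * N powr (- 1 / p) + e1 * N powr (1 / q) + e2 * (d + 1) powr (1 / q) \<longrightarrow>
      d \<le> C * \<mu>"
proof -
  have pq1: "q - 1 = q / p" "1 / q * (q - 1) = 1 / p" "(p - 1) * q = p"
    using p q pq by (auto simp: field_simps)
  define c1 where "c1 = max (8 * p) ((2 * p) powr q)"
  define c2 where "c2 = 3 + c1 powr (1 / p)"
  define \<Gamma> where "\<Gamma> = max 2 ((2 * (2 * c2) powr q) powr (p / q))"
  define c3 where "c3 = q * 2 powr (q - 1) * c2"
  define K where "K = (c3 * 2 powr (1 / q)) powr p"
  have c1: "c1 > 0" using p by (auto simp: c1_def)
  have c2: "c2 \<ge> 3" by (simp add: c2_def)
  have K: "K \<ge> 0" by (simp add: K_def)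
  have c3: "c3 > 0" using q c2 by (simp add: c3_def)
  have "d \<le> (4 + 2 * K) * \<mu>"
    if \<mu>: "1 \<le> \<mu>" and N: "\<Gamma> * \<mu> \<le> N" and d: "0 \<le> d" and e: "0 \<le> e1" "0 \<le> e2" "e1 powr p + e2 powr p \<le> 1"
      and A1: "(N - \<mu>) powr (1 / q) \<le> 3 * N powr (- 1 / p) + e1 * N powr (1 / q) + e2"
      and A2: "(N + d - \<mu>) powr (1 / q) \<le> 3 * N powr (- 1 / p) + e1 * N powr (1 / q) + e2 * (d + 1) powr (1 / q)"
    for N \<mu> d e1 e2
  proof -
    have "2 * \<mu> \<le> \<Gamma> * \<mu>" using \<mu> by (intro mult_right_mono) (auto simp: \<Gamma>_def)
    then have N2: "N \<ge> 2 * \<mu>" "N \<ge> 2" "N > 0" "\<mu> < N" using N \<mu> by linarith+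
    \<comment> \<open>energy spent after the point is missing, to first order, before it\<close>
    have e1: "e1 \<le> 1 - e2 powr p / p"
    proof -
      have "e1 * 1 \<le> e1 powr p / p + 1 powr q / q"
        by (rule Youngs_inequality) (use assms e in auto)
      also have "\<dots> \<le> (1 - e2 powr p) / p + 1 / q"
        using e p q by (intro add_mono divide_right_mono) auto
      finally show ?thesis using pq by (simp add: diff_divide_distrib)
    qed
    have e1_1: "e1 \<le> 1" using e1 p by (smt (verit) divide_nonneg_pos powr_ge_zero)
    have e2: "e2 powr p \<le> c1 * \<mu> / N"
    proof -
      have "1 - \<mu> / N \<le> (1 - \<mu> / N) powr (1 / q)"
        using powr_mono'[of "1 / q" 1 "1 - \<mu> / N"] N2 \<mu> q by (auto simp: field_simps)
      then have "(1 - \<mu> / N) * N powr (1 / q) \<le> (1 - \<mu> / N) powr (1 / q) * N powr (1 / q)"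
        by (intro mult_right_mono) auto
      also have "\<dots> = ((1 - \<mu> / N) * N) powr (1 / q)"
        by (rule powr_mult[symmetric])
      also have "(1 - \<mu> / N) * N = N - \<mu>"
        using N2 by (simp add: left_diff_distrib)
      also note A1
      also have "3 * N powr (- 1 / p) + e1 * N powr (1 / q) + e2 \<le>
          (3 * (1 / N) + (1 - e2 powr p / p) + e2 * N powr (- 1 / q)) * N powr (1 / q)"
      proof -
        have "N powr (- 1 / p) = (1 / N) * N powr (1 / q)"
        proof -
          have "- 1 / p = 1 / q - 1" using pq by simp
          then show ?thesis using N2 by (simp add: powr_diff)
        qed
        moreover have "e2 = e2 * N powr (- 1 / q) * N powr (1 / q)"
          using N2 by (simp add: mult.assoc flip: powr_add)
        moreover have "e1 * N powr (1 / q) \<le> (1 - e2 powr p / p) * N powr (1 / q)"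
          by (intro mult_right_mono e1) auto
        ultimately show ?thesis unfolding distrib_right by linarith
      qed
      finally have "1 - \<mu> / N \<le> 3 * (1 / N) + (1 - e2 powr p / p) + e2 * N powr (- 1 / q)"
        using N2 by (simp add: mult_le_cancel_right)
      moreover have "1 / N \<le> \<mu> / N" using \<mu> N2 by (intro divide_right_mono) auto
      ultimately have "e2 powr p / p \<le> 4 * (\<mu> / N) + e2 * N powr (- 1 / q)"
        by linarith
      then have main: "e2 powr p / p \<le> 4 * \<mu> / N + e2 * N powr (- 1 / q)" by simp
      show ?thesis
      \<comment> \<open>unless the loss accounts for e2, the inequality bounds a positive power of e2 in terms of N\<close>
      proof (cases "e2 powr p / (2 * p) \<le> 4 * \<mu> / N")
        case True
        then have "e2 powr p \<le> 8 * p * \<mu> / N" using p N2 by (simp add: field_simps)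
        also have "\<dots> \<le> c1 * \<mu> / N" using \<mu> N2 by (intro divide_right_mono mult_right_mono) (auto simp: c1_def)
        finally show ?thesis .
      next
        case False
        then have *: "e2 powr p \<le> 2 * p * e2 * N powr (- 1 / q)" 
        proof -
          have "e2 powr p / p = 2 * (e2 powr p / (2 * p))" by simp
          then have "e2 powr p / (2 * p) \<le> e2 * N powr (- 1 / q)" using main False by linarith
          then show ?thesis using p by (simp add: pos_divide_le_eq mult_ac)
        qed
        have "e2 > 0" using False \<mu> N2 p e by (cases "e2 = 0") auto
        have "e2 powr (p - 1) * e2 = e2 powr p" using \<open>e2 > 0\<close> by (simp add: powr_diff)
        then have "e2 powr (p - 1) \<le> 2 * p * N powr (- 1 / q)"
          using * \<open>e2 > 0\<close> by (metis mult.assoc mult.commute mult_le_cancel_right_pos)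
        then have "(e2 powr (p - 1)) powr q \<le> (2 * p * N powr (- 1 / q)) powr q"
          using q by (intro powr_mono2) auto
        moreover have "(e2 powr (p - 1)) powr q = e2 powr p" by (simp add: powr_powr pq1)
        moreover have "(N powr (- 1 / q)) powr q = 1 / N"
          using q N2 by (simp only: powr_powr) (simp add: powr_minus_divide)
        ultimately have "e2 powr p \<le> (2 * p) powr q / N"
          by (simp only: powr_mult) simp
        also have "\<dots> \<le> c1 * \<mu> / N"
          using \<mu> N2 c1 mult_mono[of "(2 * p) powr q" c1 1 \<mu>] by (intro divide_right_mono) (auto simp: c1_def)
        finally show ?thesis .
      qed
    qed
    \<comment> \<open>A is the optimal growth over the length N, and B collects all other contributions\<close>
    define A where "A = N powr (1 / q)"
    define B where "B = c2 * (\<mu> / N) powr (1 / p) * (d + 1) powr (1 / q)"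
    have A: "A > 0" using N2 by (simp add: A_def)
    have B: "B \<ge> 0" using c2 by (simp add: B_def)
    have d1: "1 \<le> (d + 1) powr (1 / q)" using d q by (simp add: ge_one_powr_ge_zero)
    have "e2 \<le> (c1 * \<mu> / N) powr (1 / p)"
    proof -
      have "(e2 powr p) powr (1 / p) \<le> (c1 * \<mu> / N) powr (1 / p)"
        using e2 p by (intro powr_mono2) auto
      then show ?thesis using e p by (simp add: powr_powr)
    qed
    also have "\<dots> = c1 powr (1 / p) * (\<mu> / N) powr (1 / p)"
      using c1 \<mu> N2 by (simp add: powr_mult powr_divide)
    finally have e2': "e2 \<le> c1 powr (1 / p) * (\<mu> / N) powr (1 / p)" .
    have "N powr (- 1 / p) = (1 / N) powr (1 / p)"
      using powr_minus_divide[of N "1 / p"] N2 by (simp add: powr_divide)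
    also have "\<dots> \<le> (\<mu> / N) powr (1 / p) * 1"
      using \<mu> N2 p by (auto intro!: powr_mono2 divide_right_mono)
    also have "\<dots> \<le> (\<mu> / N) powr (1 / p) * (d + 1) powr (1 / q)"
      by (intro mult_left_mono d1) auto
    finally have "3 * N powr (- 1 / p) + e2 * (d + 1) powr (1 / q) \<le>
        3 * ((\<mu> / N) powr (1 / p) * (d + 1) powr (1 / q)) + (c1 powr (1 / p) * (\<mu> / N) powr (1 / p)) * (d + 1) powr (1 / q)"
      by (intro add_mono mult_left_mono mult_right_mono e2') auto
    also have "\<dots> = B" by (simp add: B_def c2_def algebra_simps)
    finally have "3 * N powr (- 1 / p) + e2 * (d + 1) powr (1 / q) \<le> B" .
    moreover have "e1 * A \<le> 1 * A" using A e1_1 by (intro mult_right_mono) auto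
    ultimately have "(N + d - \<mu>) powr (1 / q) \<le> A + B" using A2 by (simp add: A_def)
    then have "((N + d - \<mu>) powr (1 / q)) powr q \<le> (A + B) powr q"
      using q by (intro powr_mono2) auto
    then have main: "N + d - \<mu> \<le> (A + B) powr q"
      using q N2 d by (simp add: powr_powr)
    show ?thesis
    proof (cases "B \<le> A")
      case True
      have "(A + B) powr q \<le> A powr q + q * B * (A + B) powr (q - 1)"
        using A B q by (intro powr_add_le) auto
      also have "\<dots> \<le> A powr q + q * B * (2 * A) powr (q - 1)"
        using True A B q by (intro add_mono mult_left_mono powr_mono2) auto
      also have "(2 * A) powr (q - 1) = 2 powr (q - 1) * N powr (1 / p)"
        unfolding A_def powr_mult powr_powr pq1(2) ..
      also have "A powr q = N" using N2 q by (simp add: A_def powr_powr)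
      also have "q * B * (2 powr (q - 1) * N powr (1 / p)) = c3 * (\<mu> powr (1 / p) * (d + 1) powr (1 / q))"
        using N2 \<mu> by (simp add: B_def c3_def powr_divide)
      finally have 1: "(A + B) powr q \<le> N + c3 * (\<mu> powr (1 / p) * (d + 1) powr (1 / q))" .
      have "c3 * (\<mu> powr (1 / p) * (d + 1) powr (1 / q)) = (K * \<mu>) powr (1 / p) * ((d + 1) / 2) powr (1 / q)"
        using \<mu> d c3 p by (simp add: K_def powr_mult powr_divide powr_powr)
      also have "\<dots> \<le> 1 / p * (K * \<mu>) + 1 / q * ((d + 1) / 2)"
        by (rule Youngs_inequality_0) (use p q pq \<mu> d c3 in \<open>auto simp: K_def\<close>)
      also have "\<dots> \<le> 1 * (K * \<mu>) + 1 * ((d + 1) / 2)"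
        using p q K \<mu> d by (intro add_mono mult_right_mono) (auto simp: field_simps)
      finally have 2: "c3 * (\<mu> powr (1 / p) * (d + 1) powr (1 / q)) \<le> K * \<mu> + (d + 1) / 2" by simp
      have "N + d - \<mu> \<le> N + (K * \<mu> + (d + 1) / 2)"
        by (rule order_trans[OF order_trans[OF main 1] add_left_mono[OF 2]])
      then have "d \<le> 2 * \<mu> + 2 * (K * \<mu>) + 1" by (simp add: field_simps)
      then show ?thesis using \<mu> by (simp add: algebra_simps)
    next
      case False
      have "(A + B) powr q \<le> (2 * B) powr q"
        using False A B q by (intro powr_mono2) auto
      also have "\<dots> = (2 * c2) powr q * (\<mu> / N) powr (q / p) * (d + 1)"
        using c2 d q \<mu> N2 by (simp add: B_def powr_mult powr_powr)
      also have "\<dots> \<le> (2 * c2) powr q * (1 / \<Gamma>) powr (q / p) * (d + 1)"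
        using N N2 p q \<mu> d by (intro mult_left_mono mult_right_mono powr_mono2) (auto simp: field_simps \<Gamma>_def)
      also have "\<dots> \<le> 1 / 2 * (d + 1)"
      proof (rule mult_right_mono)
        have "2 * (2 * c2) powr q = ((2 * (2 * c2) powr q) powr (p / q)) powr (q / p)"
          using p q c2 by (simp add: powr_powr)
        also have "\<dots> \<le> \<Gamma> powr (q / p)"
          using p q by (intro powr_mono2) (auto simp: \<Gamma>_def)
        finally show "(2 * c2) powr q * (1 / \<Gamma>) powr (q / p) \<le> 1 / 2"
          by (simp add: powr_divide field_simps \<Gamma>_def)
      qed (use d in auto)
      finally have "d \<le> 2 * \<mu>" using main N2 \<mu> by simp
      then show ?thesis using K \<mu> by (simp add: algebra_simps) (smt (verit) mult_nonneg_nonneg)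
    qed
  qed
  moreover have "\<Gamma> \<ge> 2" by (simp add: \<Gamma>_def)
  moreover have "4 + 2 * K \<ge> 1" using K by simp
  ultimately show ?thesis by meson
qed

text \<open>Here \<open>x\<close>, \<open>y\<close>, \<open>m\<close> are values of $t = \ln M - (\eta+1)\ln r$, so that large values correspond to small
  radii. The numbers \<open>e1\<close> and \<open>e2\<close> are the $L^p$ norms of the right-hand side between \<open>y\<close> and \<open>m\<close> and
  beyond \<open>m\<close>; the latter part also acts from radii smaller than that of \<open>x\<close>, which accounts for the
  summand $1$ in $x - m + 1$. The second clause encodes an $L^p$ norm of \<open>W\<close> normalised by \<open>M\<close>.\<close>

definition log_growth :: "real \<Rightarrow> real \<Rightarrow> (real \<Rightarrow> real) \<Rightarrow> bool"
  where "log_growth p q W \<longleftrightarrow>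
    (\<forall>m y. y \<le> m \<longrightarrow> (\<exists>e1\<ge>0. \<exists>e2\<ge>0. e1 powr p + e2 powr p \<le> 1 \<and>
      (\<forall>x\<ge>m. W x \<le> W y + e1 * (m - y) powr (1 / q) + e2 * (x - m + 1) powr (1 / q)))) \<and>
    (\<forall>s. \<exists>y. s - 1 \<le> y \<and> y \<le> s \<and> W y \<le> exp (s / p))"

lemma log_growth_bound:
  assumes p: "p > 1" and q: "q > 1" and W: "log_growth p q W" and s: "s \<le> m"
  obtains e1 e2 where "e1 \<ge> 0" "e2 \<ge> 0" "e1 powr p + e2 powr p \<le> 1"
    "\<forall>x\<ge>m. W x \<le> exp (s / p) + e1 * (m - s + 1) powr (1 / q) + e2 * (x - m + 1) powr (1 / q)"
proof -
  obtain y where y: "s - 1 \<le> y" "y \<le> s" "W y \<le> exp (s / p)"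
    using W unfolding log_growth_def by blast
  then have "y \<le> m" using s by simp
  then obtain e1 e2 where e: "e1 \<ge> 0" "e2 \<ge> 0" "e1 powr p + e2 powr p \<le> 1"
    "\<forall>x\<ge>m. W x \<le> W y + e1 * (m - y) powr (1 / q) + e2 * (x - m + 1) powr (1 / q)"
    using W unfolding log_growth_def by blast
  have "e1 * (m - y) powr (1 / q) \<le> e1 * (m - s + 1) powr (1 / q)"
    using e y s q by (intro mult_left_mono powr_mono2) auto
  then have "W x \<le> exp (s / p) + e1 * (m - s + 1) powr (1 / q) + e2 * (x - m + 1) powr (1 / q)" if "x \<ge> m" for x
    using e(4)[rule_format, OF that] y(3) by linarith
  then show ?thesis using that e(1-3) by blast
qed

lemma powr_le_1_imp_le_1:
  fixes e p :: real
  assumes "e powr p \<le> 1" "p > 0"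
  shows "e \<le> 1"
  using assms gr_one_powr[of e p] by linarith

text \<open>The value $4$ is a convenient threshold: starting at distance at most $1$ from \<open>t\<close>, the two growth
  terms contribute at most $1$ each, so $e^{t/p} \ge 2$.\<close>

lemma log_growth_large_imp_pos:
  assumes p: "p > 1" and q: "q > 1" and W: "log_growth p q W" and "W t \<ge> 4"
  shows "t > 0"
proof -
  obtain e1 e2 where e: "e1 \<ge> 0" "e2 \<ge> 0" "e1 powr p + e2 powr p \<le> 1"
    "\<forall>x\<ge>t. W x \<le> exp (t / p) + e1 * (t - t + 1) powr (1 / q) + e2 * (x - t + 1) powr (1 / q)"
    using log_growth_bound[OF p q W, of t t] by auto
  have "e1 powr p \<le> 1" "e2 powr p \<le> 1" using e(3) powr_ge_zero[of e1 p] powr_ge_zero[of e2 p] by linarith+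
  then have "e1 \<le> 1" "e2 \<le> 1" using powr_le_1_imp_le_1 p by auto
  moreover have "W t \<le> exp (t / p) + e1 + e2" using e(4)[rule_format, of t] by simp
  ultimately have "exp (t / p) > 1" using assms(4) by linarith
  then show ?thesis using p by (simp add: zero_less_divide_iff)
qed

lemma Hoelder_two:
  fixes e1 e2 a p q :: real
  assumes p: "p > 1" and q: "q > 1" and pq: "1 / p + 1 / q = 1"
    and e: "e1 \<ge> 0" "e2 \<ge> 0" "e1 powr p + e2 powr p \<le> 1" and N: "N \<ge> 0"
  shows "e1 * N powr (1 / q) + e2 \<le> (N + 1) powr (1 / q)"
proof -
  define S where "S = (N + 1) powr (1 / q)"
  have S: "S > 0" using N by (simp add: S_def)
  have Sq: "S powr q = N + 1" using N q by (simp add: S_def powr_powr)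
  have "e1 * (N powr (1 / q) / S) \<le> e1 powr p / p + (N powr (1 / q) / S) powr q / q"
    by (rule Youngs_inequality) (use p q pq e S in auto)
  moreover have "e2 * (1 / S) \<le> e2 powr p / p + (1 / S) powr q / q"
    by (rule Youngs_inequality) (use p q pq e S in auto)
  moreover have "(N powr (1 / q) / S) powr q = N / (N + 1)"
    using N q S by (simp add: powr_divide Sq powr_powr)
  moreover have "(1 / S) powr q = 1 / (N + 1)"
    using S by (simp add: powr_divide Sq)
  ultimately have "e1 * (N powr (1 / q) / S) + e2 * (1 / S) \<le>
      (e1 powr p + e2 powr p) / p + (N / (N + 1) + 1 / (N + 1)) / q"
    by (simp add: add_divide_distrib)
  also have "N / (N + 1) + 1 / (N + 1) = 1" using N by (simp add: field_simps)
  also have "(e1 powr p + e2 powr p) / p + 1 / q \<le> 1 / p + 1 / q"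
    using e p q by (intro add_mono divide_right_mono) auto
  finally have "(e1 * N powr (1 / q) + e2) / S \<le> 1"
    using pq by (simp add: add_divide_distrib)
  then show ?thesis using S by (simp add: S_def)
qed

text \<open>Growing from a point near $s$ yields $W^q \le t - s + O(1) + O(e^{s/p}t^{1/p})$. With $s = -\ln(t+1)$ the
  last term is bounded, and the resulting excess $\ln(t+1)$ is compensated by the logarithm of $W^q$.\<close>

lemma log_growth_upper:
  fixes p q :: real
  assumes p: "p > 1" and q: "q > 1" and pq: "1 / p + 1 / q = 1"
  shows "\<exists>c\<ge>0. \<forall>W t. log_growth p q W \<longrightarrow> W t \<ge> 4 \<longrightarrow> W t powr q - ln (W t powr q) \<le> t + c"
proof -
  define c where "c = 2 + q * 2 powr (q - 1) * 3 powr (1 / p)"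
  have c: "c \<ge> 2" using q by (simp add: c_def)
  have pq1: "1 / q * (q - 1) = 1 / p" using p q pq by (auto simp: field_simps)
  have "W t powr q - ln (W t powr q) \<le> t + c" if W: "log_growth p q W" and W4: "W t \<ge> 4" for W t
  proof -
    have t: "t > 0" by (rule log_growth_large_imp_pos[OF p q W W4])
    define s where "s = - ln (t + 1)"
    define N where "N = t - s + 1"
    have s: "s \<le> t" using t ln_ge_zero[of "t + 1"] unfolding s_def by linarith
    have N: "N \<ge> 1" "N + 1 \<le> 3 * (t + 1)"
      using t s ln_le_minus_one[of "t + 1"] by (auto simp: N_def s_def)
    obtain e1 e2 where e: "e1 \<ge> 0" "e2 \<ge> 0" "e1 powr p + e2 powr p \<le> 1"
      "\<forall>x\<ge>t. W x \<le> exp (s / p) + e1 * (t - s + 1) powr (1 / q) + e2 * (x - t + 1) powr (1 / q)"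
      using log_growth_bound[OF p q W s] by blast
    define A where "A = (N + 1) powr (1 / q)"
    define B where "B = (t + 1) powr (- 1 / p)"
    have AB: "A > 0" "A \<ge> 1" "B \<ge> 0" "B \<le> 1"
      using N t q p by (auto simp: A_def B_def ge_one_powr_ge_zero powr_minus intro!: inverse_le_1_iff[THEN iffD2])
    have "exp (s / p) = B" using t by (simp add: s_def B_def powr_def)
    moreover have "W t \<le> exp (s / p) + (e1 * N powr (1 / q) + e2)"
      using e(4)[rule_format, of t] by (simp add: N_def)
    moreover have "e1 * N powr (1 / q) + e2 \<le> A"
      unfolding A_def by (rule Hoelder_two[OF p q pq e(1-3)]) (use N in simp)
    ultimately have "W t \<le> A + B" by linarith
    then have "W t powr q \<le> (A + B) powr q" using q W4 by (intro powr_mono2) auto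
    also have "\<dots> \<le> A powr q + q * B * (A + B) powr (q - 1)"
      using AB q by (intro powr_add_le) auto
    also have "\<dots> \<le> A powr q + q * B * (2 * A) powr (q - 1)"
      using AB q by (intro add_mono mult_left_mono powr_mono2) auto
    also have "A powr q = N + 1" using N q by (simp add: A_def powr_powr)
    also have "(2 * A) powr (q - 1) = 2 powr (q - 1) * (N + 1) powr (1 / p)"
      unfolding A_def powr_mult powr_powr pq1 ..
    finally have 1: "W t powr q \<le> N + 1 + q * B * (2 powr (q - 1) * (N + 1) powr (1 / p))" .
    have "(N + 1) powr (1 / p) \<le> (3 * (t + 1)) powr (1 / p)"
      using N p by (intro powr_mono2) auto
    also have "\<dots> = 3 powr (1 / p) * (t + 1) powr (1 / p)" by (rule powr_mult)
    finally have "q * B * (2 powr (q - 1) * (N + 1) powr (1 / p)) \<le>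
        q * B * (2 powr (q - 1) * (3 powr (1 / p) * (t + 1) powr (1 / p)))"
      using AB q by (intro mult_left_mono) auto
    also have "\<dots> = q * 2 powr (q - 1) * 3 powr (1 / p) * (B * (t + 1) powr (1 / p))" by (simp add: mult_ac)
    also have "B * (t + 1) powr (1 / p) = 1" using t by (simp add: B_def flip: powr_add)
    finally have v: "W t powr q \<le> t + ln (t + 1) + c"
      using 1 by (simp add: N_def s_def c_def)
    have v1: "W t powr q \<ge> 1" using W4 q by (simp add: ge_one_powr_ge_zero)
    show ?thesis
    \<comment> \<open>if the q-th power of W is below t + 1 there is no excess to compensate\<close>
    proof (cases "W t powr q \<le> t + 1")
      case True
      then show ?thesis using c v1 ln_ge_zero[OF v1] by linarith
    next
      case False
      then have "ln (t + 1) \<le> ln (W t powr q)" using t by (intro ln_mono) auto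
      then show ?thesis using v by linarith
    qed
  qed
  moreover have "c \<ge> 0" using c by simp
  ultimately show ?thesis by blast
qed

text \<open>Both points are reached from the same starting point near $s = -\ln t_1$, which is good enough for
  \<open>t2\<close> as well because $\ln W^q$ obeys the same lower bound there. The energy used up to \<open>t1\<close> is then missing
  afterwards, as quantified by \<open>two_point\<close>.\<close>

lemma log_growth_level_set:
  fixes p q :: real
  assumes p: "p > 1" and q: "q > 1" and pq: "1 / p + 1 / q = 1"
  shows "\<exists>\<Gamma>\<ge>2. \<exists>C\<ge>1. \<forall>W k t1 t2. log_growth p q W \<longrightarrow> k \<ge> 0 \<longrightarrow> W t1 \<ge> 4 \<longrightarrow> W t2 \<ge> 4 \<longrightarrow>
      \<Gamma> * (k + 2) \<le> t1 \<longrightarrow> t1 \<le> t2 \<longrightarrow>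
      W t1 powr q - ln (W t1 powr q) \<ge> t1 - k \<longrightarrow> W t2 powr q - ln (W t2 powr q) \<ge> t2 - k \<longrightarrow>
      t2 - t1 \<le> C * (k + 2)"
proof -
  obtain \<Gamma> C where \<Gamma>: "\<Gamma> \<ge> 2" and C: "C \<ge> 1"
    and two: "\<And>N \<mu> d e1 e2. 1 \<le> \<mu> \<Longrightarrow> \<Gamma> * \<mu> \<le> N \<Longrightarrow> 0 \<le> d \<Longrightarrow> 0 \<le> e1 \<Longrightarrow> 0 \<le> e2 \<Longrightarrow>
      e1 powr p + e2 powr p \<le> 1 \<Longrightarrow>
      (N - \<mu>) powr (1 / q) \<le> 3 * N powr (- 1 / p) + e1 * N powr (1 / q) + e2 \<Longrightarrow>
      (N + d - \<mu>) powr (1 / q) \<le> 3 * N powr (- 1 / p) + e1 * N powr (1 / q) + e2 * (d + 1) powr (1 / q) \<Longrightarrow>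
      d \<le> C * \<mu>"
    using two_point[OF p q pq] by metis
  have "t2 - t1 \<le> C * (k + 2)"
    if W: "log_growth p q W" and k: "k \<ge> 0" and W4: "W t1 \<ge> 4" "W t2 \<ge> 4"
      and t1: "\<Gamma> * (k + 2) \<le> t1" and t12: "t1 \<le> t2"
      and F: "W t1 powr q - ln (W t1 powr q) \<ge> t1 - k" "W t2 powr q - ln (W t2 powr q) \<ge> t2 - k"
    for W k t1 t2
  proof -
    have "2 * (k + 2) \<le> \<Gamma> * (k + 2)" using \<Gamma> k by (intro mult_right_mono) auto
    then have T: "t1 \<ge> 2 * k + 4" using t1 by simp
    define s where "s = - ln t1"
    define N where "N = t1 - s + 1"
    have ln0: "ln t1 \<ge> 0" using T k by simp
    have s: "s \<le> t1" using T k ln0 unfolding s_def by linarith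
    have N: "t1 \<le> N" "N \<le> 3 * t1"
      using T k ln0 ln_le_minus_one[of t1] by (auto simp: N_def s_def)
    obtain e1 e2 where e: "e1 \<ge> 0" "e2 \<ge> 0" "e1 powr p + e2 powr p \<le> 1"
      "\<forall>x\<ge>t1. W x \<le> exp (s / p) + e1 * (t1 - s + 1) powr (1 / q) + e2 * (x - t1 + 1) powr (1 / q)"
      using log_growth_bound[OF p q W s] by blast
    have sN: "exp (s / p) \<le> 3 * N powr (- 1 / p)"
    proof -
      have "N powr (1 / p) \<le> (3 * t1) powr (1 / p)" using N T k p by (intro powr_mono2) auto
      also have "\<dots> = 3 powr (1 / p) * t1 powr (1 / p)" by (rule powr_mult)
      also have "\<dots> \<le> 3 powr 1 * t1 powr (1 / p)" using p by (intro mult_right_mono powr_mono) auto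
      finally have "N powr (1 / p) \<le> 3 * t1 powr (1 / p)" by simp
      then have "t1 powr (- 1 / p) \<le> 3 * N powr (- 1 / p)"
        using N T k by (simp add: powr_minus divide_simps)
      moreover have "exp (s / p) = t1 powr (- 1 / p)" using T k by (simp add: s_def powr_def)
      ultimately show ?thesis by simp
    qed
    \<comment> \<open>the logarithm in the level-set condition contributes at least ln (t1 / 2), which cancels s\<close>
    have lower: "(t1 + ln t1 - k - 1 + (t - t1)) powr (1 / q) \<le> W t"
      if t: "t1 \<le> t" "W t \<ge> 4" "W t powr q - ln (W t powr q) \<ge> t - k" for t
    proof -
      define v where "v = W t powr q"
      have v: "v \<ge> 1" using t q by (simp add: v_def ge_one_powr_ge_zero)
      have "v \<ge> t - k" using t(3) ln_ge_zero[OF v] by (simp add: v_def)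
      then have "v \<ge> t1 / 2" using t T k by simp
      then have "ln (t1 / 2) \<le> ln v" using T k by simp
      moreover have "ln (t1 / 2) = ln t1 - ln 2" using T k by (simp add: ln_div)
      moreover have "ln 2 \<le> (1::real)" using ln_le_minus_one[of 2] by simp
      ultimately have "t1 + ln t1 - k - 1 + (t - t1) \<le> v" using t(3) by (simp add: v_def)
      then have "(t1 + ln t1 - k - 1 + (t - t1)) powr (1 / q) \<le> v powr (1 / q)"
        using T k t ln0 q by (intro powr_mono2) auto
      also have "\<dots> = W t" using t q by (simp add: v_def powr_powr)
      finally show ?thesis .
    qed
    show ?thesis
    proof (rule two[OF _ _ _ e(1-3)])
      show "\<Gamma> * (k + 2) \<le> N" using t1 N by simp
      have "(N - (k + 2)) powr (1 / q) \<le> W t1"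
        using lower[OF _ W4(1) F(1)] by (simp add: N_def s_def algebra_simps)
      also have "W t1 \<le> exp (s / p) + e1 * N powr (1 / q) + e2"
        using e(4)[rule_format, of t1] by (simp add: N_def)
      finally show "(N - (k + 2)) powr (1 / q) \<le> 3 * N powr (- 1 / p) + e1 * N powr (1 / q) + e2"
        using sN by linarith
      have "(N + (t2 - t1) - (k + 2)) powr (1 / q) \<le> W t2"
        using lower[OF t12 W4(2) F(2)] by (simp add: N_def s_def algebra_simps)
      also have "W t2 \<le> exp (s / p) + e1 * N powr (1 / q) + e2 * ((t2 - t1) + 1) powr (1 / q)"
        using e(4)[rule_format, of t2] t12 by (simp add: N_def)
      finally show "(N + (t2 - t1) - (k + 2)) powr (1 / q) \<le>
          3 * N powr (- 1 / p) + e1 * N powr (1 / q) + e2 * ((t2 - t1) + 1) powr (1 / q)"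
        using sN by linarith
    qed (use k t12 in auto)
  qed
  with \<Gamma> C show ?thesis by blast
qed

text \<open>The points where $e^{W^q}/W^q$ is comparable to $e^{t-n}$ lie in an initial interval or in an interval
  around an arbitrary one of them, both of length $O(n+3)$. Intervals in place of the level sets
  themselves spare any regularity assumption on \<open>W\<close>.\<close>

lemma log_growth_covering:
  fixes p q :: real
  assumes p: "p > 1" and q: "q > 1" and pq: "1 / p + 1 / q = 1"
  shows "\<exists>K\<ge>0. \<exists>c. \<forall>W. log_growth p q W \<longrightarrow> (\<exists>\<tau>. \<forall>t. W t \<ge> 4 \<longrightarrow>
    (\<exists>n::nat. exp (W t powr q) / W t powr q \<le> exp (t + c - real n) \<and>
      (t \<in> {0..K * (real n + 3)} \<or> t \<in> {\<tau> n - K * (real n + 3)..\<tau> n + K * (real n + 3)})))"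
proof -
  obtain c where c: "c \<ge> 0" and up: "\<And>W t. log_growth p q W \<Longrightarrow> W t \<ge> 4 \<Longrightarrow> W t powr q - ln (W t powr q) \<le> t + c"
    using log_growth_upper[OF p q pq] by blast
  obtain \<Gamma> C where \<Gamma>: "\<Gamma> \<ge> 2" and C: "C \<ge> 1" and level: "\<And>W k t1 t2. log_growth p q W \<Longrightarrow> k \<ge> 0 \<Longrightarrow> W t1 \<ge> 4 \<Longrightarrow> W t2 \<ge> 4 \<Longrightarrow>
      \<Gamma> * (k + 2) \<le> t1 \<Longrightarrow> t1 \<le> t2 \<Longrightarrow>
      W t1 powr q - ln (W t1 powr q) \<ge> t1 - k \<Longrightarrow> W t2 powr q - ln (W t2 powr q) \<ge> t2 - k \<Longrightarrow>
      t2 - t1 \<le> C * (k + 2)"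
    using log_growth_level_set[OF p q pq] by metis
  define K where "K = max \<Gamma> C"
  have K: "K \<ge> 0" "K \<ge> \<Gamma>" "K \<ge> C" using \<Gamma> by (auto simp: K_def)
  have "\<exists>\<tau>. \<forall>t. W t \<ge> 4 \<longrightarrow>
    (\<exists>n::nat. exp (W t powr q) / W t powr q \<le> exp (t + c - real n) \<and>
      (t \<in> {0..K * (real n + 3)} \<or> t \<in> {\<tau> n - K * (real n + 3)..\<tau> n + K * (real n + 3)}))"
    if W: "log_growth p q W" for W
  proof -
    define P where "P n t \<longleftrightarrow> W t \<ge> 4 \<and> \<Gamma> * (real n + 3) \<le> t \<and> W t powr q - ln (W t powr q) \<ge> t - (real n + 1)" for n t
    \<comment> \<open>any far-out point of the n-th level set serves as centre\<close>
    define \<tau> where "\<tau> n = (SOME t. P n t)" for n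
    have "\<exists>n::nat. exp (W t powr q) / W t powr q \<le> exp (t + c - real n) \<and>
      (t \<in> {0..K * (real n + 3)} \<or> t \<in> {\<tau> n - K * (real n + 3)..\<tau> n + K * (real n + 3)})"
      if W4: "W t \<ge> 4" for t
    proof -
      define F where "F = W t powr q - ln (W t powr q)"
      have t0: "t > 0" by (rule log_growth_large_imp_pos[OF p q W W4])
      have Fc: "F \<le> t + c" unfolding F_def by (rule up[OF W W4])
      define n where "n = nat \<lfloor>t + c - F\<rfloor>"
      have n: "real n \<le> t + c - F" "t + c - F < real n + 1"
        using Fc by (auto simp: n_def)
      have "exp F = exp (W t powr q) / W t powr q"
        using W4 unfolding F_def exp_diff by (subst exp_ln) auto
      then have 1: "exp (W t powr q) / W t powr q \<le> exp (t + c - real n)"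
        using n(1) by (metis diff_le_eq exp_le_cancel_iff le_diff_eq add.commute)
      have 2: "t \<in> {\<tau> n - K * (real n + 3)..\<tau> n + K * (real n + 3)}" if "t \<notin> {0..K * (real n + 3)}"
      proof -
        have "K * (real n + 3) \<ge> \<Gamma> * (real n + 3)" using K by (intro mult_right_mono) auto
        moreover have "K * (real n + 3) < t" using that t0 by auto
        ultimately have "\<Gamma> * (real n + 3) \<le> t" by linarith
        then have Pt: "P n t" using W4 n c by (auto simp: P_def F_def)
        then have P\<tau>: "P n (\<tau> n)" unfolding \<tau>_def by (rule someI)
        have "t2 - t1 \<le> C * (real n + 3)" if "P n t1" "P n t2" "t1 \<le> t2" for t1 t2
          using level[OF W, of "real n + 1" t1 t2] that by (simp add: P_def add.assoc)
        from this[of t "\<tau> n"] this[of "\<tau> n" t] have "\<bar>t - \<tau> n\<bar> \<le> C * (real n + 3)"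
          using Pt P\<tau> by (cases "t \<le> \<tau> n") auto
        also have "\<dots> \<le> K * (real n + 3)" using K by (intro mult_right_mono) auto
        finally show ?thesis by auto
      qed
      show ?thesis using 1 2 by blast
    qed
    then show ?thesis by blast
  qed
  then show ?thesis using K(1) by blast
qed

section \<open>Hoelder's inequality and elementary integrals\<close>

text \<open>Bounds in place of the exact values of the two integrals suit the applications, where only estimates
  of the kernels are at hand.\<close>

lemma nn_integral_Hoelder:
  fixes f g :: "'a \<Rightarrow> real"
  assumes p: "p > 1" and q: "q > 1" and pq: "1 / p + 1 / q = 1"
    and meas [measurable]: "f \<in> borel_measurable M" "g \<in> borel_measurable M"
    and nn: "\<And>x. 0 \<le> f x" "\<And>x. 0 \<le> g x"
    and A: "(\<integral>\<^sup>+ x. ennreal (f x powr p) \<partial>M) \<le> ennreal A" "0 \<le> A"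
    and B: "(\<integral>\<^sup>+ x. ennreal (g x powr q) \<partial>M) \<le> ennreal B" "0 \<le> B"
  shows "(\<integral>\<^sup>+ x. ennreal (f x * g x) \<partial>M) \<le> ennreal (A powr (1 / p) * B powr (1 / q))"
proof (cases "A = 0 \<or> B = 0")
  case True
  have "AE x in M. f x * g x = 0"
  proof (cases "A = 0")
    case True
    then have "AE x in M. ennreal (f x powr p) = 0"
      using A by (subst nn_integral_0_iff_AE[symmetric]) auto
    then show ?thesis by eventually_elim (metis ennreal_eq_0_iff powr_ge_zero powr_eq_0_iff order_antisym mult_zero_left mult_zero_right)
  next
    case False
    then have "AE x in M. ennreal (g x powr q) = 0"
      using B \<open>A = 0 \<or> B = 0\<close> by (subst nn_integral_0_iff_AE[symmetric]) auto
    then show ?thesis by eventually_elim (metis ennreal_eq_0_iff powr_ge_zero powr_eq_0_iff order_antisym mult_zero_left mult_zero_right)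
  qed
  then have "(\<integral>\<^sup>+ x. ennreal (f x * g x) \<partial>M) = 0"
    by (subst nn_integral_0_iff_AE) auto
  then show ?thesis by simp
next
  case False
  then have AB: "A > 0" "B > 0" using A B by auto
  define a where "a = A powr (1 / p)"
  define b where "b = B powr (1 / q)"
  have ab: "a > 0" "b > 0" "a powr p = A" "b powr q = B"
    using AB p q by (auto simp: a_def b_def powr_powr)
  have "f x * g x \<le> (a * b / (A * p)) * f x powr p + (a * b / (B * q)) * g x powr q" for x
  proof -
    have "(f x / a) * (g x / b) \<le> (f x / a) powr p / p + (g x / b) powr q / q"
      by (rule Youngs_inequality) (use p q pq nn ab in auto)
    also have "\<dots> = f x powr p / (A * p) + g x powr q / (B * q)"
      using nn ab by (simp add: powr_divide)
    finally have "(f x / a) * (g x / b) * (a * b) \<le> (f x powr p / (A * p) + g x powr q / (B * q)) * (a * b)"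
      using ab by (intro mult_right_mono) auto
    then show ?thesis using ab by (simp add: field_simps)
  qed
  then have "(\<integral>\<^sup>+ x. ennreal (f x * g x) \<partial>M) \<le>
      (\<integral>\<^sup>+ x. ennreal (a * b / (A * p)) * ennreal (f x powr p) + ennreal (a * b / (B * q)) * ennreal (g x powr q) \<partial>M)"
    using ab AB p q nn by (intro nn_integral_mono) (simp flip: ennreal_mult ennreal_plus)
  also have "\<dots> = ennreal (a * b / (A * p)) * (\<integral>\<^sup>+ x. ennreal (f x powr p) \<partial>M) +
      ennreal (a * b / (B * q)) * (\<integral>\<^sup>+ x. ennreal (g x powr q) \<partial>M)"
    by (subst nn_integral_add) (auto simp: nn_integral_cmult)
  also have "\<dots> \<le> ennreal (a * b / (A * p)) * ennreal A + ennreal (a * b / (B * q)) * ennreal B"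
    using A B by (intro add_mono mult_left_mono) auto
  also have "\<dots> = ennreal (a * b / (A * p) * A + a * b / (B * q) * B)"
    using ab AB p q by (simp flip: ennreal_mult ennreal_plus)
  also have "a * b / (A * p) * A + a * b / (B * q) * B = a * b * (1 / p + 1 / q)"
    using AB by (simp add: field_simps)
  finally show ?thesis by (simp add: pq a_def b_def)
qed

lemma nn_integral_lebesgue_has_integral:
  fixes f :: "real \<Rightarrow> real"
  assumes "\<And>x. x \<in> S \<Longrightarrow> 0 \<le> f x" "(f has_integral I) S"
  shows "(\<integral>\<^sup>+ x\<in>S. ennreal (f x) \<partial>lebesgue) = ennreal I"
  using nn_integral_has_integral_lebesgue'[OF assms] by (simp add: nn_integral_completion)

lemma has_integral_powr:
  fixes k :: real
  assumes "0 < a" "a \<le> b" "k \<noteq> -1"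
  shows "((\<lambda>x. x powr k) has_integral ((b powr (k + 1) - a powr (k + 1)) / (k + 1))) {a..b}"
proof -
  have "((\<lambda>x. x powr k) has_integral (b powr (k + 1) / (k + 1) - a powr (k + 1) / (k + 1))) {a..b}"
  proof (rule fundamental_theorem_of_calculus)
    fix x assume "x \<in> {a..b}"
    then have "((\<lambda>x. x powr (k + 1) / (k + 1)) has_real_derivative x powr k) (at x within {a..b})"
      using assms by (auto intro!: derivative_eq_intros)
    then show "((\<lambda>x. x powr (k + 1) / (k + 1)) has_vector_derivative x powr k) (at x within {a..b})"
      by (simp add: has_real_derivative_iff_has_vector_derivative)
  qed (use assms in auto)
  then show ?thesis by (simp add: diff_divide_distrib)
qed

lemma has_integral_inverse:
  assumes "0 < a" "a \<le> b"
  shows "((\<lambda>x::real. 1 / x) has_integral ln (b / a)) {a..b}"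
proof -
  have "((\<lambda>x. 1 / x) has_integral (ln b - ln a)) {a..b}"
  proof (rule fundamental_theorem_of_calculus)
    fix x assume "x \<in> {a..b}"
    then have "(ln has_real_derivative 1 / x) (at x within {a..b})"
      using assms by (auto intro!: derivative_eq_intros)
    then show "(ln has_vector_derivative 1 / x) (at x within {a..b})"
      by (simp add: has_real_derivative_iff_has_vector_derivative)
  qed (use assms in auto)
  then show ?thesis using assms by (simp add: ln_div)
qed

lemma abs_integral_le_nn_integral:
  fixes v :: "real \<Rightarrow> real"
  assumes "v absolutely_integrable_on {a..b}"
  shows "ennreal \<bar>integral {a..b} v\<bar> \<le> (\<integral>\<^sup>+ x\<in>{a..b}. ennreal \<bar>v x\<bar> \<partial>lebesgue)"
proof -
  have "ennreal (norm (\<integral>x. indicator {a..b} x * v x \<partial>lebesgue)) \<le>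
      (\<integral>\<^sup>+ x. ennreal (norm (indicator {a..b} x * v x)) \<partial>lebesgue)"
    using assms by (intro integral_norm_bound_ennreal) (simp add: set_integrable_def)
  also have "(\<integral>\<^sup>+ x. ennreal (norm (indicator {a..b} x * v x)) \<partial>lebesgue) =
      (\<integral>\<^sup>+ x\<in>{a..b}. ennreal \<bar>v x\<bar> \<partial>lebesgue)"
    by (intro nn_integral_cong) (auto simp: indicator_def)
  also have "(\<integral>x. indicator {a..b} x * v x \<partial>lebesgue) = integral {a..b} v"
    using set_lebesgue_integral_eq_integral(2)[OF assms] by (simp add: set_lebesgue_integral_def)
  finally show ?thesis by simp
qed

lemma lebesgue_measurable_indicator_interval [measurable]:
  "(indicator {a<..b} :: real \<Rightarrow> real) \<in> borel_measurable lebesgue"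
  "(indicator {a..b} :: real \<Rightarrow> real) \<in> borel_measurable lebesgue"
  "(indicator {a<..} :: real \<Rightarrow> real) \<in> borel_measurable lebesgue"
  "(indicator {a<..b} :: real \<Rightarrow> ennreal) \<in> borel_measurable lebesgue"
  "(indicator {a..b} :: real \<Rightarrow> ennreal) \<in> borel_measurable lebesgue"
  "(indicator {a<..} :: real \<Rightarrow> ennreal) \<in> borel_measurable lebesgue"
  by (intro borel_measurable_indicator; simp)+

lemma lebesgue_measurable_powr [measurable]: "(\<lambda>s::real. s powr k) \<in> borel_measurable lebesgue"
  by (rule borel_imp_lebesgue_measurable) simp

lemma lebesgue_measurable_max [measurable]: "(\<lambda>s::real. max x s) \<in> borel_measurable lebesgue"
  by (rule borel_imp_lebesgue_measurable) simp

section \<open>The potential of the operator\<close>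

lemma AE_ex_small:
  assumes "AE x in lebesgue. x > 0 \<longrightarrow> P x" "(\<delta>::real) > 0"
  shows "\<exists>r. 0 < r \<and> r < \<delta> \<and> P r"
proof (rule ccontr)
  assume no: "\<not> ?thesis"
  have "AE x in lebesgue. x \<notin> {0<..<\<delta>}"
    using assms(1) by eventually_elim (use no in auto)
  then have "{0<..<\<delta>} \<in> null_sets lebesgue"
    by (subst (asm) AE_iff_null_sets[symmetric]) auto
  then show False using assms(2) by (auto simp: null_sets_def)
qed

text \<open>Hoelder's inequality against the weight $s^{2p-1}$, whose dual integral over $(r,1)$ is of order
  $r^{-q}$.\<close>

lemma derivative_growth_at_0:
  assumes p: "p > 1" and V: "antideriv V w" and w: "locally_integrable w"
    and fin: "(\<integral>\<^sup>+ r\<in>{0<..}. ennreal (\<bar>w r\<bar> powr p * r powr (2 * p - 1)) \<partial>lebesgue) < top"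
  shows "\<exists>K\<ge>0. \<forall>r. 0 < r \<and> r \<le> 1 \<longrightarrow> \<bar>V r\<bar> \<le> K / r"
proof -
  define q where "q = p / (p - 1)"
  have q: "q > 1" "1 / p + 1 / q = 1" using p by (auto simp: q_def field_simps)
  have e1: "(2 * p - 1) / p * q = 1 + q" using p by (simp add: q_def field_simps)
  obtain I where I: "I \<ge> 0" "(\<integral>\<^sup>+ r\<in>{0<..}. ennreal (\<bar>w r\<bar> powr p * r powr (2 * p - 1)) \<partial>lebesgue) = ennreal I"
    using fin by (cases "\<integral>\<^sup>+ r\<in>{0<..}. ennreal (\<bar>w r\<bar> powr p * r powr (2 * p - 1)) \<partial>lebesgue") auto
  define K where "K = I powr (1 / p)"
  have [measurable]: "(\<lambda>r. indicator {0<..} r * w r) \<in> borel_measurable lebesgue"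
    by (rule locally_integrable_measurable[OF w])
  have "\<bar>V r\<bar> \<le> (\<bar>V 1\<bar> + K) / r" if r: "0 < r" "r \<le> 1" for r
  proof -
    define f where "f s = indicator {r..1} s * (\<bar>indicator {0<..} s * w s\<bar> * s powr ((2 * p - 1) / p))" for s
    define h where "h s = indicator {r..1} s * s powr (- ((2 * p - 1) / p))" for s :: real
    have "(\<integral>\<^sup>+ s. ennreal (f s * h s) \<partial>lebesgue) \<le> ennreal (I powr (1 / p) * (r powr (- q)) powr (1 / q))"
    proof (rule nn_integral_Hoelder[OF p q])
      show "f \<in> borel_measurable lebesgue" unfolding f_def[abs_def] by measurable
      show "h \<in> borel_measurable lebesgue" unfolding h_def[abs_def] by measurable
      show "(\<integral>\<^sup>+ s. ennreal (f s powr p) \<partial>lebesgue) \<le> ennreal I"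
        unfolding I(2)[symmetric]
        using p r by (intro nn_integral_mono) (auto simp: f_def powr_mult powr_powr split: split_indicator)
      have "(\<integral>\<^sup>+ s. ennreal (h s powr q) \<partial>lebesgue) = (\<integral>\<^sup>+ s\<in>{r..1}. ennreal (s powr (- 1 - q)) \<partial>lebesgue)"
        using e1 by (intro nn_integral_cong) (auto simp: h_def powr_powr split: split_indicator)
      also have "\<dots> = ennreal ((1 powr (- 1 - q + 1) - r powr (- 1 - q + 1)) / (- 1 - q + 1))"
        using r q by (intro nn_integral_lebesgue_has_integral has_integral_powr) auto
      also have "\<dots> \<le> ennreal (r powr (- q))"
      proof (rule ennreal_leI)
        have "r powr (- q) \<ge> 1" using r q by (simp add: powr_minus powr_le1 one_le_inverse)
        moreover have "(r powr (- q) - 1) / q \<le> (r powr (- q) - 1) / 1"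
          using calculation q by (intro divide_left_mono) auto
        ultimately have "(r powr (- q) - 1) / q \<le> r powr (- q)" by simp
        moreover have "(1 powr (- 1 - q + 1) - r powr (- 1 - q + 1)) / (- 1 - q + 1) = (r powr (- q) - 1) / q"
          by (simp add: diff_divide_distrib)
        ultimately show "(1 powr (- 1 - q + 1) - r powr (- 1 - q + 1)) / (- 1 - q + 1) \<le> r powr (- q)"
          by (simp only:)
      qed
      finally show "(\<integral>\<^sup>+ s. ennreal (h s powr q) \<partial>lebesgue) \<le> ennreal (r powr (- q))" .
    qed (use I in \<open>auto simp: f_def h_def\<close>)
    also have "(r powr (- q)) powr (1 / q) = 1 / r"
      unfolding powr_powr using r q by (simp add: powr_minus_divide)
    also have "(\<integral>\<^sup>+ s. ennreal (f s * h s) \<partial>lebesgue) = (\<integral>\<^sup>+ s\<in>{r..1}. ennreal \<bar>w s\<bar> \<partial>lebesgue)"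
      using r by (intro nn_integral_cong) (auto simp: f_def h_def powr_minus split: split_indicator)
    finally have "(\<integral>\<^sup>+ s\<in>{r..1}. ennreal \<bar>w s\<bar> \<partial>lebesgue) \<le> ennreal (K / r)" by (simp add: K_def)
    then have "ennreal \<bar>integral {r..1} w\<bar> \<le> ennreal (K / r)"
      using abs_integral_le_nn_integral[OF locally_integrable_interval[OF w r(1)], of 1] by (rule order_trans[rotated])
    then have "\<bar>integral {r..1} w\<bar> \<le> K / r"
      using r by (simp add: K_def)
    moreover have "V 1 - V r = integral {r..1} w" using V r by (simp add: antideriv_def)
    moreover have "\<bar>V 1\<bar> \<le> \<bar>V 1\<bar> / r" using r by (simp add: field_simps mult_left_le_one_le)
    ultimately show ?thesis by (simp add: add_divide_distrib)
  qed
  then show ?thesis by (intro exI[of _ "\<bar>V 1\<bar> + K"]) (auto simp: K_def)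
qed

text \<open>By \<open>eq\<close>, \<open>H\<close> is the flux $r^\gamma V$. It has no boundary term at $0$, since
  $r^\gamma |V(r)| \le K r^{\gamma-1}$ tends to $0$ for $\gamma > 1$.\<close>

lemma flux_bound:
  assumes \<gamma>: "\<gamma> > 1" and H: "antideriv H g" and g: "locally_integrable g"
    and VK: "K \<ge> 0" "\<forall>r. 0 < r \<and> r \<le> 1 \<longrightarrow> \<bar>V r\<bar> \<le> K / r"
    and eq: "AE r in lebesgue. r > 0 \<longrightarrow> r powr \<gamma> * V r = H r" and x: "x > 0"
  shows "ennreal \<bar>H x\<bar> \<le> (\<integral>\<^sup>+ r\<in>{0<..x}. ennreal \<bar>g r\<bar> \<partial>lebesgue)"
proof (rule ennreal_le_epsilon)
  fix e :: real assume e: "e > 0"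
  define \<delta> where "\<delta> = min (min 1 x) ((e / (K + 1)) powr (1 / (\<gamma> - 1)))"
  have \<delta>: "\<delta> > 0" using e x VK by (auto simp: \<delta>_def)
  obtain r where r: "0 < r" "r < \<delta>" "r powr \<gamma> * V r = H r"
    using AE_ex_small[OF eq \<delta>] by auto
  have r1: "r \<le> 1" "r \<le> x" "r \<le> (e / (K + 1)) powr (1 / (\<gamma> - 1))" using r by (auto simp: \<delta>_def)
  have "\<bar>H r\<bar> = r powr \<gamma> * \<bar>V r\<bar>" unfolding r(3)[symmetric] by (simp add: abs_mult)
  also have "\<dots> \<le> r powr \<gamma> * (K / r)" using VK r r1 by (intro mult_left_mono) auto
  also have "\<dots> = K * r powr (\<gamma> - 1)" using r by (simp add: powr_diff)
  also have "\<dots> \<le> K * ((e / (K + 1)) powr (1 / (\<gamma> - 1))) powr (\<gamma> - 1)"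
    using r r1 VK \<gamma> by (intro mult_left_mono powr_mono2) auto
  also have "\<dots> = K * (e / (K + 1))" using \<gamma> e VK by (simp add: powr_powr)
  also have "\<dots> \<le> e" using e VK by (simp add: field_simps)
  finally have Hr: "\<bar>H r\<bar> \<le> e" .
  have "H x - H r = integral {r..x} g" using H r r1 by (simp add: antideriv_def)
  then have "\<bar>H x\<bar> \<le> \<bar>integral {r..x} g\<bar> + e" using Hr by linarith
  then have "ennreal \<bar>H x\<bar> \<le> ennreal \<bar>integral {r..x} g\<bar> + ennreal e"
    using e by (simp flip: ennreal_plus)
  also have "ennreal \<bar>integral {r..x} g\<bar> \<le> (\<integral>\<^sup>+ s\<in>{r..x}. ennreal \<bar>g s\<bar> \<partial>lebesgue)"
    by (rule abs_integral_le_nn_integral[OF locally_integrable_interval[OF g r(1)]])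
  also have "\<dots> \<le> (\<integral>\<^sup>+ s\<in>{0<..x}. ennreal \<bar>g s\<bar> \<partial>lebesgue)"
    using r by (intro nn_integral_mono) (auto split: split_indicator)
  finally show "ennreal \<bar>H x\<bar> \<le> (\<integral>\<^sup>+ s\<in>{0<..x}. ennreal \<bar>g s\<bar> \<partial>lebesgue) + ennreal e"
    by (simp add: add_right_mono)
qed

text \<open>Insert the bound for the flux into $U(y) - U(x) = \int_x^y v$ and exchange the integrals: each \<open>z\<close> is
  seen by the radii between $\max(x,z)$ and \<open>y\<close>.\<close>

lemma potential_bound:
  assumes \<gamma>: "\<gamma> > 1" and U: "antideriv U v" and v: "locally_integrable v" and g: "locally_integrable g"
    and flux: "\<And>r. r > 0 \<Longrightarrow> ennreal \<bar>H r\<bar> \<le> (\<integral>\<^sup>+ s\<in>{0<..r}. ennreal \<bar>g s\<bar> \<partial>lebesgue)"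
    and eq: "AE r in lebesgue. r > 0 \<longrightarrow> r powr \<gamma> * v r = H r" and xy: "0 < x" "x \<le> y"
  shows "ennreal \<bar>U x\<bar> \<le> ennreal \<bar>U y\<bar> +
    (\<integral>\<^sup>+ z\<in>{0<..y}. ennreal (\<bar>g z\<bar> * (max x z powr (1 - \<gamma>) / (\<gamma> - 1))) \<partial>lebesgue)"
proof -
  interpret pair_sigma_finite "lebesgue :: real measure" "lebesgue :: real measure"
    by (rule pair_sigma_finite_lebesgue)
  define g0 where "g0 z = \<bar>indicator {0<..} z * g z\<bar>" for z
  have g0m: "g0 \<in> borel_measurable lebesgue"
    unfolding g0_def[abs_def] using locally_integrable_measurable[OF g] by measurable
  note [measurable] = lebesgue_pair_fst lebesgue_pair_snd g0m
  have "U y - U x = integral {x..y} v" using U xy by (simp add: antideriv_def)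
  then have "\<bar>U x\<bar> \<le> \<bar>U y\<bar> + \<bar>integral {x..y} v\<bar>" by linarith
  then have "ennreal \<bar>U x\<bar> \<le> ennreal \<bar>U y\<bar> + ennreal \<bar>integral {x..y} v\<bar>"
    by (simp flip: ennreal_plus)
  also have "ennreal \<bar>integral {x..y} v\<bar> \<le> (\<integral>\<^sup>+ r\<in>{x..y}. ennreal \<bar>v r\<bar> \<partial>lebesgue)"
    by (rule abs_integral_le_nn_integral[OF locally_integrable_interval[OF v xy(1)]])
  also have "\<dots> \<le> (\<integral>\<^sup>+ r. (\<integral>\<^sup>+ z. (if x \<le> r \<and> r \<le> y \<and> 0 < z \<and> z \<le> r then ennreal (r powr (- \<gamma>) * g0 z) else 0) \<partial>lebesgue) \<partial>lebesgue)"
  proof (rule nn_integral_mono_AE)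
    show "AE r in lebesgue. ennreal \<bar>v r\<bar> * indicator {x..y} r \<le>
        (\<integral>\<^sup>+ z. (if x \<le> r \<and> r \<le> y \<and> 0 < z \<and> z \<le> r then ennreal (r powr (- \<gamma>) * g0 z) else 0) \<partial>lebesgue)"
      using eq
    proof eventually_elim
      fix r assume r: "r > 0 \<longrightarrow> r powr \<gamma> * v r = H r"
      show "ennreal \<bar>v r\<bar> * indicator {x..y} r \<le>
        (\<integral>\<^sup>+ z. (if x \<le> r \<and> r \<le> y \<and> 0 < z \<and> z \<le> r then ennreal (r powr (- \<gamma>) * g0 z) else 0) \<partial>lebesgue)"
      proof (cases "r \<in> {x..y}")
        case True
        then have r0: "r > 0" using xy by auto
        then have "H r = r powr \<gamma> * v r" using r by simp
        then have "\<bar>v r\<bar> = r powr (- \<gamma>) * \<bar>H r\<bar>"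
          using r0 by (simp add: abs_mult powr_minus)
        then have "ennreal \<bar>v r\<bar> = ennreal (r powr (- \<gamma>)) * ennreal \<bar>H r\<bar>"
          by (simp add: ennreal_mult)
        also have "\<dots> \<le> ennreal (r powr (- \<gamma>)) * (\<integral>\<^sup>+ s\<in>{0<..r}. ennreal \<bar>g s\<bar> \<partial>lebesgue)"
          by (intro mult_left_mono flux r0) auto
        also have "(\<integral>\<^sup>+ s\<in>{0<..r}. ennreal \<bar>g s\<bar> \<partial>lebesgue) = (\<integral>\<^sup>+ s\<in>{0<..r}. ennreal (g0 s) \<partial>lebesgue)"
          by (rule nn_integral_cong) (auto simp: g0_def split: split_indicator)
        also have "ennreal (r powr (- \<gamma>)) * (\<integral>\<^sup>+ s\<in>{0<..r}. ennreal (g0 s) \<partial>lebesgue) =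
            (\<integral>\<^sup>+ s. ennreal (r powr (- \<gamma>)) * (ennreal (g0 s) * indicator {0<..r} s) \<partial>lebesgue)"
        proof (rule nn_integral_cmult[symmetric])
          have "(indicator {0<..r} :: real \<Rightarrow> ennreal) \<in> borel_measurable lebesgue"
            by (intro borel_measurable_indicator) auto
          then show "(\<lambda>s. ennreal (g0 s) * indicator {0<..r} s) \<in> borel_measurable lebesgue"
            by measurable
        qed
        also have "\<dots> = (\<integral>\<^sup>+ z. (if x \<le> r \<and> r \<le> y \<and> 0 < z \<and> z \<le> r then ennreal (r powr (- \<gamma>) * g0 z) else 0) \<partial>lebesgue)"
          using True by (intro nn_integral_cong) (auto simp: ennreal_mult g0_def split: split_indicator)
        finally show ?thesis using True by simp
      qed simp
    qed
  qed
  also have "\<dots> = (\<integral>\<^sup>+ z. (\<integral>\<^sup>+ r. (if x \<le> r \<and> r \<le> y \<and> 0 < z \<and> z \<le> r then ennreal (r powr (- \<gamma>) * g0 z) else 0) \<partial>lebesgue) \<partial>lebesgue)"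
  proof (rule Fubini'[symmetric])
    have "(\<lambda>(r, z). (if x \<le> r \<and> r \<le> y \<and> 0 < z \<and> z \<le> r then ennreal (r powr (- \<gamma>) * g0 z) else 0)) =
      (\<lambda>w. if x \<le> fst w \<and> fst w \<le> y \<and> 0 < snd w \<and> snd w \<le> fst w then ennreal (fst w powr (- \<gamma>) * g0 (snd w)) else 0)"
      by auto
    also have "\<dots> \<in> borel_measurable (lebesgue \<Otimes>\<^sub>M lebesgue)" by measurable
    finally show "(\<lambda>(r, z). (if x \<le> r \<and> r \<le> y \<and> 0 < z \<and> z \<le> r then ennreal (r powr (- \<gamma>) * g0 z) else 0)) \<in>
      borel_measurable (lebesgue \<Otimes>\<^sub>M lebesgue)" .
  qed
  also have "\<dots> \<le> (\<integral>\<^sup>+ z\<in>{0<..y}. ennreal (\<bar>g z\<bar> * (max x z powr (1 - \<gamma>) / (\<gamma> - 1))) \<partial>lebesgue)"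
  proof (rule nn_integral_mono)
    fix z
    show "(\<integral>\<^sup>+ r. (if x \<le> r \<and> r \<le> y \<and> 0 < z \<and> z \<le> r then ennreal (r powr (- \<gamma>) * g0 z) else 0) \<partial>lebesgue) \<le>
        ennreal (\<bar>g z\<bar> * (max x z powr (1 - \<gamma>) / (\<gamma> - 1))) * indicator {0<..y} z"
    proof (cases "0 < z \<and> z \<le> y")
      case True
      have "(\<integral>\<^sup>+ r. (if x \<le> r \<and> r \<le> y \<and> 0 < z \<and> z \<le> r then ennreal (r powr (- \<gamma>) * g0 z) else 0) \<partial>lebesgue) =
          (\<integral>\<^sup>+ r. ennreal \<bar>g z\<bar> * (ennreal (r powr (- \<gamma>)) * indicator {max x z..y} r) \<partial>lebesgue)"
        using True by (intro nn_integral_cong) (auto simp: g0_def ennreal_mult mult.commute split: split_indicator)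
      also have "\<dots> = ennreal \<bar>g z\<bar> * (\<integral>\<^sup>+ r\<in>{max x z..y}. ennreal (r powr (- \<gamma>)) \<partial>lebesgue)"
      proof (rule nn_integral_cmult)
        have "(\<lambda>r. ennreal (r powr (- \<gamma>)) * indicator {max x z..y} r) \<in> borel_measurable borel" by measurable
        then show "(\<lambda>r. ennreal (r powr (- \<gamma>)) * indicator {max x z..y} r) \<in> borel_measurable lebesgue"
          by (simp add: measurable_completion)
      qed
      also have "(\<integral>\<^sup>+ r\<in>{max x z..y}. ennreal (r powr (- \<gamma>)) \<partial>lebesgue) =
          ennreal ((y powr (- \<gamma> + 1) - max x z powr (- \<gamma> + 1)) / (- \<gamma> + 1))"
        using True xy \<gamma> by (intro nn_integral_lebesgue_has_integral has_integral_powr) auto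
      also have "\<dots> \<le> ennreal (max x z powr (1 - \<gamma>) / (\<gamma> - 1))"
      proof (rule ennreal_leI)
        have "(y powr (- \<gamma> + 1) - max x z powr (- \<gamma> + 1)) / (- \<gamma> + 1) =
            (max x z powr (1 - \<gamma>) - y powr (1 - \<gamma>)) / (\<gamma> - 1)"
          using \<gamma> by (simp add: divide_simps) (simp add: algebra_simps)
        also have "\<dots> \<le> max x z powr (1 - \<gamma>) / (\<gamma> - 1)"
          using \<gamma> by (intro divide_right_mono) auto
        finally show "(y powr (- \<gamma> + 1) - max x z powr (- \<gamma> + 1)) / (- \<gamma> + 1) \<le> max x z powr (1 - \<gamma>) / (\<gamma> - 1)" .
      qed
      finally have "(\<integral>\<^sup>+ r. (if x \<le> r \<and> r \<le> y \<and> 0 < z \<and> z \<le> r then ennreal (r powr (- \<gamma>) * g0 z) else 0) \<partial>lebesgue) \<le>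
          ennreal \<bar>g z\<bar> * ennreal (max x z powr (1 - \<gamma>) / (\<gamma> - 1))"
        by (simp add: mult_left_mono)
      also have "\<dots> = ennreal (\<bar>g z\<bar> * (max x z powr (1 - \<gamma>) / (\<gamma> - 1)))"
        using \<gamma> by (intro ennreal_mult[symmetric]) auto
      finally show ?thesis using True by simp
    next
      case False
      then have "(\<lambda>r. if x \<le> r \<and> r \<le> y \<and> 0 < z \<and> z \<le> r then ennreal (r powr (- \<gamma>) * g0 z) else 0) = (\<lambda>_. 0)"
        by auto
      then show ?thesis by simp
    qed
  qed
  finally show ?thesis by (simp add: add_left_mono)
qed

lemma set_nn_integral_split:
  fixes f :: "real \<Rightarrow> ennreal"
  assumes "a \<le> m" "m \<le> b" "(\<lambda>z. f z * indicator {a<..m} z) \<in> borel_measurable lebesgue"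
    "(\<lambda>z. f z * indicator {m<..b} z) \<in> borel_measurable lebesgue"
  shows "(\<integral>\<^sup>+ z\<in>{a<..b}. f z \<partial>lebesgue) = (\<integral>\<^sup>+ z\<in>{a<..m}. f z \<partial>lebesgue) + (\<integral>\<^sup>+ z\<in>{m<..b}. f z \<partial>lebesgue)"
  unfolding nn_integral_add[OF assms(3,4), symmetric]
  using assms(1,2) by (intro nn_integral_cong) (auto simp: indicator_def)

text \<open>Hoelder's inequality separately on $(m,y)$ and on $(0,m)$, so that \<open>e1\<close> and \<open>e2\<close> share one unit of
  energy and depend on \<open>m\<close> and \<open>y\<close> only. The \<open>q\<close>-th power of the kernel in the dual weight is
  $\max(x,z)^{-(\eta+1)} z^\eta$: this is $1/z$ for $z \ge x$, and it integrates to $1/(\eta+1)$ over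
  $(0,x)$.\<close>

lemma two_scale_bound:
  assumes p: "p > 1" and q: "q > 1" and pq: "1 / p + 1 / q = 1"
    and \<eta>: "\<eta> > -1" and \<gamma>: "\<gamma> > 1" and rel: "(1 - \<gamma>) * q = - (\<eta> + 1)"
    and g: "locally_integrable g"
    and energy: "(\<integral>\<^sup>+ r\<in>{0<..}. ennreal (\<bar>g r\<bar> powr p * r powr (- (p - 1) * \<eta>)) \<partial>lebesgue) \<le> 1"
    and pot: "\<And>x y. 0 < x \<Longrightarrow> x \<le> y \<Longrightarrow> ennreal \<bar>U x\<bar> \<le> ennreal \<bar>U y\<bar> +
      (\<integral>\<^sup>+ z\<in>{0<..y}. ennreal (\<bar>g z\<bar> * (max x z powr (1 - \<gamma>) / (\<gamma> - 1))) \<partial>lebesgue)"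
    and my: "0 < m" "m \<le> y"
  shows "\<exists>e1\<ge>0. \<exists>e2\<ge>0. e1 powr p + e2 powr p \<le> 1 \<and> (\<forall>x. 0 < x \<and> x \<le> m \<longrightarrow>
    \<bar>U x\<bar> \<le> \<bar>U y\<bar> + (e1 * ln (y / m) powr (1 / q) + e2 * (1 / (\<eta> + 1) + ln (m / x)) powr (1 / q)) / (\<gamma> - 1))"
proof -
  define k where "k = - (p - 1) * \<eta>"
  define E where "E A = (\<integral>\<^sup>+ r\<in>A. ennreal (\<bar>g r\<bar> powr p * r powr k) \<partial>lebesgue)" for A
  define e where "e A = enn2real (E A) powr (1 / p)" for A
  have kq: "- k / p * q = \<eta>"
  proof -
    have "(p - 1) * q = p" using p q pq by (simp add: field_simps)
    moreover have "- k * q = \<eta> * ((p - 1) * q)" by (simp add: k_def algebra_simps)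
    ultimately have "- k * q = p * \<eta>" by simp
    then show ?thesis using p by (simp add: field_simps)
  qed
  define g0 where "g0 z = \<bar>indicator {0<..} z * g z\<bar>" for z
  have [measurable]: "g0 \<in> borel_measurable lebesgue"
    unfolding g0_def[abs_def] using locally_integrable_measurable[OF g] by measurable
  have g0: "g0 z = \<bar>g z\<bar>" if "z > 0" for z using that by (simp add: g0_def)
  have Emeas: "(\<lambda>r. ennreal (\<bar>g r\<bar> powr p * r powr k) * indicator {a<..b} r) \<in> borel_measurable lebesgue"
    if "a \<ge> 0" for a b
  proof -
    have "(\<lambda>r. ennreal (\<bar>g r\<bar> powr p * r powr k) * indicator {a<..b} r) =
        (\<lambda>r. ennreal (g0 r powr p * r powr k) * indicator {a<..b} r)"
      using that by (auto simp: g0 split: split_indicator)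
    also have "\<dots> \<in> borel_measurable lebesgue" by measurable
    finally show ?thesis .
  qed
  have "E {0<..m} + E {m<..y} = E {0<..y}"
    unfolding E_def by (rule set_nn_integral_split[symmetric]) (use my Emeas in auto)
  also have "\<dots> \<le> (\<integral>\<^sup>+ r\<in>{0<..}. ennreal (\<bar>g r\<bar> powr p * r powr k) \<partial>lebesgue)"
    unfolding E_def by (intro nn_integral_mono) (auto split: split_indicator)
  finally have E1: "E {0<..m} + E {m<..y} \<le> 1" using energy by (simp add: k_def)
  then have Efin: "E {0<..m} \<noteq> top" "E {m<..y} \<noteq> top" by (auto simp: top_unique)
  have "enn2real (E {0<..m}) + enn2real (E {m<..y}) \<le> 1"
    using E1 Efin by (metis enn2real_leI enn2real_plus ennreal_1 less_top zero_le_one)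
  then have sum_e: "e {m<..y} powr p + e {0<..m} powr p \<le> 1"
    using p by (simp add: e_def powr_powr)
  have Hoelder: "(\<integral>\<^sup>+ z\<in>{a<..b}. ennreal (\<bar>g z\<bar> * max x z powr (1 - \<gamma>)) \<partial>lebesgue) \<le> ennreal (e {a<..b} * B powr (1 / q))"
    if fin: "E {a<..b} \<noteq> top" and a: "a \<ge> 0" and x: "x > 0" and B: "B \<ge> 0"
      "(\<integral>\<^sup>+ z\<in>{a<..b}. ennreal (max x z powr (- (\<eta> + 1)) * z powr \<eta>) \<partial>lebesgue) \<le> ennreal B" for a b x B
  proof -
    define f where "f z = indicator {a<..b} z * (g0 z * z powr (k / p))" for z
    define h where "h z = indicator {a<..b} z * (max x z powr (1 - \<gamma>) * z powr (- k / p))" for z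
    have "(\<integral>\<^sup>+ z. ennreal (f z * h z) \<partial>lebesgue) \<le> ennreal (enn2real (E {a<..b}) powr (1 / p) * B powr (1 / q))"
    proof (rule nn_integral_Hoelder[OF p q pq])
      show "f \<in> borel_measurable lebesgue" unfolding f_def[abs_def] by measurable
      show "h \<in> borel_measurable lebesgue" unfolding h_def[abs_def] by measurable
      have "(\<integral>\<^sup>+ z. ennreal (f z powr p) \<partial>lebesgue) = E {a<..b}"
        unfolding E_def using p a
        by (intro nn_integral_cong) (auto simp: f_def g0 powr_mult powr_powr split: split_indicator)
      then show "(\<integral>\<^sup>+ z. ennreal (f z powr p) \<partial>lebesgue) \<le> ennreal (enn2real (E {a<..b}))"
        using fin by (simp add: less_top)
      have "(\<integral>\<^sup>+ z. ennreal (h z powr q) \<partial>lebesgue) =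
          (\<integral>\<^sup>+ z\<in>{a<..b}. ennreal (max x z powr (- (\<eta> + 1)) * z powr \<eta>) \<partial>lebesgue)"
      proof (rule nn_integral_cong)
        fix z
        show "ennreal (h z powr q) = ennreal (max x z powr (- (\<eta> + 1)) * z powr \<eta>) * indicator {a<..b} z"
        proof (cases "z \<in> {a<..b}")
          case True
          then have "h z powr q = max x z powr ((1 - \<gamma>) * q) * z powr (- k / p * q)"
            by (simp add: h_def powr_mult powr_powr)
          then show ?thesis using True unfolding kq rel by simp
        qed (simp add: h_def)
      qed
      then show "(\<integral>\<^sup>+ z. ennreal (h z powr q) \<partial>lebesgue) \<le> ennreal B" using B by simp
    qed (use B in \<open>auto simp: f_def h_def g0_def\<close>)
    moreover have "(\<integral>\<^sup>+ z\<in>{a<..b}. ennreal (\<bar>g z\<bar> * max x z powr (1 - \<gamma>)) \<partial>lebesgue) = (\<integral>\<^sup>+ z. ennreal (f z * h z) \<partial>lebesgue)"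
      using a by (intro nn_integral_cong) (auto simp: f_def h_def g0 powr_minus split: split_indicator)
    ultimately show ?thesis by (simp add: e_def)
  qed
  have bound: "\<bar>U x\<bar> \<le> \<bar>U y\<bar> + (e {m<..y} * ln (y / m) powr (1 / q) + e {0<..m} * (1 / (\<eta> + 1) + ln (m / x)) powr (1 / q)) / (\<gamma> - 1)"
    if x: "0 < x" "x \<le> m" for x
  proof -
    have inv: "max x z powr (- (\<eta> + 1)) * z powr \<eta> = 1 / z" if "x \<le> z" for z
    proof -
      have "z powr (- (\<eta> + 1)) * z powr \<eta> = z powr (- 1)" by (simp flip: powr_add)
      also have "\<dots> = 1 / z" using x that by (simp add: powr_minus_divide)
      finally show ?thesis using that by (simp add: max_def)
    qed
    have B1: "(\<integral>\<^sup>+ z\<in>{m<..y}. ennreal (max x z powr (- (\<eta> + 1)) * z powr \<eta>) \<partial>lebesgue) \<le> ennreal (ln (y / m))"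
    proof -
      have "(\<integral>\<^sup>+ z\<in>{m<..y}. ennreal (max x z powr (- (\<eta> + 1)) * z powr \<eta>) \<partial>lebesgue) \<le> (\<integral>\<^sup>+ z\<in>{m..y}. ennreal (1 / z) \<partial>lebesgue)"
      proof (rule nn_integral_mono)
        fix z
        show "ennreal (max x z powr (- (\<eta> + 1)) * z powr \<eta>) * indicator {m<..y} z \<le> ennreal (1 / z) * indicator {m..y} z"
          using x inv[of z] by (cases "m < z") (auto simp del: minus_add_distrib split: split_indicator)
      qed
      also have "\<dots> = ennreal (ln (y / m))"
        using my by (intro nn_integral_lebesgue_has_integral has_integral_inverse) auto
      finally show ?thesis .
    qed
    have B2: "(\<integral>\<^sup>+ z\<in>{0<..m}. ennreal (max x z powr (- (\<eta> + 1)) * z powr \<eta>) \<partial>lebesgue) \<le> ennreal (1 / (\<eta> + 1) + ln (m / x))"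
    proof -
      have "(\<integral>\<^sup>+ z\<in>{0<..m}. ennreal (max x z powr (- (\<eta> + 1)) * z powr \<eta>) \<partial>lebesgue) \<le>
          (\<integral>\<^sup>+ z. ennreal (x powr (- (\<eta> + 1)) * z powr \<eta>) * indicator {0..x} z + ennreal (1 / z) * indicator {x..m} z \<partial>lebesgue)"
      proof (rule nn_integral_mono)
        fix z
        show "ennreal (max x z powr (- (\<eta> + 1)) * z powr \<eta>) * indicator {0<..m} z \<le>
            ennreal (x powr (- (\<eta> + 1)) * z powr \<eta>) * indicator {0..x} z + ennreal (1 / z) * indicator {x..m} z"
          using x inv[of z] by (cases "x \<le> z") (auto simp: max_def split: split_indicator)
      qed
      also have "\<dots> = (\<integral>\<^sup>+ z\<in>{0..x}. ennreal (x powr (- (\<eta> + 1)) * z powr \<eta>) \<partial>lebesgue) + (\<integral>\<^sup>+ z\<in>{x..m}. ennreal (1 / z) \<partial>lebesgue)"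
      proof (rule nn_integral_add)
        have "(\<lambda>z. ennreal (1 / z) * indicator {x..m} z) \<in> borel_measurable borel" by measurable
        then show "(\<lambda>z. ennreal (1 / z) * indicator {x..m} z) \<in> borel_measurable lebesgue"
          by (simp add: measurable_completion)
        show "(\<lambda>z. ennreal (x powr (- (\<eta> + 1)) * z powr \<eta>) * indicator {0..x} z) \<in> borel_measurable lebesgue"
          by measurable
      qed
      also have "(\<integral>\<^sup>+ z\<in>{x..m}. ennreal (1 / z) \<partial>lebesgue) = ennreal (ln (m / x))"
        using x by (intro nn_integral_lebesgue_has_integral has_integral_inverse) auto
      also have "(\<integral>\<^sup>+ z\<in>{0..x}. ennreal (x powr (- (\<eta> + 1)) * z powr \<eta>) \<partial>lebesgue) =
          ennreal (x powr (- (\<eta> + 1)) * (x powr (\<eta> + 1) / (\<eta> + 1)))"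
        using x \<eta> by (intro nn_integral_lebesgue_has_integral has_integral_mult_right has_integral_powr_from_0) auto
      also have "x powr (- (\<eta> + 1)) * (x powr (\<eta> + 1) / (\<eta> + 1)) = 1 / (\<eta> + 1)"
      proof -
        have "x powr (- (\<eta> + 1)) * x powr (\<eta> + 1) = 1" using x by (simp flip: powr_add)
        then show ?thesis by simp
      qed
      finally show ?thesis using x \<eta> by (simp flip: ennreal_plus)
    qed
    let ?f = "\<lambda>z. ennreal (\<bar>g z\<bar> * max x z powr (1 - \<gamma>))"
    have fm: "(\<lambda>z. ?f z * indicator {a<..b} z) \<in> borel_measurable lebesgue" if "a \<ge> 0" for a b
    proof -
      have "(\<lambda>z. ?f z * indicator {a<..b} z) = (\<lambda>z. ennreal (g0 z * max x z powr (1 - \<gamma>)) * indicator {a<..b} z)"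
        using that by (auto simp: g0 split: split_indicator)
      also have "\<dots> \<in> borel_measurable lebesgue" by measurable
      finally show ?thesis .
    qed
    have "(\<integral>\<^sup>+ z\<in>{0<..y}. ennreal (\<bar>g z\<bar> * (max x z powr (1 - \<gamma>) / (\<gamma> - 1))) \<partial>lebesgue) =
        (\<integral>\<^sup>+ z. ennreal (1 / (\<gamma> - 1)) * (?f z * indicator {0<..y} z) \<partial>lebesgue)"
    proof (rule nn_integral_cong)
      fix z
      have "ennreal (\<bar>g z\<bar> * (max x z powr (1 - \<gamma>) / (\<gamma> - 1))) = ennreal (1 / (\<gamma> - 1) * (\<bar>g z\<bar> * max x z powr (1 - \<gamma>)))"
        by simp
      also have "\<dots> = ennreal (1 / (\<gamma> - 1)) * ?f z" using \<gamma> by (intro ennreal_mult) auto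
      finally show "ennreal (\<bar>g z\<bar> * (max x z powr (1 - \<gamma>) / (\<gamma> - 1))) * indicator {0<..y} z =
          ennreal (1 / (\<gamma> - 1)) * (?f z * indicator {0<..y} z)" by (simp only: mult.assoc)
    qed
    also have "\<dots> = ennreal (1 / (\<gamma> - 1)) * (\<integral>\<^sup>+ z\<in>{0<..y}. ?f z \<partial>lebesgue)"
      by (intro nn_integral_cmult fm) auto
    also have "(\<integral>\<^sup>+ z\<in>{0<..y}. ?f z \<partial>lebesgue) = (\<integral>\<^sup>+ z\<in>{0<..m}. ?f z \<partial>lebesgue) + (\<integral>\<^sup>+ z\<in>{m<..y}. ?f z \<partial>lebesgue)"
      using my by (intro set_nn_integral_split fm) auto
    finally have int_eq: "(\<integral>\<^sup>+ z\<in>{0<..y}. ennreal (\<bar>g z\<bar> * (max x z powr (1 - \<gamma>) / (\<gamma> - 1))) \<partial>lebesgue) =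
        ennreal (1 / (\<gamma> - 1)) * ((\<integral>\<^sup>+ z\<in>{0<..m}. ?f z \<partial>lebesgue) + (\<integral>\<^sup>+ z\<in>{m<..y}. ?f z \<partial>lebesgue))" .
    define b1 where "b1 = e {m<..y} * ln (y / m) powr (1 / q)"
    define b2 where "b2 = e {0<..m} * (1 / (\<eta> + 1) + ln (m / x)) powr (1 / q)"
    have b: "b1 \<ge> 0" "b2 \<ge> 0" by (auto simp: b1_def b2_def e_def)
    have "(\<integral>\<^sup>+ z\<in>{0<..m}. ?f z \<partial>lebesgue) \<le> ennreal b2"
      unfolding b2_def using x \<eta> by (intro Hoelder Efin B2 add_nonneg_nonneg) auto
    moreover have "(\<integral>\<^sup>+ z\<in>{m<..y}. ?f z \<partial>lebesgue) \<le> ennreal b1"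
      unfolding b1_def using x my by (intro Hoelder Efin B1) auto
    ultimately have "ennreal (1 / (\<gamma> - 1)) * ((\<integral>\<^sup>+ z\<in>{0<..m}. ?f z \<partial>lebesgue) + (\<integral>\<^sup>+ z\<in>{m<..y}. ?f z \<partial>lebesgue)) \<le>
        ennreal (1 / (\<gamma> - 1)) * (ennreal b2 + ennreal b1)"
      by (intro mult_left_mono add_mono) auto
    also have "\<dots> = ennreal (1 / (\<gamma> - 1)) * ennreal (b1 + b2)"
      using b by (simp add: add.commute)
    also have "\<dots> = ennreal (1 / (\<gamma> - 1) * (b1 + b2))"
      using \<gamma> b by (intro ennreal_mult[symmetric]) auto
    finally have "(\<integral>\<^sup>+ z\<in>{0<..y}. ennreal (\<bar>g z\<bar> * (max x z powr (1 - \<gamma>) / (\<gamma> - 1))) \<partial>lebesgue) \<le>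
        ennreal (1 / (\<gamma> - 1) * (b1 + b2))"
      unfolding int_eq .
    moreover have "ennreal \<bar>U x\<bar> \<le> ennreal \<bar>U y\<bar> +
        (\<integral>\<^sup>+ z\<in>{0<..y}. ennreal (\<bar>g z\<bar> * (max x z powr (1 - \<gamma>) / (\<gamma> - 1))) \<partial>lebesgue)"
      using x my by (intro pot) auto
    ultimately have "ennreal \<bar>U x\<bar> \<le> ennreal \<bar>U y\<bar> + ennreal (1 / (\<gamma> - 1) * (b1 + b2))"
      by (meson add_left_mono order_trans)
    also have "\<dots> = ennreal (\<bar>U y\<bar> + 1 / (\<gamma> - 1) * (b1 + b2))"
      using \<gamma> b by (intro ennreal_plus[symmetric]) auto
    finally have "\<bar>U x\<bar> \<le> \<bar>U y\<bar> + 1 / (\<gamma> - 1) * (b1 + b2)"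
      using \<gamma> b by (subst (asm) ennreal_le_iff) auto
    then show ?thesis by (simp add: b1_def b2_def)
  qed
  show ?thesis
    by (intro exI[of _ "e {m<..y}"] exI[of _ "e {0<..m}"] conjI allI impI sum_e bound)
       (auto simp: e_def)
qed

section \<open>Integrating the exponential\<close>

text \<open>The factor in \<open>W\<close> is $\beta^{1/q}$; it absorbs both the constant of the kernel and the change of scale
  from $\ln r$ to \<open>t\<close>, so that the growth becomes normalised. If \<open>W\<close> were large on a whole unit interval,
  its weighted $L^p$ norm would exceed \<open>I\<close>.\<close>

lemma log_growth_rescaled:
  fixes U :: "real \<Rightarrow> real"
  assumes p: "p > 1" and q: "q > 1" and \<eta>: "\<eta> > -1" and \<gamma>: "\<gamma> > 1"
    and two: "\<And>m y. 0 < m \<Longrightarrow> m \<le> y \<Longrightarrow> \<exists>e1\<ge>0. \<exists>e2\<ge>0. e1 powr p + e2 powr p \<le> 1 \<and> (\<forall>x. 0 < x \<and> x \<le> m \<longrightarrow>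
      \<bar>U x\<bar> \<le> \<bar>U y\<bar> + (e1 * ln (y / m) powr (1 / q) + e2 * (1 / (\<eta> + 1) + ln (m / x)) powr (1 / q)) / (\<gamma> - 1))"
    and W: "\<And>r. W r = (\<eta> + 1) powr (1 / q) * (\<gamma> - 1) * \<bar>U r\<bar>"
    and I: "I > 0" "(\<integral>\<^sup>+ r\<in>{0<..}. ennreal (W r powr p * r powr \<eta>) \<partial>lebesgue) \<le> ennreal I"
    and M: "M = 2 * (\<eta> + 1) * I / (exp 1 - 1)"
  shows "log_growth p q (\<lambda>t. W (exp ((ln M - t) / (\<eta> + 1))))"
proof -
  define \<rho> where "\<rho> t = exp ((ln M - t) / (\<eta> + 1))" for t
  have M0: "M > 0" using I(1) \<eta> by (simp add: M)
  have \<rho>0: "\<rho> t > 0" for t by (simp add: \<rho>_def)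
  have \<rho>_mono: "\<rho> x \<le> \<rho> y" if "y \<le> x" for x y
    using that \<eta> by (simp add: \<rho>_def divide_right_mono)
  have ln_\<rho>: "ln (\<rho> y / \<rho> m) = (m - y) / (\<eta> + 1)" for y m
    using \<rho>0 by (subst ln_div) (auto simp: \<rho>_def diff_divide_distrib)
  have 1: "\<exists>e1\<ge>0. \<exists>e2\<ge>0. e1 powr p + e2 powr p \<le> 1 \<and>
      (\<forall>x\<ge>m. W (\<rho> x) \<le> W (\<rho> y) + e1 * (m - y) powr (1 / q) + e2 * (x - m + 1) powr (1 / q))"
    if ym: "y \<le> m" for m y
  proof -
    obtain e1 e2 where e: "e1 \<ge> 0" "e2 \<ge> 0" "e1 powr p + e2 powr p \<le> 1"
      "\<forall>x. 0 < x \<and> x \<le> \<rho> m \<longrightarrow> \<bar>U x\<bar> \<le> \<bar>U (\<rho> y)\<bar> +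
        (e1 * ln (\<rho> y / \<rho> m) powr (1 / q) + e2 * (1 / (\<eta> + 1) + ln (\<rho> m / x)) powr (1 / q)) / (\<gamma> - 1)"
      using two[OF \<rho>0 \<rho>_mono[OF ym]] by blast
    have "W (\<rho> x) \<le> W (\<rho> y) + e1 * (m - y) powr (1 / q) + e2 * (x - m + 1) powr (1 / q)" if x: "m \<le> x" for x
    proof -
      have "\<bar>U (\<rho> x)\<bar> \<le> \<bar>U (\<rho> y)\<bar> +
        (e1 * ln (\<rho> y / \<rho> m) powr (1 / q) + e2 * (1 / (\<eta> + 1) + ln (\<rho> m / \<rho> x)) powr (1 / q)) / (\<gamma> - 1)"
        using e(4) \<rho>0 \<rho>_mono[OF x] by blast
      also have "1 / (\<eta> + 1) + ln (\<rho> m / \<rho> x) = (x - m + 1) / (\<eta> + 1)"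
        unfolding ln_\<rho> by (simp add: add_divide_distrib)
      finally have "W (\<rho> x) \<le> (\<eta> + 1) powr (1 / q) * (\<gamma> - 1) * (\<bar>U (\<rho> y)\<bar> +
        (e1 * ((m - y) / (\<eta> + 1)) powr (1 / q) + e2 * ((x - m + 1) / (\<eta> + 1)) powr (1 / q)) / (\<gamma> - 1))"
        unfolding W ln_\<rho> using \<gamma> by (intro mult_left_mono) auto
      also have "\<dots> = W (\<rho> y) + e1 * (m - y) powr (1 / q) + e2 * (x - m + 1) powr (1 / q)"
        using \<eta> \<gamma> ym x by (simp add: W powr_divide field_simps)
      finally show ?thesis .
    qed
    then show ?thesis using e(1-3) by blast
  qed
  have 2: "\<exists>y. s - 1 \<le> y \<and> y \<le> s \<and> W (\<rho> y) \<le> exp (s / p)" for s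
  proof (rule ccontr)
    assume "\<not> ?thesis"
    then have big: "W (\<rho> y) > exp (s / p)" if "s - 1 \<le> y" "y \<le> s" for y
      using that by force
    define a where "a = \<rho> s"
    define b where "b = \<rho> (s - 1)"
    have ab: "0 < a" "a \<le> b" using \<rho>0 \<rho>_mono by (auto simp: a_def b_def)
    \<comment> \<open>with this value the factor 2 in M yields the integral 2 * I over a unit interval\<close>
    have pw: "\<rho> t powr (\<eta> + 1) = M * exp (- t)" for t
    proof -
      have "\<rho> t powr (\<eta> + 1) = exp (ln M - t)" using \<eta> by (simp add: \<rho>_def powr_def)
      then show ?thesis using M0 by (simp add: exp_diff exp_minus divide_inverse)
    qed
    have "exp s * r powr \<eta> \<le> W r powr p * r powr \<eta>" if r: "r \<in> {a..b}" for r
    proof -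
      define t where "t = ln M - (\<eta> + 1) * ln r"
      have r0: "r > 0" using r ab by simp
      have rt: "\<rho> t = r" using r0 \<eta> by (simp add: \<rho>_def t_def)
      have "ln a \<le> ln r" "ln r \<le> ln b" using r ab by auto
      then have "(ln M - s) / (\<eta> + 1) \<le> ln r" "ln r \<le> (ln M - (s - 1)) / (\<eta> + 1)"
        by (auto simp: a_def b_def \<rho>_def)
      then have "s - 1 \<le> t" "t \<le> s" using \<eta> by (auto simp: t_def field_simps)
      then have "exp (s / p) < W r" using big rt by metis
      then have "exp (s / p) powr p \<le> W r powr p" using p by (intro powr_mono2) auto
      moreover have "exp (s / p) powr p = exp s" using p by (simp add: powr_def)
      ultimately show ?thesis by (intro mult_right_mono) auto
    qed
    then have "(\<integral>\<^sup>+ r\<in>{a..b}. ennreal (exp s * r powr \<eta>) \<partial>lebesgue) \<le>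
        (\<integral>\<^sup>+ r\<in>{0<..}. ennreal (W r powr p * r powr \<eta>) \<partial>lebesgue)"
      using ab by (intro nn_integral_mono) (auto split: split_indicator intro!: ennreal_leI)
    also note I(2)
    also have "(\<integral>\<^sup>+ r\<in>{a..b}. ennreal (exp s * r powr \<eta>) \<partial>lebesgue) =
        ennreal (exp s * ((b powr (\<eta> + 1) - a powr (\<eta> + 1)) / (\<eta> + 1)))"
      using ab \<eta> by (intro nn_integral_lebesgue_has_integral has_integral_mult_right has_integral_powr) auto
    also have "exp s * ((b powr (\<eta> + 1) - a powr (\<eta> + 1)) / (\<eta> + 1)) = M * (exp 1 - 1) / (\<eta> + 1)"
    proof -
      have "exp s * (M * exp (- (s - 1)) - M * exp (- s)) = M * (exp (s + - (s - 1)) - exp (s + - s))"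
        unfolding exp_add by (simp add: algebra_simps)
      also have "\<dots> = M * (exp 1 - 1)" by simp
      finally show ?thesis unfolding a_def b_def pw by simp
    qed
    also have "\<dots> = 2 * I"
    proof -
      have "2 * E * I / D * D / E = 2 * I" if "E \<noteq> 0" "D \<noteq> 0" for E D :: real
        using that by simp
      from this[of "\<eta> + 1" "exp 1 - 1"] show ?thesis using \<eta> by (simp only: M) simp
    qed
    finally show False using I(1) by simp
  qed
  show ?thesis
    using 1 2 unfolding log_growth_def \<rho>_def by blast
qed

lemma summable_linear_exp: "summable (\<lambda>n. exp (c - real n) * (real n + 3))"
proof (rule summable_comparison_test'[of "\<lambda>n. 6 * exp c * exp (- 1 / 2) ^ n" 0])
  show "summable (\<lambda>n. 6 * exp c * exp (- 1 / 2 :: real) ^ n)"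
    by (intro summable_mult summable_geometric) simp
  fix n :: nat
  have "real n + 3 \<le> 6 * (1 + real n / 2)" by simp
  also have "\<dots> \<le> 6 * exp (real n / 2)" by (intro mult_left_mono exp_ge_add_one_self) auto
  finally have "exp (c - real n) * (real n + 3) \<le> exp (c - real n) * (6 * exp (real n / 2))"
    by (intro mult_left_mono) auto
  also have "\<dots> = 6 * (exp (c - real n) * exp (real n / 2))" by simp
  also have "exp (c - real n) * exp (real n / 2) = exp c * exp (real n * (- 1 / 2))"
    by (simp flip: exp_add)
  also have "exp (real n * (- 1 / 2)) = exp (- 1 / 2) ^ n" by (rule exp_of_nat_mult)
  finally show "norm (exp (c - real n) * (real n + 3)) \<le> 6 * exp c * exp (- 1 / 2) ^ n" by simp
qed

text \<open>On the \<open>n\<close>-th set of the covering $e^{W^q}/W^q \cdot r^\eta$ is at most $M e^{c-n}/r$, and $dr/r$ is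
  $dt/(\eta+1)$. A majorant \<open>\<Phi>\<close> built from intervals is measurable whatever \<open>W\<close> is.\<close>

lemma log_growth_majorant:
  fixes p q \<eta> :: real
  assumes p: "p > 1" and q: "q > 1" and pq: "1 / p + 1 / q = 1" and \<eta>: "\<eta> > -1"
  shows "\<exists>C\<ge>0. \<forall>W M. M > 0 \<longrightarrow> log_growth p q (\<lambda>t. W (exp ((ln M - t) / (\<eta> + 1)))) \<longrightarrow>
    (\<exists>\<Phi> \<in> borel_measurable lebesgue.
      (\<forall>r>0. W r \<ge> 4 \<longrightarrow> ennreal (exp (W r powr q) / W r powr q * r powr \<eta>) \<le> \<Phi> r) \<and>
      (\<integral>\<^sup>+ r. \<Phi> r \<partial>lebesgue) \<le> ennreal (C * M))"
proof -
  obtain K c where K: "K \<ge> 0" and cov: "\<And>W. log_growth p q W \<Longrightarrow> (\<exists>\<tau>. \<forall>t. W t \<ge> 4 \<longrightarrow>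
    (\<exists>n::nat. exp (W t powr q) / W t powr q \<le> exp (t + c - real n) \<and>
      (t \<in> {0..K * (real n + 3)} \<or> t \<in> {\<tau> n - K * (real n + 3)..\<tau> n + K * (real n + 3)})))"
    using log_growth_covering[OF p q pq] by blast
  define h where "h n = 3 * K / (\<eta> + 1) * (exp (c - real n) * (real n + 3))" for n :: nat
  have h: "summable h" "h n \<ge> 0" for n
    using K \<eta> unfolding h_def by (auto intro!: summable_mult summable_linear_exp)
  define C where "C = suminf h"
  have C: "C \<ge> 0" unfolding C_def by (intro suminf_nonneg h)
  have "\<exists>\<Phi> \<in> borel_measurable lebesgue.
      (\<forall>r>0. W r \<ge> 4 \<longrightarrow> ennreal (exp (W r powr q) / W r powr q * r powr \<eta>) \<le> \<Phi> r) \<and>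
      (\<integral>\<^sup>+ r. \<Phi> r \<partial>lebesgue) \<le> ennreal (C * M)"
    if M: "M > 0" and lg: "log_growth p q (\<lambda>t. W (exp ((ln M - t) / (\<eta> + 1))))" for W M
  proof -
    define \<rho> where "\<rho> t = exp ((ln M - t) / (\<eta> + 1))" for t
    have \<rho>0: "\<rho> t > 0" for t by (simp add: \<rho>_def)
    obtain \<tau> where \<tau>: "\<forall>t. W (\<rho> t) \<ge> 4 \<longrightarrow>
      (\<exists>n::nat. exp (W (\<rho> t) powr q) / W (\<rho> t) powr q \<le> exp (t + c - real n) \<and>
      (t \<in> {0..K * (real n + 3)} \<or> t \<in> {\<tau> n - K * (real n + 3)..\<tau> n + K * (real n + 3)}))"
      using cov[OF lg] unfolding \<rho>_def by blast
    define J where "J lo hi r = ennreal (1 / r) * indicator {\<rho> hi..\<rho> lo} r" for lo hi r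
    have Jm [measurable]: "J lo hi \<in> borel_measurable lebesgue" for lo hi
    proof -
      have "J lo hi \<in> borel_measurable borel" unfolding J_def[abs_def] by measurable
      then show ?thesis by (simp add: measurable_completion)
    qed
    have J_int: "(\<integral>\<^sup>+ r. J lo hi r \<partial>lebesgue) = ennreal ((hi - lo) / (\<eta> + 1))" if "lo \<le> hi" for lo hi
    proof -
      have le: "\<rho> hi \<le> \<rho> lo" using that \<eta> by (simp add: \<rho>_def divide_right_mono)
      have "(\<integral>\<^sup>+ r. J lo hi r \<partial>lebesgue) = ennreal (ln (\<rho> lo / \<rho> hi))"
        unfolding J_def using \<rho>0[of hi] le
        by (intro nn_integral_lebesgue_has_integral has_integral_inverse) auto
      also have "ln (\<rho> lo / \<rho> hi) = (hi - lo) / (\<eta> + 1)"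
        using \<rho>0 by (subst ln_div) (auto simp: \<rho>_def diff_divide_distrib)
      finally show ?thesis .
    qed
    define \<Phi>n where "\<Phi>n n r = ennreal (M * exp (c - real n)) *
      (J 0 (K * (real n + 3)) r + J (\<tau> n - K * (real n + 3)) (\<tau> n + K * (real n + 3)) r)" for n r
    define \<Phi> where "\<Phi> r = (\<Sum>n. \<Phi>n n r)" for r
    have \<Phi>n_m [measurable]: "\<Phi>n n \<in> borel_measurable lebesgue" for n
      unfolding \<Phi>n_def[abs_def] by measurable
    have "ennreal (exp (W r powr q) / W r powr q * r powr \<eta>) \<le> \<Phi> r" if r: "r > 0" and W4: "W r \<ge> 4" for r
    proof -
      define t where "t = ln M - (\<eta> + 1) * ln r"
      have rt: "\<rho> t = r" using r \<eta> by (simp add: \<rho>_def t_def)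
      obtain n where n: "exp (W r powr q) / W r powr q \<le> exp (t + c - real n)"
        "t \<in> {0..K * (real n + 3)} \<or> t \<in> {\<tau> n - K * (real n + 3)..\<tau> n + K * (real n + 3)}"
        using \<tau>[rule_format, of t] W4 unfolding rt by blast
      have mem: "J lo hi r = ennreal (1 / r)" if "t \<in> {lo..hi}" for lo hi
      proof -
        have "\<rho> hi \<le> \<rho> t" "\<rho> t \<le> \<rho> lo" using that \<eta> by (auto simp: \<rho>_def divide_right_mono)
        then show ?thesis by (simp add: J_def rt)
      qed
      have "exp (W r powr q) / W r powr q * r powr \<eta> \<le> exp (t + c - real n) * r powr \<eta>"
        using n(1) by (intro mult_right_mono) auto
      also have "\<dots> = M * exp (c - real n) * (1 / r)"
      proof -
        have "exp (t + c - real n) = exp (ln M) * exp (- ((\<eta> + 1) * ln r)) * exp (c - real n)"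
          by (simp add: t_def flip: exp_add)
        also have "exp (- ((\<eta> + 1) * ln r)) = r powr (- (\<eta> + 1))" using r by (simp add: powr_def algebra_simps)
        finally have "exp (t + c - real n) * r powr \<eta> = M * exp (c - real n) * (r powr (- (\<eta> + 1)) * r powr \<eta>)"
          using M by simp
        also have "r powr (- (\<eta> + 1)) * r powr \<eta> = 1 / r"
          using r by (simp add: powr_minus_divide flip: powr_add)
        finally show ?thesis .
      qed
      finally have "ennreal (exp (W r powr q) / W r powr q * r powr \<eta>) \<le> ennreal (M * exp (c - real n) * (1 / r))"
        by (rule ennreal_leI)
      also have "\<dots> = ennreal (M * exp (c - real n)) * ennreal (1 / r)"
        using M r by (intro ennreal_mult) auto
      also have "\<dots> \<le> \<Phi>n n r"
        unfolding \<Phi>n_def using n(2) mem by (intro mult_left_mono) auto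
      also have "\<dots> \<le> \<Phi> r"
        unfolding \<Phi>_def using sum_le_suminf[of "\<lambda>n. \<Phi>n n r" "{n}"] by simp
      finally show ?thesis .
    qed
    moreover have "(\<integral>\<^sup>+ r. \<Phi> r \<partial>lebesgue) \<le> ennreal (C * M)"
    proof -
      have "(\<integral>\<^sup>+ r. \<Phi> r \<partial>lebesgue) = (\<Sum>n. (\<integral>\<^sup>+ r. \<Phi>n n r \<partial>lebesgue))"
        unfolding \<Phi>_def by (rule nn_integral_suminf) measurable
      also have "(\<lambda>n. (\<integral>\<^sup>+ r. \<Phi>n n r \<partial>lebesgue)) = (\<lambda>n. ennreal (M * h n))"
      proof
        fix n
        let ?L = "K * (real n + 3)"
        have L: "?L \<ge> 0" using K by simp
        have "(\<integral>\<^sup>+ r. \<Phi>n n r \<partial>lebesgue) = ennreal (M * exp (c - real n)) *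
            (ennreal ((?L - 0) / (\<eta> + 1)) + ennreal ((\<tau> n + ?L - (\<tau> n - ?L)) / (\<eta> + 1)))"
          unfolding \<Phi>n_def using L by (simp add: nn_integral_cmult nn_integral_add J_int)
        also have "ennreal ((?L - 0) / (\<eta> + 1)) + ennreal ((\<tau> n + ?L - (\<tau> n - ?L)) / (\<eta> + 1)) =
            ennreal (?L / (\<eta> + 1) + 2 * ?L / (\<eta> + 1))"
          using L \<eta> by (subst ennreal_plus) auto
        also have "ennreal (M * exp (c - real n)) * \<dots> = ennreal (M * exp (c - real n) * (?L / (\<eta> + 1) + 2 * ?L / (\<eta> + 1)))"
          using L \<eta> M by (intro ennreal_mult[symmetric]) auto
        also have "M * exp (c - real n) * (?L / (\<eta> + 1) + 2 * ?L / (\<eta> + 1)) = M * h n"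
        proof -
          have "M * e * (K * l / E + 2 * (K * l) / E) = M * (3 * K / E * (e * l))" for e l E :: real
            by (simp add: add_divide_distrib[symmetric])
          then show ?thesis by (simp only: h_def)
        qed
        finally show "(\<integral>\<^sup>+ r. \<Phi>n n r \<partial>lebesgue) = ennreal (M * h n)" .
      qed
      also have "(\<Sum>n. ennreal (M * h n)) = ennreal (\<Sum>n. M * h n)"
        using M h by (intro suminf_ennreal2 summable_mult) auto
      also have "(\<Sum>n. M * h n) = C * M" using suminf_mult[OF h(1), of M] by (simp add: C_def)
      finally show ?thesis by simp
    qed
    moreover have "\<Phi> \<in> borel_measurable lebesgue" unfolding \<Phi>_def[abs_def] by measurable
    ultimately show ?thesis by blast
  qed
  with C show ?thesis by blast
qed

section \<open>The exponential inequality\<close>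

lemma wLp_norm_cases:
  assumes "p > 0"
  shows "ennpowr (wLp_norm p a f) p = (\<integral>\<^sup>+ r\<in>{0<..}. ennreal (\<bar>f r\<bar> powr p * r powr a) \<partial>lebesgue)"
    and "wLp_norm p a f \<le> 1 \<Longrightarrow> (\<integral>\<^sup>+ r\<in>{0<..}. ennreal (\<bar>f r\<bar> powr p * r powr a) \<partial>lebesgue) \<le> 1"
    and "wLp_norm p a f < top \<Longrightarrow> (\<integral>\<^sup>+ r\<in>{0<..}. ennreal (\<bar>f r\<bar> powr p * r powr a) \<partial>lebesgue) < top"
proof -
  define X where "X = (\<integral>\<^sup>+ r\<in>{0<..}. ennreal (\<bar>f r\<bar> powr p * r powr a) \<partial>lebesgue)"
  have X: "wLp_norm p a f = ennpowr X (1 / p)" by (simp add: wLp_norm_def X_def)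
  show "ennpowr (wLp_norm p a f) p = (\<integral>\<^sup>+ r\<in>{0<..}. ennreal (\<bar>f r\<bar> powr p * r powr a) \<partial>lebesgue)"
    unfolding X unfolding X_def[symmetric]
    using assms by (cases X) (auto simp: ennpowr_def powr_powr)
  show "(\<integral>\<^sup>+ r\<in>{0<..}. ennreal (\<bar>f r\<bar> powr p * r powr a) \<partial>lebesgue) \<le> 1" if "wLp_norm p a f \<le> 1"
  proof (cases X)
    case (real x)
    have "x powr (1 / p) \<le> 1" using that real by (simp add: X ennpowr_def)
    then have "(x powr (1 / p)) powr p \<le> 1 powr p" using assms by (intro powr_mono2) auto
    then have "x \<le> 1" using assms real by (simp add: powr_powr)
    then show ?thesis unfolding X_def[symmetric] using real by simp
  next
    case top
    then show ?thesis using that by (simp add: X ennpowr_def top_unique)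
  qed
  show "(\<integral>\<^sup>+ r\<in>{0<..}. ennreal (\<bar>f r\<bar> powr p * r powr a) \<partial>lebesgue) < top" if "wLp_norm p a f < top"
    using that unfolding X unfolding X_def[symmetric] by (cases X) (auto simp: ennpowr_def)
qed

theorem theorem1p3:
  fixes p \<eta> \<alpha>2 \<gamma> \<beta> :: real
  assumes "p > 1" and "\<eta> > -1"
    and "\<alpha>2 = 2 * p - 1"
    and "\<gamma> = (\<alpha>2 + (p - 1) * \<eta>) / p"
    and "\<beta> = (\<eta> + 1) * (\<gamma> - 1) powr (p / (p - 1))"
  shows "\<exists>C::real. C > 0 \<and>
    (\<forall>\<alpha>0 \<alpha>1 \<theta>. \<alpha>1 \<ge> p - 1 \<longrightarrow> \<alpha>0 \<ge> \<alpha>1 - p \<longrightarrow>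
      (\<forall>u \<in> X2 p \<alpha>0 \<alpha>1 \<alpha>2.
        wLp_norm p (\<alpha>2 + (\<theta> - \<gamma>) * p) (L_op \<theta> \<gamma> u) \<le> 1 \<longrightarrow>
        (\<integral>\<^sup>+ r \<in> {0<..}.
            ennreal (exp_tail p (\<beta> * \<bar>u r\<bar> powr (p / (p - 1)))
              / (1 + \<bar>u r\<bar>) powr (p / (p - 1)) * r powr \<eta>) \<partial>lebesgue)
          \<le> ennreal C * ennpowr (wLp_norm p \<eta> u) p))"
proof -
  note p = assms(1) and \<eta> = assms(2) and \<alpha>2 = assms(3) and \<gamma>_def = assms(4) and \<beta>_def = assms(5)
  define q where "q = p / (p - 1)"
  have q: "q > 1" and pq: "1 / p + 1 / q = 1" using p by (auto simp: q_def field_simps)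
  have pq1: "q * (p - 1) = p" using p by (simp add: q_def)
  have \<gamma>1: "\<gamma> - 1 = (p - 1) * (\<eta> + 1) / p" using p by (simp add: \<gamma>_def \<alpha>2 field_simps)
  have \<gamma>: "\<gamma> > 1"
  proof -
    have "\<gamma> - 1 > 0" unfolding \<gamma>1 using p \<eta> by (intro divide_pos_pos mult_pos_pos) auto
    then show ?thesis by simp
  qed
  have rel: "(1 - \<gamma>) * q = - (\<eta> + 1)"
  proof -
    have "(\<gamma> - 1) * q = \<eta> + 1" unfolding \<gamma>1 q_def using p by simp
    then show ?thesis by (simp add: algebra_simps)
  qed
  define B where "B = (\<eta> + 1) powr (1 / q) * (\<gamma> - 1)"
  have B: "B > 0" using \<eta> \<gamma> by (simp add: B_def)
  have Bq: "B powr q = \<beta>"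
    using \<eta> \<gamma> q by (simp add: B_def \<beta>_def powr_mult powr_powr q_def[symmetric])
  have \<beta>: "\<beta> > 0" using B Bq by (metis powr_gt_zero less_irrefl)
  obtain C1 where C1: "C1 > 0" "\<And>t. t \<ge> 0 \<Longrightarrow> exp_tail p t \<le> C1 * exp t"
    using exp_tail_le_exp[OF p] by blast
  obtain C2 where C2: "C2 \<ge> 0" and maj: "\<And>W M. M > 0 \<Longrightarrow> log_growth p q (\<lambda>t. W (exp ((ln M - t) / (\<eta> + 1)))) \<Longrightarrow>
    (\<exists>\<Phi> \<in> borel_measurable lebesgue.
      (\<forall>r>0. W r \<ge> 4 \<longrightarrow> ennreal (exp (W r powr q) / W r powr q * r powr \<eta>) \<le> \<Phi> r) \<and>
      (\<integral>\<^sup>+ r. \<Phi> r \<partial>lebesgue) \<le> ennreal (C2 * M))"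
    using log_growth_majorant[OF p q pq \<eta>] by blast
  have Gp: "Gamma p > 0" using p by (intro Gamma_real_pos) auto
  define C0 where "C0 = exp (4 powr q) / Gamma p"
  have C0: "C0 > 0" using Gp by (simp add: C0_def)
  define C where "C = B powr p * (C0 + C1 * \<beta> * (C2 * (2 * (\<eta> + 1) / (exp 1 - 1))))"
  have "C > 0"
  proof -
    have "C1 * \<beta> * (C2 * (2 * (\<eta> + 1) / (exp 1 - 1))) \<ge> 0"
      using C1 C2 \<beta> \<eta> by (intro mult_nonneg_nonneg divide_nonneg_pos) auto
    then show ?thesis unfolding C_def using B C0 by (intro mult_pos_pos) auto
  qed
  moreover have "(\<integral>\<^sup>+ r \<in> {0<..}.
            ennreal (exp_tail p (\<beta> * \<bar>u r\<bar> powr (p / (p - 1)))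
              / (1 + \<bar>u r\<bar>) powr (p / (p - 1)) * r powr \<eta>) \<partial>lebesgue)
          \<le> ennreal C * ennpowr (wLp_norm p \<eta> u) p"
    if u: "u \<in> X2 p \<alpha>0 \<alpha>1 \<alpha>2" and L: "wLp_norm p (\<alpha>2 + (\<theta> - \<gamma>) * p) (L_op \<theta> \<gamma> u) \<le> 1"
    for \<alpha>0 \<alpha>1 \<theta> u
  proof -
    define Z where "Z r = exp_tail p (\<beta> * \<bar>u r\<bar> powr q) / (1 + \<bar>u r\<bar>) powr q * r powr \<eta>" for r
    define v where "v = weak_deriv u"
    define g where "g = weak_deriv (\<lambda>s. s powr \<gamma> * v s)"
    obtain w where w: "w \<in> wLp p \<alpha>2" "has_weak_deriv 2 u w" using u by (auto simp: X2_def)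
    have uv: "has_weak_deriv 1 u v"
    proof -
      have "\<exists>v. has_weak_deriv 1 u v" using u by (auto simp: X2_def)
      then show ?thesis unfolding v_def weak_deriv_def by (rule someI_ex)
    qed
    have vw: "has_weak_deriv 1 v w" by (rule weak_deriv_of_weak_deriv[OF uv w(2)])
    have vg: "has_weak_deriv 1 (\<lambda>s. s powr \<gamma> * v s) g"
      unfolding g_def weak_deriv_def by (rule someI_ex[OF weak_deriv_powr_mult[OF vw]])
    have loc: "locally_integrable u" "locally_integrable v" "locally_integrable w" "locally_integrable g"
      using uv vw vg by (auto simp: has_weak_deriv_def)
    obtain U where U: "antideriv U v" "AE r in lebesgue. r > 0 \<longrightarrow> u r = U r"
      using weak_deriv_antideriv[OF uv] by blast
    obtain V where V: "antideriv V w" "AE r in lebesgue. r > 0 \<longrightarrow> v r = V r"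
      using weak_deriv_antideriv[OF vw] by blast
    obtain H where H: "antideriv H g" "AE r in lebesgue. r > 0 \<longrightarrow> r powr \<gamma> * v r = H r"
      using weak_deriv_antideriv[OF vg] by blast
    have "(\<integral>\<^sup>+ r\<in>{0<..}. ennreal (\<bar>w r\<bar> powr p * r powr (2 * p - 1)) \<partial>lebesgue) < top"
      using wLp_norm_cases(3)[of p \<alpha>2 w] w(1) p by (simp add: wLp_def \<alpha>2)
    then obtain K where K: "K \<ge> 0" "\<forall>r. 0 < r \<and> r \<le> 1 \<longrightarrow> \<bar>V r\<bar> \<le> K / r"
      using derivative_growth_at_0[OF p V(1) loc(3)] by blast
    have HV: "AE r in lebesgue. r > 0 \<longrightarrow> r powr \<gamma> * V r = H r"
      using V(2) H(2) by eventually_elim auto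
    have energy: "(\<integral>\<^sup>+ r\<in>{0<..}. ennreal (\<bar>g r\<bar> powr p * r powr (- (p - 1) * \<eta>)) \<partial>lebesgue) \<le> 1"
    proof -
      have "(\<integral>\<^sup>+ r\<in>{0<..}. ennreal (\<bar>L_op \<theta> \<gamma> u r\<bar> powr p * r powr (\<alpha>2 + (\<theta> - \<gamma>) * p)) \<partial>lebesgue) =
          (\<integral>\<^sup>+ r\<in>{0<..}. ennreal (\<bar>g r\<bar> powr p * r powr (- (p - 1) * \<eta>)) \<partial>lebesgue)"
      proof (rule nn_integral_cong)
        fix r :: real
        show "ennreal (\<bar>L_op \<theta> \<gamma> u r\<bar> powr p * r powr (\<alpha>2 + (\<theta> - \<gamma>) * p)) * indicator {0<..} r =
          ennreal (\<bar>g r\<bar> powr p * r powr (- (p - 1) * \<eta>)) * indicator {0<..} r"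
        proof (cases "r > 0")
          case True
          have "\<bar>L_op \<theta> \<gamma> u r\<bar> powr p = \<bar>g r\<bar> powr p * r powr (- \<theta> * p)"
            by (simp add: L_op_def g_def v_def abs_mult powr_mult powr_powr)
          then have "\<bar>L_op \<theta> \<gamma> u r\<bar> powr p * r powr (\<alpha>2 + (\<theta> - \<gamma>) * p) =
              \<bar>g r\<bar> powr p * r powr (- \<theta> * p + (\<alpha>2 + (\<theta> - \<gamma>) * p))"
            by (simp only: powr_add mult.assoc)
          also have "- \<theta> * p + (\<alpha>2 + (\<theta> - \<gamma>) * p) = - (p - 1) * \<eta>"
            using p by (simp add: \<gamma>_def \<alpha>2 field_simps)
          finally show ?thesis by simp
        qed simp
      qed
      then show ?thesis using wLp_norm_cases(2)[OF _ L] p by simp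
    qed
    have flux: "ennreal \<bar>H x\<bar> \<le> (\<integral>\<^sup>+ r\<in>{0<..x}. ennreal \<bar>g r\<bar> \<partial>lebesgue)" if "x > 0" for x
      by (rule flux_bound[OF \<gamma> H(1) loc(4) K HV that])
    have pot: "ennreal \<bar>U x\<bar> \<le> ennreal \<bar>U y\<bar> +
        (\<integral>\<^sup>+ z\<in>{0<..y}. ennreal (\<bar>g z\<bar> * (max x z powr (1 - \<gamma>) / (\<gamma> - 1))) \<partial>lebesgue)"
      if "0 < x" "x \<le> y" for x y
      by (rule potential_bound[OF \<gamma> U(1) loc(2,4) flux H(2) that])
    note two = two_scale_bound[OF p q pq \<eta> \<gamma> rel loc(4) energy pot]
    define J where "J = (\<integral>\<^sup>+ r\<in>{0<..}. ennreal (\<bar>u r\<bar> powr p * r powr \<eta>) \<partial>lebesgue)"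
    have norm: "ennpowr (wLp_norm p \<eta> u) p = J" using wLp_norm_cases(1)[of p \<eta> u] p by (simp add: J_def)
    have um: "(\<lambda>r. ennreal (\<bar>u r\<bar> powr p * r powr \<eta>) * indicator {0<..} r) \<in> borel_measurable lebesgue"
    proof -
      have [measurable]: "(\<lambda>r. indicator {0<..} r * u r) \<in> borel_measurable lebesgue"
        by (rule locally_integrable_measurable[OF loc(1)])
      have "(\<lambda>r. ennreal (\<bar>u r\<bar> powr p * r powr \<eta>) * indicator {0<..} r) =
          (\<lambda>r. ennreal (\<bar>indicator {0<..} r * u r\<bar> powr p * r powr \<eta>) * indicator {0<..} r)"
        by (auto split: split_indicator)
      also have "\<dots> \<in> borel_measurable lebesgue" by measurable
      finally show ?thesis .
    qed
    have "(\<integral>\<^sup>+ r\<in>{0<..}. ennreal (Z r) \<partial>lebesgue) \<le> ennreal C * J"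
    proof -
      \<comment> \<open>an infinite right-hand side leaves nothing to prove; for J = 0 there is no normalisation M\<close>
      consider "J = top" | "J = 0" | j where "J = ennreal j" "j > 0"
        by (cases J) (auto simp: less_le)
      then show ?thesis
      proof cases
        case 1
        then show ?thesis using \<open>C > 0\<close> by (simp add: ennreal_mult_top)
      next
        case 2
        then have "AE r in lebesgue. ennreal (\<bar>u r\<bar> powr p * r powr \<eta>) * indicator {0<..} r = 0"
          using um by (simp add: J_def nn_integral_0_iff_AE)
        then have "AE r in lebesgue. ennreal (Z r) * indicator {0<..} r = 0"
        proof eventually_elim
          fix r assume r: "ennreal (\<bar>u r\<bar> powr p * r powr \<eta>) * indicator {0<..} r = 0"
          show "ennreal (Z r) * indicator {0<..} r = 0"
          proof (cases "r > 0")
            case True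
            then have "\<bar>u r\<bar> powr p * r powr \<eta> \<le> 0" using r by (simp add: ennreal_eq_0_iff)
            then have "u r = 0" using True by (smt (verit) mult_pos_pos powr_gt_zero)
            then show ?thesis by (simp add: Z_def exp_tail_def)
          qed simp
        qed
        then have "(\<integral>\<^sup>+ r\<in>{0<..}. ennreal (Z r) \<partial>lebesgue) = (\<integral>\<^sup>+ r. 0 \<partial>(lebesgue :: real measure))"
          by (rule nn_integral_cong_AE)
        then show ?thesis by simp
      next
        case 3
        define W where "W r = B * \<bar>U r\<bar>" for r
        define I where "I = B powr p * j"
        define M where "M = 2 * (\<eta> + 1) * I / (exp 1 - 1)"
        have I: "I > 0" using 3 B by (simp add: I_def)
        have M: "M > 0" using I \<eta> by (simp add: M_def)
        have IW: "(\<integral>\<^sup>+ r\<in>{0<..}. ennreal (W r powr p * r powr \<eta>) \<partial>lebesgue) = ennreal I"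
        proof -
          have "(\<integral>\<^sup>+ r\<in>{0<..}. ennreal (W r powr p * r powr \<eta>) \<partial>lebesgue) =
              (\<integral>\<^sup>+ r. ennreal (B powr p) * (ennreal (\<bar>u r\<bar> powr p * r powr \<eta>) * indicator {0<..} r) \<partial>lebesgue)"
          proof (rule nn_integral_cong_AE)
            show "AE r in lebesgue. ennreal (W r powr p * r powr \<eta>) * indicator {0<..} r =
                ennreal (B powr p) * (ennreal (\<bar>u r\<bar> powr p * r powr \<eta>) * indicator {0<..} r)"
              using U(2)
            proof eventually_elim
              fix r :: real assume r: "r > 0 \<longrightarrow> u r = U r"
              show "ennreal (W r powr p * r powr \<eta>) * indicator {0<..} r =
                ennreal (B powr p) * (ennreal (\<bar>u r\<bar> powr p * r powr \<eta>) * indicator {0<..} r)"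
              proof (cases "r > 0")
                case True
                then have "W r powr p * r powr \<eta> = B powr p * (\<bar>u r\<bar> powr p * r powr \<eta>)"
                  using r B by (simp add: W_def powr_mult)
                then show ?thesis using True by (simp add: ennreal_mult mult.assoc)
              qed simp
            qed
          qed
          also have "\<dots> = ennreal (B powr p) * J"
            unfolding J_def by (rule nn_integral_cmult[OF um])
          also have "\<dots> = ennreal I" using 3 by (simp add: I_def ennreal_mult)
          finally show ?thesis .
        qed
        have lg: "log_growth p q (\<lambda>t. W (exp ((ln M - t) / (\<eta> + 1))))"
          by (rule log_growth_rescaled[OF p q \<eta> \<gamma> two]) (use I IW M_def in \<open>auto simp: W_def B_def\<close>)
        obtain \<Phi> where \<Phi>: "\<Phi> \<in> borel_measurable lebesgue"
          "\<forall>r>0. W r \<ge> 4 \<longrightarrow> ennreal (exp (W r powr q) / W r powr q * r powr \<eta>) \<le> \<Phi> r"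
          "(\<integral>\<^sup>+ r. \<Phi> r \<partial>lebesgue) \<le> ennreal (C2 * M)"
          using maj[OF M lg] by blast
        have "AE r in lebesgue. ennreal (Z r) * indicator {0<..} r \<le>
            ennreal (C0 * B powr p) * (ennreal (\<bar>u r\<bar> powr p * r powr \<eta>) * indicator {0<..} r) + ennreal (C1 * \<beta>) * \<Phi> r"
          using U(2)
        proof eventually_elim
          fix r :: real assume ru: "r > 0 \<longrightarrow> u r = U r"
          show "ennreal (Z r) * indicator {0<..} r \<le>
            ennreal (C0 * B powr p) * (ennreal (\<bar>u r\<bar> powr p * r powr \<eta>) * indicator {0<..} r) + ennreal (C1 * \<beta>) * \<Phi> r"
          proof (cases "r > 0")
            case r: True
            define s where "s = \<beta> * \<bar>u r\<bar> powr q"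
            have sW: "s = W r powr q" using ru r B by (simp add: s_def W_def powr_mult Bq)
            have s0: "s \<ge> 0" using \<beta> by (simp add: s_def)
            have W0: "W r \<ge> 0" using B by (simp add: W_def)
            have den: "(1 + \<bar>u r\<bar>) powr q \<ge> 1" using q by (simp add: ge_one_powr_ge_zero)
            show ?thesis
            proof (cases "W r \<ge> 4")
              case True
              \<comment> \<open>the growth estimate is used only here; the denominator is at least the q-th power of u\<close>
              have u0: "\<bar>u r\<bar> > 0" using True B ru r by (auto simp: W_def)
              have "exp_tail p s / (1 + \<bar>u r\<bar>) powr q \<le> (C1 * exp s) / (1 + \<bar>u r\<bar>) powr q"
                using C1(2)[OF s0] by (intro divide_right_mono) auto
              also have "\<dots> \<le> (C1 * exp s) / \<bar>u r\<bar> powr q"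
                using u0 C1 q by (intro divide_left_mono powr_mono2 mult_pos_pos) auto
              also have "\<dots> = C1 * \<beta> * (exp (W r powr q) / W r powr q)"
                using \<beta> u0 unfolding sW[symmetric] by (simp add: s_def)
              finally have "Z r \<le> C1 * \<beta> * (exp (W r powr q) / W r powr q) * r powr \<eta>"
                unfolding Z_def s_def[symmetric] by (intro mult_right_mono) auto
              then have "ennreal (Z r) \<le> ennreal (C1 * \<beta> * (exp (W r powr q) / W r powr q * r powr \<eta>))"
                by (intro ennreal_leI) (simp add: mult.assoc)
              also have "\<dots> = ennreal (C1 * \<beta>) * ennreal (exp (W r powr q) / W r powr q * r powr \<eta>)"
                using C1 \<beta> by (intro ennreal_mult) auto
              also have "\<dots> \<le> ennreal (C1 * \<beta>) * \<Phi> r"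
                using \<Phi>(2) r True by (intro mult_left_mono) auto
              finally show ?thesis using r by (simp add: add_increasing)
            next
              case False
              have "exp_tail p s \<le> s powr (p - 1) * exp s / Gamma p"
                by (rule exp_tail_le_powr[OF p s0])
              also have "s powr (p - 1) = W r powr p" unfolding sW powr_powr pq1 ..
              also have "W r powr p * exp s / Gamma p \<le> W r powr p * exp (4 powr q) / Gamma p"
                using False W0 q Gp by (intro divide_right_mono mult_left_mono) (auto simp: sW intro!: powr_mono2)
              also have "\<dots> = C0 * W r powr p" by (simp add: C0_def)
              finally have t: "exp_tail p s \<le> C0 * W r powr p" .
              have "exp_tail p s / (1 + \<bar>u r\<bar>) powr q \<le> C0 * W r powr p"
              proof -
                have "exp_tail p s / (1 + \<bar>u r\<bar>) powr q \<le> C0 * W r powr p / (1 + \<bar>u r\<bar>) powr q"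
                  using t by (intro divide_right_mono) auto
                also have "\<dots> \<le> C0 * W r powr p / 1"
                  using den C0 by (intro divide_left_mono) auto
                finally show ?thesis by simp
              qed
              then have "Z r \<le> C0 * W r powr p * r powr \<eta>"
                unfolding Z_def s_def[symmetric] by (intro mult_right_mono) auto
              also have "\<dots> = C0 * B powr p * (\<bar>u r\<bar> powr p * r powr \<eta>)"
                using ru r B by (simp add: W_def powr_mult)
              finally have "ennreal (Z r) \<le> ennreal (C0 * B powr p * (\<bar>u r\<bar> powr p * r powr \<eta>))"
                by (rule ennreal_leI)
              also have "\<dots> = ennreal (C0 * B powr p) * ennreal (\<bar>u r\<bar> powr p * r powr \<eta>)"
                using C0 by (intro ennreal_mult) auto
              finally show ?thesis using r by (simp add: add_increasing2)
            qed
          qed simp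
        qed
        then have "(\<integral>\<^sup>+ r\<in>{0<..}. ennreal (Z r) \<partial>lebesgue) \<le>
          (\<integral>\<^sup>+ r. ennreal (C0 * B powr p) * (ennreal (\<bar>u r\<bar> powr p * r powr \<eta>) * indicator {0<..} r) + ennreal (C1 * \<beta>) * \<Phi> r \<partial>lebesgue)"
          by (rule nn_integral_mono_AE)
        also have "\<dots> = ennreal (C0 * B powr p) * J + ennreal (C1 * \<beta>) * (\<integral>\<^sup>+ r. \<Phi> r \<partial>lebesgue)"
          using um \<Phi>(1) by (subst nn_integral_add) (auto simp: nn_integral_cmult J_def)
        also have "\<dots> \<le> ennreal (C0 * B powr p) * ennreal j + ennreal (C1 * \<beta>) * ennreal (C2 * M)"
          using \<Phi>(3) 3 by (intro add_mono mult_left_mono) auto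
        also have "\<dots> = ennreal (C0 * B powr p * j) + ennreal (C1 * \<beta> * (C2 * M))"
          using C0 C1 C2 \<beta> M 3 B by (simp only: ennreal_mult[symmetric] mult_nonneg_nonneg less_imp_le powr_ge_zero)
        also have "\<dots> = ennreal (C0 * B powr p * j + C1 * \<beta> * (C2 * M))"
          using C0 C1 C2 \<beta> M 3 B by (intro ennreal_plus[symmetric] mult_nonneg_nonneg) (auto intro: less_imp_le)
        also have "C0 * B powr p * j + C1 * \<beta> * (C2 * M) = C * j"
          by (simp add: C_def M_def I_def algebra_simps)
        also have "ennreal (C * j) = ennreal C * J"
          using \<open>C > 0\<close> 3 by (simp add: ennreal_mult)
        finally show ?thesis .
      qed
    qed
    then show ?thesis by (simp add: norm Z_def q_def)
  qed
  ultimately show ?thesis by blast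
qed

end
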